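(* Let $0<q<d\leq 2q$, let $W^{[q,d]}=(W^{[q,d]}_t)_{t\in[q,d]}$ be a $(q,d)$-Slepian process, and let $a,b\in\mathbb{R}$ be fixed. Let $[t_i,t_{i+1}]\subseteq[q,d]$ with $t_i<t_{i+1}$, put $h:=t_{i+1}-t_i$, and let $x_i,x_{i+1}\in\mathbb{R}$ with $x_i<b$ and $x_{i+1}<b+ah$. Then \begin{align*} &\mathbb{P}\left( W_t^{[q,d]} \leq b+a(t-t_i) \ \text{for all } t\in[t_i,t_{i+1}]\,\middle|\, W^{[q,d]}_{t_i}=x_i,\, W^{[q,d]}_{t_{i+1}}=x_{i+1} \right)\\ & = 1- \frac{\sqrt{qh}\,(b-x_i)}{2\sqrt{\pi}}\exp\left(\frac{q(x_{i+1}-x_i)^2}{4h}\right)\\ &\qquad \times \int_0^h \frac{1}{\sqrt{(h-s)s^3}}\exp\left[-\frac{q}{4}\left( \frac{ (b+as-x_{i})^2}{s}+\frac{ (x_{i+1}-b-as)^2}{h-s} \right)\right] \mathrm{d} s . \end{align*}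
   Context: For $0<q<d$, a $(q,d)$-Slepian process is a centered, stationary Gaussian process $W^{[q,d]}=(W^{[q,d]}_t)_{t\in[q,d]}$ with continuous sample paths and covariance function $$C(s,s+t)=\left(1-\frac{t}{q}\right)^+,\qquad q\leq s\leq s+t\leq d,$$ where $a^+=a$ if $a\geq 0$ and $a^+=0$ if $a<0$. Equivalently, in law, it is the process $\frac{1}{\sqrt{q}}(B_t-B_{t-q})_{t\in[q,d]}$ with $B$ standard Brownian motion. Conditional probabilities given $W^{[q,d]}_{s}=x,\,W^{[q,d]}_{t}=y$ are taken with respect to the (Gaussian) conditional law of the process given these values. *)

theory Defs
  imports "HOL-Probability.Probability"
begin

text \<open>Normal distributions may be degenerate (almost surely constant), as is usual for
  finite-dimensional marginals of Gaussian processes.\<close>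

definition gaussian_rv :: "'a measure \<Rightarrow> ('a \<Rightarrow> real) \<Rightarrow> bool" where
  "gaussian_rv M X \<longleftrightarrow> X \<in> borel_measurable M \<and>
     ((\<exists>\<mu> \<sigma>. \<sigma> > 0 \<and> distributed M lborel X (normal_density \<mu> \<sigma>)) \<or>
      (\<exists>\<mu>. AE \<omega> in M. X \<omega> = \<mu>))"

definition gaussian_process :: "'a measure \<Rightarrow> real set \<Rightarrow> (real \<Rightarrow> 'a \<Rightarrow> real) \<Rightarrow> bool" where
  "gaussian_process M I X \<longleftrightarrow> prob_space M \<and>
     (\<forall>F c. finite F \<and> F \<subseteq> I \<longrightarrow> gaussian_rv M (\<lambda>\<omega>. \<Sum>t\<in>F. c t * X t \<omega>))"

definition covariance :: "'a measure \<Rightarrow> ('a \<Rightarrow> real) \<Rightarrow> ('a \<Rightarrow> real) \<Rightarrow> real" where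
  "covariance M X Y =
     (LINT \<omega>|M. (X \<omega> - (LINT \<omega>'|M. X \<omega>')) * (Y \<omega> - (LINT \<omega>'|M. Y \<omega>')))"

text \<open>Strict stationarity on an index set that is not closed under translation: only shifts
  that keep the finitely many times inside the index set are considered.\<close>

definition stationary_process :: "'a measure \<Rightarrow> real set \<Rightarrow> (real \<Rightarrow> 'a \<Rightarrow> real) \<Rightarrow> bool" where
  "stationary_process M I X \<longleftrightarrow>
     (\<forall>F r. finite F \<and> F \<subseteq> I \<and> (\<lambda>t. t + r) ` F \<subseteq> I \<longrightarrow>
        distr M (Pi\<^sub>M F (\<lambda>_. borel)) (\<lambda>\<omega>. \<lambda>t\<in>F. X t \<omega>) =
        distr M (Pi\<^sub>M F (\<lambda>_. borel)) (\<lambda>\<omega>. \<lambda>t\<in>F. X (t + r) \<omega>))"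

definition slepian_process :: "'a measure \<Rightarrow> real \<Rightarrow> real \<Rightarrow> (real \<Rightarrow> 'a \<Rightarrow> real) \<Rightarrow> bool" where
  "slepian_process M q d W \<longleftrightarrow>
     gaussian_process M {q..d} W \<and>
     stationary_process M {q..d} W \<and>
     (\<forall>t\<in>{q..d}. (LINT \<omega>|M. W t \<omega>) = 0) \<and>
     (\<forall>\<omega>\<in>space M. continuous_on {q..d} (\<lambda>t. W t \<omega>)) \<and>
     (\<forall>s t. q \<le> s \<and> s \<le> s + t \<and> s + t \<le> d \<longrightarrow>
        covariance M (W s) (W (s + t)) = max 0 (1 - t / q))"

text \<open>The space of continuous paths on \<open>I\<close>, with the sigma-algebra generated by the
  coordinate maps. Paths are extensional, i.e. \<open>undefined\<close> outside \<open>I\<close>.\<close>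

definition path_space :: "real set \<Rightarrow> (real \<Rightarrow> real) measure" where
  "path_space I = restrict_space (Pi\<^sub>M I (\<lambda>_. borel)) {w. continuous_on I w}"

text \<open>\<open>\<kappa>\<close> is a regular conditional distribution of the process \<open>X\<close>, as a random continuous path,
  given \<open>(X s, X t)\<close>: \<open>\<kappa> (x, y)\<close> is the conditional law given \<open>X s = x\<close> and \<open>X t = y\<close>.\<close>

definition regular_conditional_law ::
  "'a measure \<Rightarrow> real set \<Rightarrow> (real \<Rightarrow> 'a \<Rightarrow> real) \<Rightarrow> real \<Rightarrow> real \<Rightarrow>
     (real \<times> real \<Rightarrow> (real \<Rightarrow> real) measure) \<Rightarrow> bool" where
  "regular_conditional_law M I X s t \<kappa> \<longleftrightarrow>
     \<kappa> \<in> borel \<rightarrow>\<^sub>M prob_algebra (path_space I) \<and>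
     (\<forall>A\<in>sets (path_space I). \<forall>B\<in>sets borel.
        emeasure M {\<omega>\<in>space M. (\<lambda>u\<in>I. X u \<omega>) \<in> A \<and> (X s \<omega>, X t \<omega>) \<in> B} =
        (\<integral>\<^sup>+ z\<in>B. emeasure (\<kappa> z) A \<partial>distr M borel (\<lambda>\<omega>. (X s \<omega>, X t \<omega>))))"

text \<open>A regular conditional distribution is determined only up to null sets of values \<open>(x, y)\<close>.
  To condition on individual values we take the version consisting of Gaussian laws whose mean
  and covariance functions depend continuously on \<open>(x, y)\<close>; it is unique as soon as
  \<open>(X s, X t)\<close> has a nondegenerate Gaussian distribution.\<close>

definition gaussian_conditional_law ::
  "'a measure \<Rightarrow> real set \<Rightarrow> (real \<Rightarrow> 'a \<Rightarrow> real) \<Rightarrow> real \<Rightarrow> real \<Rightarrow>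
     (real \<times> real \<Rightarrow> (real \<Rightarrow> real) measure) \<Rightarrow> bool" where
  "gaussian_conditional_law M I X s t \<kappa> \<longleftrightarrow>
     regular_conditional_law M I X s t \<kappa> \<and>
     (\<forall>z. gaussian_process (\<kappa> z) I (\<lambda>u w. w u)) \<and>
     (\<forall>u\<in>I. continuous_on UNIV (\<lambda>z. LINT w|\<kappa> z. w u)) \<and>
     (\<forall>u\<in>I. \<forall>v\<in>I. continuous_on UNIV (\<lambda>z. covariance (\<kappa> z) (\<lambda>w. w u) (\<lambda>w. w v)))"

end

theory Submission
  imports Defs
begin

text \<open>
  \<^bold>\<open>Reduction to a Brownian bridge.\<close> Since \<open>d \<le> 2 * q\<close>, the positive part in the covariance is
  never active on \<open>[q, d]\<close>: the covariance of \<open>W u\<close> and \<open>W v\<close> is \<open>1 - \<bar>u - v\<bar> / q\<close>. Disjoint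
  increments are therefore uncorrelated, with variance \<open>2 / q\<close> per unit of time. The residual
  of \<open>W u\<close> after subtracting the linear interpolation between \<open>W t\<^sub>0\<close> and \<open>W t\<^sub>1\<close> is uncorrelated with
  both end values and has the covariance of a Brownian bridge, so the conditional law is the law
  of a Brownian bridge with variance \<open>2 / q\<close> per unit of time from \<open>x\<^sub>0\<close> to \<open>x\<^sub>1\<close>
  (\<open>slepian_conditional_bridge\<close>). The conditional law is pinned down for every pair of values, and
  not only for almost every one, because its Fourier transform depends continuously on the
  values and the law of the end values charges every box (\<open>gaussian_conditional_cis\<close>).

  \<^bold>\<open>Crossing probability.\<close> Subtracting the line leaves a bridge \<open>Y\<close> from \<open>- \<alpha>\<close> to \<open>- \<beta>\<close>, where
  \<open>\<alpha> = b - x\<^sub>0\<close> and \<open>\<beta> = b + a * h - x\<^sub>1\<close> are positive, and the question is whether \<open>Y\<close> becomes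
  positive. The process \<open>Y t / (h - t)\<close> has independent increments, and for a suitable \<open>\<theta>\<close> the
  process \<open>exp (\<theta> * Y t / (h - t))\<close> is a martingale. It equals \<open>1\<close> when \<open>Y\<close> reaches \<open>0\<close> and tends to
  \<open>0\<close> at time \<open>h\<close> if \<open>Y\<close> never does, since \<open>Y h = - \<beta> < 0\<close>. Optional stopping thus identifies the
  crossing probability with the initial value \<open>exp (- \<theta> * \<alpha> / h) = exp (- q * \<alpha> * \<beta> / h)\<close>
  (\<open>brownian_bridge_crossing\<close>). Optional stopping is carried out on finite grids, where the first
  passage events are of product form; path continuity removes the overshoot in the limit.

  \<^bold>\<open>Independence.\<close> Everything about joint Gaussian laws is extracted from one principle: if
  a complex weight \<open>F\<close> satisfies \<open>E[F * cis (l * X)] = 0\<close> for all \<open>l\<close>, then \<open>E[F * g X] = 0\<close> for all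
  \<open>g\<close> for which this makes sense (\<open>fourier_uniqueness\<close>). By iteration over coordinates it
  also serves as uniqueness theorem for multivariate characteristic functions.

  \<^bold>\<open>The integral.\<close> The integrand is, up to a factor, the density of the crossing time. The slope \<open>a\<close>
  cancels, and in the variable \<open>v = sqrt ((h - s) / s)\<close> the integral is the classical integral of
  \<open>exp (- c * (\<alpha> * v - \<beta> / v)\<^sup>2)\<close>, which has an explicit antiderivative in terms of the normal
  distribution function (\<open>gaussian_bridge_integral\<close>). The right-hand side of the theorem becomes
  \<open>1 - exp (- q * \<alpha> * \<beta> / h)\<close>.
\<close>

section \<open>Uniqueness of weighted Fourier transforms\<close>

lemma norm_le_imp_integrable:
  fixes f :: "'a \<Rightarrow> 'b::{banach,second_countable_topology}" and g :: "'a \<Rightarrow> 'c::{banach,second_countable_topology}"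
  assumes "integrable M g" "f \<in> borel_measurable M" "\<And>\<omega>. norm (f \<omega>) \<le> norm (g \<omega>)"
  shows "integrable M f"
  using Bochner_Integration.integrable_bound[OF assms(1,2)] assms(3) by auto

lemma borel_measurable_cis [measurable]: "cis \<in> borel_measurable borel"
  by (intro borel_measurable_continuous_onI continuous_intros)

lemma borel_measurable_cnj [measurable]: "cnj \<in> borel_measurable borel"
  by (intro borel_measurable_continuous_onI continuous_intros)

text \<open>The positive and the negative part of \<open>F\<close>, used as densities and transported to the line by \<open>X\<close>,
have the same mass (take \<open>l = 0\<close>) and the same characteristic function, so they are the same
measure by Levy's uniqueness theorem. Allowing an unbounded \<open>g\<close> is what later gives exponential moments.\<close>

lemma fourier_uniqueness_real:
  fixes F X :: "'a \<Rightarrow> real" and g :: "real \<Rightarrow> complex"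
  assumes F: "integrable M F" and X[measurable]: "X \<in> borel_measurable M"
    and g[measurable]: "g \<in> borel_measurable borel"
    and Fg: "integrable M (\<lambda>\<omega>. F \<omega> * g (X \<omega>))"
    and zero: "\<And>l. (CLINT \<omega>|M. F \<omega> * cis (l * X \<omega>)) = 0"
  shows "(CLINT \<omega>|M. F \<omega> * g (X \<omega>)) = 0"
proof -
  have [measurable]: "F \<in> borel_measurable M" using F by auto
  define P where "P = (\<lambda>\<omega>. max 0 (F \<omega>))"
  define N where "N = (\<lambda>\<omega>. max 0 (- F \<omega>))"
  have [measurable]: "P \<in> borel_measurable M" "N \<in> borel_measurable M"
    unfolding P_def N_def by measurable
  have P0: "0 \<le> P \<omega>" and N0: "0 \<le> N \<omega>" and FPN: "F \<omega> = P \<omega> - N \<omega>"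
    and PF: "\<bar>P \<omega>\<bar> \<le> \<bar>F \<omega>\<bar>" and NF: "\<bar>N \<omega>\<bar> \<le> \<bar>F \<omega>\<bar>" for \<omega>
    by (auto simp: P_def N_def)
  have Pi: "integrable M P" and Ni: "integrable M N"
    by (rule norm_le_imp_integrable[OF F]; use PF NF in simp)+
  have int: "integrable M (\<lambda>\<omega>. P \<omega> * h (X \<omega>))" "integrable M (\<lambda>\<omega>. N \<omega> * h (X \<omega>))"
    if "integrable M (\<lambda>\<omega>. F \<omega> * h (X \<omega>))" "h \<in> borel_measurable borel" for h :: "real \<Rightarrow> complex"
    by (rule norm_le_imp_integrable[OF that(1)]; use that(2) PF NF in \<open>simp add: norm_mult mult_right_mono\<close>)+
  have intcis: "integrable M (\<lambda>\<omega>. F \<omega> * cis (l * X \<omega>))" for l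
    by (rule norm_le_imp_integrable[OF F]) (auto simp: norm_mult)
  have diff: "(CLINT \<omega>|M. F \<omega> * h (X \<omega>)) = (CLINT \<omega>|M. P \<omega> * h (X \<omega>)) - (CLINT \<omega>|M. N \<omega> * h (X \<omega>))"
    if "integrable M (\<lambda>\<omega>. F \<omega> * h (X \<omega>))" "h \<in> borel_measurable borel" for h :: "real \<Rightarrow> complex"
    by (subst Bochner_Integration.integral_diff[OF int[OF that], symmetric])
       (simp add: FPN algebra_simps)
  have eqcis: "(CLINT \<omega>|M. P \<omega> * cis (l * X \<omega>)) = (CLINT \<omega>|M. N \<omega> * cis (l * X \<omega>))" for l
    using diff[of "\<lambda>x. cis (l * x)"] intcis[of l] zero[of l] by simp
  define m where "m = (LINT \<omega>|M. P \<omega>)"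
  have mN: "(LINT \<omega>|M. N \<omega>) = m"
    using eqcis[of 0] by (simp add: m_def)
  show ?thesis
  proof (cases "m = 0")
    case True
    have "AE \<omega> in M. P \<omega> = 0" "AE \<omega> in M. N \<omega> = 0"
      using True mN integral_nonneg_eq_0_iff_AE[OF Pi] integral_nonneg_eq_0_iff_AE[OF Ni] P0 N0
      by (auto simp: m_def)
    then have "AE \<omega> in M. F \<omega> * g (X \<omega>) = 0" by eventually_elim (simp add: FPN)
    then show ?thesis by (rule integral_eq_zero_AE)
  next
    case False
    have "m \<ge> 0" unfolding m_def using P0 by (intro integral_nonneg_AE) auto
    with False have m: "m > 0" by simp
    define D where "D Q = distr (density M (\<lambda>\<omega>. ennreal (Q \<omega> / m))) borel X" for Q
    have chD: "(CLINT x|D Q. h x) = (CLINT \<omega>|M. Q \<omega> * h (X \<omega>)) / m"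
      if [measurable]: "Q \<in> borel_measurable M" and Q0: "\<And>\<omega>. Q \<omega> \<ge> 0"
        and [measurable]: "h \<in> borel_measurable borel" for Q :: "'a \<Rightarrow> real" and h :: "real \<Rightarrow> complex"
    proof -
      have "(CLINT x|D Q. h x) = (CLINT \<omega>|density M (\<lambda>\<omega>. ennreal (Q \<omega> / m)). h (X \<omega>))"
        unfolding D_def by (rule integral_distr) auto
      also have "\<dots> = (CLINT \<omega>|M. (Q \<omega> / m) *\<^sub>R h (X \<omega>))"
        using m Q0 by (subst integral_density) auto
      also have "\<dots> = (CLINT \<omega>|M. Q \<omega> * h (X \<omega>) / m)"
        by (simp add: scaleR_conv_of_real)
      finally show ?thesis by simp
    qed
    have rd: "real_distribution (D Q)"
      if [measurable]: "Q \<in> borel_measurable M" and Q0: "\<And>\<omega>. Q \<omega> \<ge> 0"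
        and "integrable M Q" "(LINT \<omega>|M. Q \<omega>) = m" for Q :: "'a \<Rightarrow> real"
    proof -
      have "prob_space (density M (\<lambda>\<omega>. ennreal (Q \<omega> / m)))"
        using that m by (intro prob_spaceI) (simp add: emeasure_density nn_integral_eq_integral ennreal_1 cong: nn_integral_cong)
      then interpret prob_space "density M (\<lambda>\<omega>. ennreal (Q \<omega> / m))" .
      show ?thesis unfolding D_def by (rule real_distribution_distr) simp
    qed
    have "D P = D N"
    proof (rule Levy_uniqueness)
      show "real_distribution (D P)" "real_distribution (D N)"
        using rd[of P] rd[of N] P0 N0 Pi Ni mN by (auto simp: m_def)
      show "char (D P) = char (D N)"
        using eqcis by (auto simp: char_def chD P0 N0 cis_conv_exp fun_eq_iff)
    qed
    then have "(CLINT \<omega>|M. P \<omega> * g (X \<omega>)) / m = (CLINT \<omega>|M. N \<omega> * g (X \<omega>)) / m"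
      using chD[of P g] chD[of N g] P0 N0 by auto
    then show ?thesis using diff[OF Fg g] m by auto
  qed
qed

text \<open>Conjugating the hypothesis at \<open>- l\<close> shows that \<open>cnj \<circ> F\<close> satisfies it as well, hence so do the real and
the imaginary part of \<open>F\<close>.\<close>

lemma fourier_uniqueness:
  fixes F :: "'a \<Rightarrow> complex" and X :: "'a \<Rightarrow> real" and g :: "real \<Rightarrow> complex"
  assumes F: "integrable M F" and X[measurable]: "X \<in> borel_measurable M"
    and g[measurable]: "g \<in> borel_measurable borel"
    and Fg: "integrable M (\<lambda>\<omega>. F \<omega> * g (X \<omega>))"
    and zero: "\<And>l. (CLINT \<omega>|M. F \<omega> * cis (l * X \<omega>)) = 0"
  shows "(CLINT \<omega>|M. F \<omega> * g (X \<omega>)) = 0"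
proof -
  have [measurable]: "F \<in> borel_measurable M" using F by auto
  have intcis: "integrable M (\<lambda>\<omega>. F \<omega> * cis (l * X \<omega>))" for l
    by (rule norm_le_imp_integrable[OF F]) (auto simp: norm_mult)
  have intcis': "integrable M (\<lambda>\<omega>. cnj (F \<omega>) * cis (l * X \<omega>))" for l
    by (rule norm_le_imp_integrable[OF F]) (auto simp: norm_mult)
  have cnj0: "(CLINT \<omega>|M. cnj (F \<omega>) * cis (l * X \<omega>)) = 0" for l
  proof -
    have "(CLINT \<omega>|M. cnj (F \<omega>) * cis (l * X \<omega>)) = (CLINT \<omega>|M. cnj (F \<omega> * cis ((- l) * X \<omega>)))"
      by (simp add: cis_cnj)
    also have "\<dots> = cnj (CLINT \<omega>|M. F \<omega> * cis ((- l) * X \<omega>))"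
      using intcis[of "- l"] by (intro integral_bounded_linear bounded_linear_cnj)
    finally show ?thesis using zero[of "- l"] by simp
  qed
  have Re0: "(CLINT \<omega>|M. Re (F \<omega>) * cis (l * X \<omega>)) = 0" for l
  proof -
    have "(CLINT \<omega>|M. Re (F \<omega>) * cis (l * X \<omega>))
       = (CLINT \<omega>|M. (F \<omega> * cis (l * X \<omega>) + cnj (F \<omega>) * cis (l * X \<omega>)) / 2)"
      by (intro Bochner_Integration.integral_cong refl)
         (simp add: complex_eq_iff algebra_simps)
    then show ?thesis using zero cnj0 intcis intcis' by simp
  qed
  have Im0: "(CLINT \<omega>|M. Im (F \<omega>) * cis (l * X \<omega>)) = 0" for l
  proof -
    have "(CLINT \<omega>|M. Im (F \<omega>) * cis (l * X \<omega>))
       = (CLINT \<omega>|M. (F \<omega> * cis (l * X \<omega>) - cnj (F \<omega>) * cis (l * X \<omega>)) * (- \<i> / 2))"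
      by (intro Bochner_Integration.integral_cong refl)
         (simp add: complex_eq_iff field_simps)
    then show ?thesis using zero cnj0 intcis intcis' by simp
  qed
  have i1: "integrable M (\<lambda>\<omega>. Re (F \<omega>) * g (X \<omega>))"
    by (rule norm_le_imp_integrable[OF Fg]) (auto simp: norm_mult abs_Re_le_cmod mult_right_mono)
  have i2: "integrable M (\<lambda>\<omega>. Im (F \<omega>) * g (X \<omega>))"
    by (rule norm_le_imp_integrable[OF Fg]) (auto simp: norm_mult abs_Im_le_cmod mult_right_mono)
  have "(CLINT \<omega>|M. F \<omega> * g (X \<omega>))
      = (CLINT \<omega>|M. Re (F \<omega>) * g (X \<omega>) + \<i> * (Im (F \<omega>) * g (X \<omega>)))"
    by (intro Bochner_Integration.integral_cong refl) (simp add: complex_eq_iff algebra_simps)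
  also have "\<dots> = (CLINT \<omega>|M. Re (F \<omega>) * g (X \<omega>)) + \<i> * (CLINT \<omega>|M. Im (F \<omega>) * g (X \<omega>))"
    using i1 i2 by simp
  finally show ?thesis
    using fourier_uniqueness_real[OF _ X g i1 Re0] fourier_uniqueness_real[OF _ X g i2 Im0] F by simp
qed

text \<open>Uniqueness for several variables reduces to one variable by absorbing the remaining exponentials,
and the indicators already obtained, into the weight \<open>F\<close>. Product events suffice because first
passage events of discrete paths have this form.\<close>

lemma fourier_uniqueness_product:
  fixes F :: "'a \<Rightarrow> complex" and X :: "'i \<Rightarrow> 'a \<Rightarrow> real"
  assumes "finite J" and "integrable M F" and "\<And>j. j \<in> J \<Longrightarrow> X j \<in> borel_measurable M"
    and "\<And>l. (CLINT \<omega>|M. F \<omega> * cis (\<Sum>j\<in>J. l j * X j \<omega>)) = 0"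
    and "\<And>j. j \<in> J \<Longrightarrow> B j \<in> sets borel"
  shows "(CLINT \<omega>|M. F \<omega> * (\<Prod>j\<in>J. indicator (B j) (X j \<omega>))) = 0"
  using assms
proof (induction J arbitrary: F rule: finite_induct)
  case empty
  then show ?case by simp
next
  case (insert i J)
  have F: "integrable M F" by fact
  have [measurable]: "X i \<in> borel_measurable M" "F \<in> borel_measurable M" "B i \<in> sets borel"
    using insert.prems by auto
  have [measurable]: "X j \<in> borel_measurable M" if "j \<in> J" for j using insert.prems that by auto
  have F': "integrable M (\<lambda>\<omega>. F \<omega> * indicator (B i) (X i \<omega>))"
    by (rule norm_le_imp_integrable[OF F]) (auto simp: norm_mult indicator_def)
  have "(CLINT \<omega>|M. (F \<omega> * indicator (B i) (X i \<omega>)) * (\<Prod>j\<in>J. indicator (B j) (X j \<omega>))) = 0"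
  proof (rule insert.IH[OF F'])
    fix l :: "'i \<Rightarrow> real"
    define S where "S \<omega> = (\<Sum>j\<in>J. l j * X j \<omega>)" for \<omega>
    have [measurable]: "S \<in> borel_measurable M" unfolding S_def by measurable
    have "(CLINT \<omega>|M. F \<omega> * cis (S \<omega>) * indicator (B i) (X i \<omega>)) = 0"
    proof (rule fourier_uniqueness)
      show "integrable M (\<lambda>\<omega>. F \<omega> * cis (S \<omega>))" "integrable M (\<lambda>\<omega>. F \<omega> * cis (S \<omega>) * indicator (B i) (X i \<omega>))"
        by (rule norm_le_imp_integrable[OF F]; auto simp: norm_mult indicator_def)+
      fix r
      have "(\<Sum>j\<in>insert i J. (l(i := r)) j * X j \<omega>) = S \<omega> + r * X i \<omega>" for \<omega>
      proof -
        have "(\<Sum>j\<in>J. (l(i := r)) j * X j \<omega>) = S \<omega>"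
          unfolding S_def using insert.hyps by (intro sum.cong) auto
        then show ?thesis using insert.hyps by simp
      qed
      then show "(CLINT \<omega>|M. F \<omega> * cis (S \<omega>) * cis (r * X i \<omega>)) = 0"
        using insert.prems(3)[of "l(i := r)"] by (simp add: mult.assoc cis_mult)
    qed auto
    then show "(CLINT \<omega>|M. F \<omega> * indicator (B i) (X i \<omega>) * cis (\<Sum>j\<in>J. l j * X j \<omega>)) = 0"
      by (simp add: S_def ac_simps)
  qed (use insert.prems in auto)
  then show ?case using insert.hyps by (simp add: ac_simps)
qed

section \<open>Gaussian processes and their finite linear combinations\<close>

definition square_integrable :: "'a measure \<Rightarrow> ('a \<Rightarrow> real) \<Rightarrow> bool" where
  "square_integrable M X \<longleftrightarrow> X \<in> borel_measurable M \<and> integrable M (\<lambda>\<omega>. (X \<omega>)\<^sup>2)"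

lemma square_integrable_mult:
  assumes "square_integrable M X" "square_integrable M Y"
  shows "integrable M (\<lambda>\<omega>. X \<omega> * Y \<omega>)"
proof -
  have "integrable M (\<lambda>\<omega>. (X \<omega>)\<^sup>2 + (Y \<omega>)\<^sup>2)"
    using assms by (auto simp: square_integrable_def)
  then show ?thesis
  proof (rule Bochner_Integration.integrable_bound)
    have "\<bar>x * y\<bar> \<le> x\<^sup>2 + y\<^sup>2" for x y :: real
    proof -
      have "2 * (\<bar>x\<bar> * \<bar>y\<bar>) \<le> x\<^sup>2 + y\<^sup>2"
        using sum_squares_bound[of "\<bar>x\<bar>" "\<bar>y\<bar>"] by simp
      moreover have "0 \<le> \<bar>x\<bar> * \<bar>y\<bar>" by simp
      ultimately show ?thesis unfolding abs_mult by linarith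
    qed
    then show "AE \<omega> in M. norm (X \<omega> * Y \<omega>) \<le> norm ((X \<omega>)\<^sup>2 + (Y \<omega>)\<^sup>2)"
      by simp
  qed (use assms in \<open>auto simp: square_integrable_def\<close>)
qed

lemma (in prob_space) square_integrable_integrable:
  "square_integrable M X \<Longrightarrow> integrable M X"
  using square_integrable_imp_integrable by (auto simp: square_integrable_def)

lemma square_integrable_scale: "square_integrable M X \<Longrightarrow> square_integrable M (\<lambda>\<omega>. c * X \<omega>)"
  by (auto simp: square_integrable_def power_mult_distrib)

lemma square_integrable_add:
  "square_integrable M X \<Longrightarrow> square_integrable M Y \<Longrightarrow> square_integrable M (\<lambda>\<omega>. X \<omega> + Y \<omega>)"
  using square_integrable_mult[of M X Y]
  by (auto simp: square_integrable_def power2_sum mult.assoc)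

lemma (in prob_space) covariance_eq:
  assumes "square_integrable M X" "square_integrable M Y"
  shows "covariance M X Y = expectation (\<lambda>\<omega>. X \<omega> * Y \<omega>) - expectation X * expectation Y"
proof -
  note [simp] = square_integrable_integrable[OF assms(1)] square_integrable_integrable[OF assms(2)]
    square_integrable_mult[OF assms]
  have "covariance M X Y = expectation (\<lambda>\<omega>. X \<omega> * Y \<omega> - expectation Y * X \<omega> - expectation X * Y \<omega>
      + expectation X * expectation Y)"
    unfolding covariance_def by (intro Bochner_Integration.integral_cong refl) (simp add: algebra_simps)
  then show ?thesis by (simp add: prob_space)
qed

lemma covariance_commute: "covariance M X Y = covariance M Y X"
  by (simp add: covariance_def mult.commute)

lemma (in prob_space) covariance_scale_left:
  "square_integrable M X \<Longrightarrow> square_integrable M Y \<Longrightarrow> covariance M (\<lambda>\<omega>. c * X \<omega>) Y = c * covariance M X Y"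
  using square_integrable_scale[of M X c]
  by (simp add: covariance_eq algebra_simps)

lemma (in prob_space) covariance_scale_right:
  "square_integrable M X \<Longrightarrow> square_integrable M Y \<Longrightarrow> covariance M X (\<lambda>\<omega>. c * Y \<omega>) = c * covariance M X Y"
  using covariance_scale_left[of Y X c] by (simp add: covariance_commute)

lemma (in prob_space) covariance_add_left:
  assumes "square_integrable M X" "square_integrable M Y" "square_integrable M Z"
  shows "covariance M (\<lambda>\<omega>. X \<omega> + Y \<omega>) Z = covariance M X Z + covariance M Y Z"
  using assms square_integrable_add[OF assms(1,2)]
    square_integrable_mult[OF assms(1,3)] square_integrable_mult[OF assms(2,3)]
    square_integrable_integrable[OF assms(1)] square_integrable_integrable[OF assms(2)]
  by (simp add: covariance_eq algebra_simps)

lemma (in prob_space) covariance_add_right: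
  assumes "square_integrable M X" "square_integrable M Y" "square_integrable M Z"
  shows "covariance M Z (\<lambda>\<omega>. X \<omega> + Y \<omega>) = covariance M Z X + covariance M Z Y"
  using covariance_add_left[OF assms] by (simp add: covariance_commute)

lemma (in prob_space) covariance_sum_right:
  assumes "square_integrable M X" "finite J" "\<And>j. j \<in> J \<Longrightarrow> square_integrable M (Y j)"
  shows "covariance M X (\<lambda>\<omega>. \<Sum>j\<in>J. c j * Y j \<omega>) = (\<Sum>j\<in>J. c j * covariance M X (Y j))
       \<and> square_integrable M (\<lambda>\<omega>. \<Sum>j\<in>J. c j * Y j \<omega>)"
  using assms(2,3)
proof (induction J rule: finite_induct)
  case empty
  then show ?case by (simp add: covariance_def square_integrable_def)
next
  case (insert j J)
  then show ?case using assms(1)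
    by (simp add: covariance_add_right covariance_scale_right square_integrable_scale square_integrable_add)
qed

text \<open>Exponential tilting: multiplying the normal density with mean \<open>\<mu>\<close> by \<open>exp (a * x)\<close> gives, up to the
constant \<open>K\<close>, the normal density with mean \<open>\<mu> + a * \<sigma>\<^sup>2\<close>; what remains is a characteristic function.\<close>

lemma exp_cis_normal_density:
  fixes a b \<mu> \<sigma> :: real
  assumes "\<sigma> > 0"
  shows "has_bochner_integral lborel (\<lambda>x. normal_density \<mu> \<sigma> x *\<^sub>R (complex_of_real (exp (a * x)) * cis (b * x)))
           (exp (a * \<mu> + a\<^sup>2 * \<sigma>\<^sup>2 / 2 - b\<^sup>2 * \<sigma>\<^sup>2 / 2) * cis (b * \<mu> + a * b * \<sigma>\<^sup>2))"
proof -
  define m where "m = \<mu> + a * \<sigma>\<^sup>2"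
  define K where "K = exp (a * \<mu> + a\<^sup>2 * \<sigma>\<^sup>2 / 2)"
  have tilt: "normal_density \<mu> \<sigma> x * exp (a * x) = K * normal_density m \<sigma> x" for x
  proof -
    have "- (x - \<mu>)\<^sup>2 / (2 * \<sigma>\<^sup>2) + a * x = (a * \<mu> + a\<^sup>2 * \<sigma>\<^sup>2 / 2) + - (x - m)\<^sup>2 / (2 * \<sigma>\<^sup>2)"
      using assms unfolding m_def by (simp add: field_simps power2_eq_square)
    then have "exp (- (x - \<mu>)\<^sup>2 / (2 * \<sigma>\<^sup>2)) * exp (a * x) = K * exp (- (x - m)\<^sup>2 / (2 * \<sigma>\<^sup>2))"
      unfolding K_def by (simp flip: exp_add)
    then show ?thesis by (simp add: normal_density_def)
  qed
  have std: "has_bochner_integral lborel (\<lambda>x. std_normal_density x *\<^sub>R cis (b * \<sigma> * x)) (exp (- (b * \<sigma>)\<^sup>2 / 2))"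
  proof -
    have "(CLINT x|std_normal_distribution. cis (b * \<sigma> * x)) = exp (- (b * \<sigma>)\<^sup>2 / 2)"
      using fun_cong[OF char_std_normal_distribution, of "b * \<sigma>"] by (simp add: char_def cis_conv_exp)
    moreover have "(CLINT x|std_normal_distribution. cis (b * \<sigma> * x))
         = (CLINT x|lborel. std_normal_density x *\<^sub>R cis (b * \<sigma> * x))"
      by (rule integral_density) auto
    moreover have "integrable lborel (\<lambda>x. std_normal_density x *\<^sub>R cis (b * \<sigma> * x))"
      by (rule norm_le_imp_integrable[OF integrable_normal_density[of 1 0]]) auto
    ultimately show ?thesis by (simp add: has_bochner_integral_iff)
  qed
  have "has_bochner_integral lborel (\<lambda>x. normal_density m \<sigma> x *\<^sub>R cis (b * x)) (cis (b * m) * exp (- (b * \<sigma>)\<^sup>2 / 2))"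
  proof (subst lborel_has_bochner_integral_real_affine_iff[where c = \<sigma> and t = m])
    have e: "normal_density m \<sigma> (m + \<sigma> * x) = std_normal_density x / \<sigma>" for x
      using assms by (simp add: normal_density_def power_mult_distrib real_sqrt_mult)
    have "has_bochner_integral lborel (\<lambda>x. (cis (b * m) / \<sigma>) * (std_normal_density x *\<^sub>R cis (b * \<sigma> * x)))
        ((cis (b * m) / \<sigma>) * exp (- (b * \<sigma>)\<^sup>2 / 2))"
      using std by (rule has_bochner_integral_mult_right)
    moreover have "(cis (b * m) / \<sigma>) * (std_normal_density x *\<^sub>R cis (b * \<sigma> * x))
        = normal_density m \<sigma> (m + \<sigma> * x) *\<^sub>R cis (b * (m + \<sigma> * x))" for x
      by (simp add: e scaleR_conv_of_real distrib_left cis_mult[symmetric] mult.assoc)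
    ultimately show "has_bochner_integral lborel (\<lambda>x. normal_density m \<sigma> (m + \<sigma> * x) *\<^sub>R cis (b * (m + \<sigma> * x)))
        ((cis (b * m) * exp (- (b * \<sigma>)\<^sup>2 / 2)) /\<^sub>R \<bar>\<sigma>\<bar>)"
      using assms by (simp add: scaleR_conv_of_real field_simps)
  qed (use assms in simp)
  then have "has_bochner_integral lborel (\<lambda>x. complex_of_real K * (normal_density m \<sigma> x *\<^sub>R cis (b * x)))
      (complex_of_real K * (cis (b * m) * exp (- (b * \<sigma>)\<^sup>2 / 2)))"
    by (rule has_bochner_integral_mult_right)
  moreover have "complex_of_real K * (normal_density m \<sigma> x *\<^sub>R cis (b * x))
      = normal_density \<mu> \<sigma> x *\<^sub>R (complex_of_real (exp (a * x)) * cis (b * x))" for x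
    using arg_cong[OF tilt[of x], of complex_of_real]
    by (simp add: scaleR_conv_of_real ac_simps del: of_real_eq_iff)
  moreover have "complex_of_real K * (cis (b * m) * exp (- (b * \<sigma>)\<^sup>2 / 2))
      = exp (a * \<mu> + a\<^sup>2 * \<sigma>\<^sup>2 / 2 - b\<^sup>2 * \<sigma>\<^sup>2 / 2) * cis (b * \<mu> + a * b * \<sigma>\<^sup>2)"
  proof -
    have "exp (a * \<mu> + a\<^sup>2 * \<sigma>\<^sup>2 / 2 - b\<^sup>2 * \<sigma>\<^sup>2 / 2) = K * exp (- (b * \<sigma>)\<^sup>2 / 2)"
      unfolding K_def by (simp add: power_mult_distrib flip: exp_add)
    moreover have "b * \<mu> + a * b * \<sigma>\<^sup>2 = b * m" by (simp add: m_def algebra_simps)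
    ultimately show ?thesis by (simp add: ac_simps)
  qed
  ultimately show ?thesis by simp
qed

text \<open>In both cases mean and variance are expressed through expectation and covariance, so that the later
formulas are the same for degenerate and nondegenerate variables.\<close>

lemma (in prob_space) gaussian_rv_cases:
  assumes "gaussian_rv M X"
  obtains (normal) \<sigma> where "\<sigma> > 0" "distributed M lborel X (normal_density (expectation X) \<sigma>)"
      "square_integrable M X" "covariance M X X = \<sigma>\<^sup>2"
    | (const) "AE \<omega> in M. X \<omega> = expectation X" "square_integrable M X" "covariance M X X = 0"
proof -
  have [measurable]: "X \<in> borel_measurable M" using assms by (simp add: gaussian_rv_def)
  from assms consider \<mu> \<sigma> where "\<sigma> > 0" "distributed M lborel X (normal_density \<mu> \<sigma>)"
    | \<mu> where "AE \<omega> in M. X \<omega> = \<mu>" by (auto simp: gaussian_rv_def)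
  then show ?thesis
  proof cases
    case 1
    have E: "expectation X = \<mu>" using 1 by (rule normal_distributed_expectation)
    have "integrable lborel (\<lambda>x. normal_density \<mu> \<sigma> x * x\<^sup>2)"
    proof -
      have "integrable lborel (\<lambda>x. normal_density \<mu> \<sigma> x * (x - \<mu>)\<^sup>2 + 2 * \<mu> * (normal_density \<mu> \<sigma> x * x)
          - \<mu>\<^sup>2 * normal_density \<mu> \<sigma> x)"
        using 1(1) by (intro Bochner_Integration.integrable_add Bochner_Integration.integrable_diff
            integrable_mult_right integrable_normal_moment integrable_normal_moment_nz_1 integrable_normal_density)
      moreover have "normal_density \<mu> \<sigma> x * (x - \<mu>)\<^sup>2 + 2 * \<mu> * (normal_density \<mu> \<sigma> x * x)
          - \<mu>\<^sup>2 * normal_density \<mu> \<sigma> x = normal_density \<mu> \<sigma> x * x\<^sup>2" for x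
        by (simp add: algebra_simps power2_eq_square)
      ultimately show ?thesis by simp
    qed
    then have "square_integrable M X"
      using distributed_integrable[OF 1(2), of "\<lambda>x. x\<^sup>2"] by (simp add: square_integrable_def)
    moreover have "covariance M X X = \<sigma>\<^sup>2"
      using normal_distributed_variance[OF 1] by (simp add: covariance_def power2_eq_square)
    ultimately show ?thesis using normal[of \<sigma>] 1 E by simp
  next
    case 2
    have E: "expectation X = \<mu>"
      using integral_cong_AE[of X M "\<lambda>_. \<mu>"] 2 by (simp add: prob_space)
    have "integrable M (\<lambda>\<omega>. (X \<omega>)\<^sup>2) \<longleftrightarrow> integrable M (\<lambda>\<omega>. \<mu>\<^sup>2)"
      using 2 by (intro integrable_cong_AE) auto
    then have "square_integrable M X" by (simp add: square_integrable_def)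
    moreover have "covariance M X X = (LINT \<omega>|M. 0)"
      unfolding covariance_def E using 2 by (intro integral_cong_AE) auto
    ultimately show ?thesis using const 2 E by simp
  qed
qed

lemma (in prob_space) gaussian_square_integrable: "gaussian_rv M X \<Longrightarrow> square_integrable M X"
  by (erule gaussian_rv_cases)

lemma (in prob_space) exp_cis_gaussian_rv:
  assumes "gaussian_rv M X"
  shows "has_bochner_integral M (\<lambda>\<omega>. complex_of_real (exp (a * X \<omega>)) * cis (b * X \<omega>))
     (exp (a * expectation X + a\<^sup>2 * covariance M X X / 2 - b\<^sup>2 * covariance M X X / 2)
       * cis (b * expectation X + a * b * covariance M X X))"
  using assms
proof (cases rule: gaussian_rv_cases)
  case (normal \<sigma>)
  let ?g = "\<lambda>x. complex_of_real (exp (a * x)) * cis (b * x)"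
  have [measurable]: "X \<in> borel_measurable M" using assms by (simp add: gaussian_rv_def)
  note h = exp_cis_normal_density[OF normal(1), of "expectation X" a b]
  have "distr M lborel X = density lborel (normal_density (expectation X) \<sigma>)"
    using normal(2) by (simp add: distributed_def)
  moreover have "has_bochner_integral (density lborel (normal_density (expectation X) \<sigma>)) ?g
     (exp (a * expectation X + a\<^sup>2 * \<sigma>\<^sup>2 / 2 - b\<^sup>2 * \<sigma>\<^sup>2 / 2) * cis (b * expectation X + a * b * \<sigma>\<^sup>2))"
    by (rule has_bochner_integral_density[OF _ _ _ h]) auto
  ultimately have "has_bochner_integral (distr M lborel X) ?g
     (exp (a * expectation X + a\<^sup>2 * \<sigma>\<^sup>2 / 2 - b\<^sup>2 * \<sigma>\<^sup>2 / 2) * cis (b * expectation X + a * b * \<sigma>\<^sup>2))"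
    by simp
  then show ?thesis
    by (simp add: has_bochner_integral_iff integrable_distr_eq integral_distr normal(4))
next
  case const
  have [measurable]: "X \<in> borel_measurable M" using assms by (simp add: gaussian_rv_def)
  have "AE \<omega> in M. complex_of_real (exp (a * X \<omega>)) * cis (b * X \<omega>)
      = complex_of_real (exp (a * expectation X)) * cis (b * expectation X)"
    using const(1) by eventually_elim (simp only:)
  then have "has_bochner_integral M (\<lambda>\<omega>. complex_of_real (exp (a * X \<omega>)) * cis (b * X \<omega>)) x \<longleftrightarrow>
      has_bochner_integral M (\<lambda>\<omega>. complex_of_real (exp (a * expectation X)) * cis (b * expectation X)) x" for x
    by (intro has_bochner_integral_cong_AE) auto
  then show ?thesis by (simp add: const(3) has_bochner_integral_iff prob_space)
qed

lemma (in prob_space) cis_gaussian_rv: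
  assumes "gaussian_rv M X"
  shows "(CLINT \<omega>|M. cis (X \<omega>)) = exp (- covariance M X X / 2) * cis (expectation X)"
  using exp_cis_gaussian_rv[OF assms, of 0 1] by (simp add: has_bochner_integral_iff)

lemma (in prob_space) exp_gaussian_rv:
  assumes "gaussian_rv M X"
  shows "integrable M (\<lambda>\<omega>. exp (X \<omega>))"
    and "expectation (\<lambda>\<omega>. exp (X \<omega>)) = exp (expectation X + covariance M X X / 2)"
  using exp_cis_gaussian_rv[OF assms, of 1 0] 
  by (simp_all add: has_bochner_integral_iff complex_of_real_integrable_eq del: of_real_exp)

text \<open>Membership in the span replaces explicit coefficient families: it is closed under addition even when
the times involved coincide, and all its members are Gaussian.\<close>

definition lin_span :: "real set \<Rightarrow> (real \<Rightarrow> 'a \<Rightarrow> real) \<Rightarrow> ('a \<Rightarrow> real) set" where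
  "lin_span I W = {(\<lambda>\<omega>. \<Sum>t\<in>F. c t * W t \<omega>) | F c. finite F \<and> F \<subseteq> I}"

lemma lin_span_base: "t \<in> I \<Longrightarrow> W t \<in> lin_span I W"
  unfolding lin_span_def by (auto intro!: exI[of _ "{t}"] exI[of _ "\<lambda>_. 1"])

lemma lin_span_scale:
  assumes "X \<in> lin_span I W" shows "(\<lambda>\<omega>. a * X \<omega>) \<in> lin_span I W"
proof -
  from assms obtain F c where "finite F" "F \<subseteq> I" "X = (\<lambda>\<omega>. \<Sum>t\<in>F. c t * W t \<omega>)"
    by (auto simp: lin_span_def)
  then show ?thesis unfolding lin_span_def
    by (auto intro!: exI[of _ F] exI[of _ "\<lambda>t. a * c t"] simp: sum_distrib_left mult.assoc)
qed

lemma lin_span_add: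
  assumes "X \<in> lin_span I W" "Y \<in> lin_span I W" shows "(\<lambda>\<omega>. X \<omega> + Y \<omega>) \<in> lin_span I W"
proof -
  from assms obtain F c G e where F: "finite F" "F \<subseteq> I" "X = (\<lambda>\<omega>. \<Sum>t\<in>F. c t * W t \<omega>)"
    and G: "finite G" "G \<subseteq> I" "Y = (\<lambda>\<omega>. \<Sum>t\<in>G. e t * W t \<omega>)"
    by (auto simp: lin_span_def)
  let ?c = "\<lambda>t. (if t \<in> F then c t else 0) + (if t \<in> G then e t else 0)"
  have "(\<Sum>t\<in>F. c t * W t \<omega>) = (\<Sum>t\<in>F \<union> G. (if t \<in> F then c t else 0) * W t \<omega>)"
    "(\<Sum>t\<in>G. e t * W t \<omega>) = (\<Sum>t\<in>F \<union> G. (if t \<in> G then e t else 0) * W t \<omega>)" for \<omega>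
    using F G by (auto intro!: sum.mono_neutral_cong_left)
  then have "(\<lambda>\<omega>. X \<omega> + Y \<omega>) = (\<lambda>\<omega>. \<Sum>t\<in>F \<union> G. ?c t * W t \<omega>)"
    using F G by (auto simp: distrib_right sum.distrib)
  moreover have "finite (F \<union> G)" "F \<union> G \<subseteq> I" using F G by auto
  ultimately show ?thesis unfolding lin_span_def by (intro CollectI exI[of _ "F \<union> G"] exI[of _ ?c]) blast
qed

lemma lin_span_diff:
  assumes "X \<in> lin_span I W" "Y \<in> lin_span I W" shows "(\<lambda>\<omega>. X \<omega> - Y \<omega>) \<in> lin_span I W"
  using lin_span_add[OF assms(1) lin_span_scale[OF assms(2), of "-1"]] by simp

lemma lin_span_sum:
  assumes "\<And>j. j \<in> J \<Longrightarrow> X j \<in> lin_span I W" shows "(\<lambda>\<omega>. \<Sum>j\<in>J. X j \<omega>) \<in> lin_span I W"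
proof (cases "finite J")
  case True
  then show ?thesis using assms
  proof (induction J rule: finite_induct)
    case empty
    then show ?case by (auto simp: lin_span_def intro: exI[of _ "{}"])
  next
    case (insert j J)
    then show ?case using lin_span_add[of "X j" I W] by simp
  qed
next
  case False
  then show ?thesis by (auto simp: lin_span_def intro: exI[of _ "{}"])
qed

lemma lin_span_gaussian: "gaussian_process M I W \<Longrightarrow> X \<in> lin_span I W \<Longrightarrow> gaussian_rv M X"
  unfolding gaussian_process_def lin_span_def by auto

lemma lin_span_square_integrable:
  "gaussian_process M I W \<Longrightarrow> X \<in> lin_span I W \<Longrightarrow> square_integrable M X"
  using lin_span_gaussian prob_space.gaussian_square_integrable by (metis gaussian_process_def)

text \<open>Means and variances of uncorrelated variables add up, and for a Gaussian variable the expectation of \<open>cis\<close>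
is the exponential of an affine function of mean and variance. All independence statements below start from this factorisation.\<close>

lemma cis_uncorrelated:
  assumes "gaussian_process M I W" "U \<in> lin_span I W" "V \<in> lin_span I W" "covariance M U V = 0"
  shows "(CLINT \<omega>|M. cis (U \<omega> + V \<omega>)) = (CLINT \<omega>|M. cis (U \<omega>)) * (CLINT \<omega>|M. cis (V \<omega>))"
proof -
  interpret prob_space M using assms(1) by (simp add: gaussian_process_def)
  have UV: "(\<lambda>\<omega>. U \<omega> + V \<omega>) \<in> lin_span I W" using assms by (intro lin_span_add)
  note g = lin_span_gaussian[OF assms(1)] and s = lin_span_square_integrable[OF assms(1)]
  have "covariance M (\<lambda>\<omega>. U \<omega> + V \<omega>) (\<lambda>\<omega>. U \<omega> + V \<omega>) = covariance M U U + covariance M V V"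
    using s[OF assms(2)] s[OF assms(3)] assms(4)
    by (simp add: covariance_add_left covariance_add_right square_integrable_add covariance_commute[of M V U])
  moreover have "expectation (\<lambda>\<omega>. U \<omega> + V \<omega>) = expectation U + expectation V"
    using s[OF assms(2)] s[OF assms(3)] by (simp add: square_integrable_integrable)
  moreover have "exp (- (covariance M U U + covariance M V V) / 2)
      = exp (- covariance M U U / 2) * exp (- covariance M V V / 2)"
    by (simp add: add_divide_distrib flip: exp_add)
  ultimately show ?thesis
    unfolding cis_gaussian_rv[OF g[OF UV]] cis_gaussian_rv[OF g[OF assms(2)]] cis_gaussian_rv[OF g[OF assms(3)]]
    by (simp only: cis_mult[symmetric] of_real_mult mult_ac)
qed

text \<open>The Cameron--Martin formula in Fourier form: the weight \<open>exp U\<close> shifts the mean of \<open>S\<close> by the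
covariance of \<open>U\<close> and \<open>S\<close> and leaves its variance unchanged. Subtracting from \<open>S\<close> its regression on \<open>U\<close>
leaves a variable \<open>R\<close> whose exponential can be averaged separately; the rest is a function of \<open>U\<close> alone.\<close>

lemma exp_cis_gaussian:
  assumes gp: "gaussian_process M I W" and U: "U \<in> lin_span I W" and S: "S \<in> lin_span I W"
  shows "(CLINT \<omega>|M. complex_of_real (exp (U \<omega>)) * cis (S \<omega>))
     = exp ((LINT \<omega>|M. U \<omega>) + covariance M U U / 2 - covariance M S S / 2) * cis ((LINT \<omega>|M. S \<omega>) + covariance M U S)"
proof -
  interpret prob_space M using gp by (simp add: gaussian_process_def)
  note g = lin_span_gaussian[OF gp] and s = lin_span_square_integrable[OF gp]
  have [measurable]: "U \<in> borel_measurable M" "S \<in> borel_measurable M"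
    using s[OF U] s[OF S] by (auto simp: square_integrable_def)
  show ?thesis using g[OF U]
  proof (cases rule: gaussian_rv_cases)
    case const
    have "(CLINT \<omega>|M. complex_of_real (exp (U \<omega>)) * cis (S \<omega>))
       = (CLINT \<omega>|M. complex_of_real (exp (expectation U)) * cis (S \<omega>))"
      by (rule integral_cong_AE) (use const(1) in auto)
    moreover have "covariance M U S = (LINT \<omega>|M. 0)"
      unfolding covariance_def using const(1) by (intro integral_cong_AE) auto
    moreover have "exp (expectation U + 0 / 2 - covariance M S S / 2)
        = exp (expectation U) * exp (- covariance M S S / 2)"
      by (simp flip: exp_add)
    ultimately show ?thesis unfolding const(3) using cis_gaussian_rv[OF g[OF S]]
      by (simp only: integral_mult_right_zero of_real_mult) simp
  next
    case (normal \<sigma>)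
    define v where "v = covariance M U U"
    have v: "v > 0" using normal v_def by simp
    \<comment> \<open>the regression coefficient of \<open>S\<close> on \<open>U\<close>\<close>
    define \<beta> where "\<beta> = covariance M U S / v"
    define R where "R \<omega> = S \<omega> + (- \<beta>) * U \<omega>" for \<omega>
    have R: "R \<in> lin_span I W" unfolding R_def[abs_def] using U S by (intro lin_span_add lin_span_scale)
    have [measurable]: "R \<in> borel_measurable M" by (simp add: R_def[abs_def])
    have UR: "covariance M U R = 0"
      unfolding R_def[abs_def] covariance_add_right[OF s[OF S] square_integrable_scale[OF s[OF U]] s[OF U]]
        covariance_scale_right[OF s[OF U] s[OF U]]
      using v by (simp add: \<beta>_def v_def)
    have SR: "S = (\<lambda>\<omega>. R \<omega> + \<beta> * U \<omega>)" by (simp add: R_def fun_eq_iff)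
    have SS: "covariance M S S = covariance M R R + \<beta>\<^sup>2 * v"
      unfolding SR using s[OF U] s[OF R] UR
      by (simp add: covariance_add_right covariance_add_left covariance_scale_right covariance_scale_left
          square_integrable_scale square_integrable_add covariance_commute[of M R U] v_def power2_eq_square)
    have ES: "expectation S = expectation R + \<beta> * expectation U"
      unfolding SR using s[OF U] s[OF R] by (simp add: square_integrable_integrable)
    define \<phi> where "\<phi> = (CLINT \<omega>|M. cis (R \<omega>))"
    have icis: "integrable M (\<lambda>\<omega>. cis (X \<omega>))" if "X \<in> borel_measurable M" for X
      using that by (intro integrable_const_bound[of _ 1]) auto
    let ?g = "\<lambda>x. complex_of_real (exp (1 * x)) * cis (\<beta> * x)"
    have hg: "has_bochner_integral M (\<lambda>\<omega>. ?g (U \<omega>))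
      (exp (1 * expectation U + 1\<^sup>2 * v / 2 - \<beta>\<^sup>2 * v / 2) * cis (\<beta> * expectation U + 1 * \<beta> * v))"
      using exp_cis_gaussian_rv[OF g[OF U], of 1 \<beta>] by (simp add: v_def)
    then have ig: "integrable M (\<lambda>\<omega>. ?g (U \<omega>))" by (simp add: has_bochner_integral_iff)
    have ig1: "integrable M (\<lambda>\<omega>. cis (R \<omega>) * ?g (U \<omega>))"
      by (rule norm_le_imp_integrable[OF ig]) (auto simp: norm_mult)
    have "(CLINT \<omega>|M. (cis (R \<omega>) - \<phi>) * ?g (U \<omega>)) = 0"
    proof (rule fourier_uniqueness)
      show "integrable M (\<lambda>\<omega>. cis (R \<omega>) - \<phi>)" using icis[of R] by simp
      show "integrable M (\<lambda>\<omega>. (cis (R \<omega>) - \<phi>) * ?g (U \<omega>))"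
        unfolding left_diff_distrib using ig1 ig by (intro Bochner_Integration.integrable_diff integrable_mult_right)
      fix l
      have "(CLINT \<omega>|M. cis (R \<omega> + l * U \<omega>)) = \<phi> * (CLINT \<omega>|M. cis (l * U \<omega>))"
        unfolding \<phi>_def using UR s[OF U] s[OF R]
        by (intro cis_uncorrelated[OF gp R lin_span_scale[OF U]])
           (simp add: covariance_scale_right covariance_commute[of M R U])
      then show "(CLINT \<omega>|M. (cis (R \<omega>) - \<phi>) * cis (l * U \<omega>)) = 0"
        using icis[of "\<lambda>\<omega>. R \<omega> + l * U \<omega>"] icis[of "\<lambda>\<omega>. l * U \<omega>"]
        by (simp add: left_diff_distrib cis_mult)
    qed auto
    then have "(CLINT \<omega>|M. cis (R \<omega>) * ?g (U \<omega>)) = \<phi> * (CLINT \<omega>|M. ?g (U \<omega>))"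
      unfolding left_diff_distrib using ig1 ig by (subst (asm) Bochner_Integration.integral_diff) auto
    also have "(\<lambda>\<omega>. cis (R \<omega>) * ?g (U \<omega>)) = (\<lambda>\<omega>. complex_of_real (exp (U \<omega>)) * cis (S \<omega>))"
      by (simp add: SR fun_eq_iff flip: cis_mult)
    also have "\<phi> * (CLINT \<omega>|M. ?g (U \<omega>))
       = (exp (- covariance M R R / 2) * exp (expectation U + v / 2 - \<beta>\<^sup>2 * v / 2))
         * (cis (expectation R) * cis (\<beta> * expectation U + \<beta> * v))"
      unfolding \<phi>_def cis_gaussian_rv[OF g[OF R]] using hg by (simp add: has_bochner_integral_iff)
    also have "\<dots> = exp (expectation U + v / 2 - covariance M S S / 2) * cis (expectation S + covariance M U S)"
      using v by (simp add: SS ES cis_mult mult_exp_exp algebra_simps add_divide_distrib diff_divide_distrib \<beta>_def)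
    finally show ?thesis by (simp add: v_def)
  qed
qed

lemma (in prob_space) gaussian_rv_shift:
  assumes "gaussian_rv M X" shows "gaussian_rv M (\<lambda>\<omega>. X \<omega> + k)"
  using assms
proof (cases rule: gaussian_rv_cases)
  case (normal \<sigma>)
  have "distributed M lborel (\<lambda>\<omega>. k + 1 * X \<omega>) (normal_density (k + 1 * expectation X) (\<bar>1\<bar> * \<sigma>))"
    using normal by (intro normal_density_affine) auto
  then show ?thesis using normal(1,3) by (auto simp: gaussian_rv_def square_integrable_def add.commute)
next
  case const
  have "AE \<omega> in M. X \<omega> + k = expectation X + k" using const(1) by eventually_elim simp
  then show ?thesis using const(2) by (auto simp: gaussian_rv_def square_integrable_def)
qed

lemma (in prob_space) covariance_shift:
  assumes "integrable M X" "integrable M Y"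
  shows "covariance M (\<lambda>\<omega>. X \<omega> - k) (\<lambda>\<omega>. Y \<omega> - l) = covariance M X Y"
  using assms by (simp add: covariance_def prob_space)

lemma gaussian_process_measurable:
  "gaussian_process M I W \<Longrightarrow> t \<in> I \<Longrightarrow> W t \<in> borel_measurable M"
  using lin_span_gaussian[OF _ lin_span_base[of t I W]] by (auto simp: gaussian_rv_def)

text \<open>By the Cameron--Martin formula, the joint Fourier transforms of the \<open>X j\<close> under the weights \<open>exp U\<close> and
\<open>exp V\<close> depend on the weights only through the covariances with the \<open>X j\<close> and the total masses. If \<open>U\<close> and \<open>V\<close>
are a later and an earlier value of a process with independent increments and the \<open>X j\<close> are its values up
to the earlier time, this is the exponential martingale property.\<close>

lemma exponential_weights_agree:
  fixes X :: "'i \<Rightarrow> 'a \<Rightarrow> real"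
  assumes gp: "gaussian_process M I W" and U: "U \<in> lin_span I W" and V: "V \<in> lin_span I W"
    and J: "finite J" and X: "\<And>j. j \<in> J \<Longrightarrow> X j \<in> lin_span I W"
    and cov: "\<And>j. j \<in> J \<Longrightarrow> covariance M U (X j) = covariance M V (X j)"
    and exponent: "(LINT \<omega>|M. U \<omega>) + covariance M U U / 2 = (LINT \<omega>|M. V \<omega>) + covariance M V V / 2"
    and B: "\<And>j. j \<in> J \<Longrightarrow> B j \<in> sets borel"
    and A: "A = {\<omega>\<in>space M. \<forall>j\<in>J. X j \<omega> \<in> B j}"
  shows "(LINT \<omega>|M. exp (U \<omega>) * indicator A \<omega>) = (LINT \<omega>|M. exp (V \<omega>) * indicator A \<omega>)"
proof -
  interpret prob_space M using gp by (simp add: gaussian_process_def)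
  note g = lin_span_gaussian[OF gp] and s = lin_span_square_integrable[OF gp]
  have [measurable]: "U \<in> borel_measurable M" "V \<in> borel_measurable M"
    using s[OF U] s[OF V] by (auto simp: square_integrable_def)
  have Xm[measurable]: "X j \<in> borel_measurable M" if "j \<in> J" for j
    using s[OF X[OF that]] by (simp add: square_integrable_def)
  have Am[measurable]: "A \<in> sets M"
    unfolding A using J B by measurable
  note iU = exp_gaussian_rv(1)[OF g[OF U]] and iV = exp_gaussian_rv(1)[OF g[OF V]]
  let ?F = "\<lambda>\<omega>. complex_of_real (exp (U \<omega>)) - complex_of_real (exp (V \<omega>))"
  have iF: "integrable M ?F" using iU iV by (intro Bochner_Integration.integrable_diff) (simp_all only: complex_of_real_integrable_eq)
  have ind: "(\<Prod>j\<in>J. indicator (B j) (X j \<omega>)) = complex_of_real (indicator A \<omega>)" if sp: "\<omega> \<in> space M" for \<omega>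
  proof (cases "\<omega> \<in> A")
    case True
    then show ?thesis by (auto simp: A)
  next
    case False
    then obtain j where "j \<in> J" "X j \<omega> \<notin> B j" using sp by (auto simp: A)
    then have "(\<Prod>j\<in>J. indicator (B j) (X j \<omega>)) = (0::complex)"
      using J by (intro prod_zero bexI[of _ j]) auto
    then show ?thesis using False by simp
  qed
  have "(CLINT \<omega>|M. ?F \<omega> * (\<Prod>j\<in>J. indicator (B j) (X j \<omega>))) = 0"
  proof (rule fourier_uniqueness_product[OF J iF Xm])
    fix l :: "'i \<Rightarrow> real"
    let ?S = "\<lambda>\<omega>. \<Sum>j\<in>J. l j * X j \<omega>"
    have S: "?S \<in> lin_span I W" using X by (intro lin_span_sum lin_span_scale) auto
    have [measurable]: "?S \<in> borel_measurable M" by measurable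
    have "covariance M U ?S = covariance M V ?S"
      using covariance_sum_right[OF s[OF U] J s[OF X], of "\<lambda>j. j"] covariance_sum_right[OF s[OF V] J s[OF X], of "\<lambda>j. j"] cov
      by simp
    then have "(CLINT \<omega>|M. complex_of_real (exp (U \<omega>)) * cis (?S \<omega>)) = (CLINT \<omega>|M. complex_of_real (exp (V \<omega>)) * cis (?S \<omega>))"
      unfolding exp_cis_gaussian[OF gp U S] exp_cis_gaussian[OF gp V S] exponent by simp
    moreover have "integrable M (\<lambda>\<omega>. complex_of_real (exp (U \<omega>)) * cis (?S \<omega>))"
      by (rule norm_le_imp_integrable[OF iU]) (auto simp: norm_mult)
    moreover have "integrable M (\<lambda>\<omega>. complex_of_real (exp (V \<omega>)) * cis (?S \<omega>))"
      by (rule norm_le_imp_integrable[OF iV]) (auto simp: norm_mult)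
    ultimately show "(CLINT \<omega>|M. ?F \<omega> * cis (?S \<omega>)) = 0"
      unfolding left_diff_distrib by (subst Bochner_Integration.integral_diff) auto
  qed (use B in auto)
  also have "(CLINT \<omega>|M. ?F \<omega> * (\<Prod>j\<in>J. indicator (B j) (X j \<omega>)))
      = (CLINT \<omega>|M. complex_of_real (exp (U \<omega>) * indicator A \<omega> - exp (V \<omega>) * indicator A \<omega>))"
    by (intro Bochner_Integration.integral_cong refl) (simp add: ind left_diff_distrib)
  also have "\<dots> = complex_of_real (LINT \<omega>|M. exp (U \<omega>) * indicator A \<omega> - exp (V \<omega>) * indicator A \<omega>)"
    by (rule integral_complex_of_real)
  also have "(LINT \<omega>|M. exp (U \<omega>) * indicator A \<omega> - exp (V \<omega>) * indicator A \<omega>)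
     = (LINT \<omega>|M. exp (U \<omega>) * indicator A \<omega>) - (LINT \<omega>|M. exp (V \<omega>) * indicator A \<omega>)"
    using iU iV by (intro Bochner_Integration.integral_diff integrable_real_mult_indicator) auto
  finally show ?thesis by simp
qed

text \<open>The factorisation of the joint characteristic function is turned into one of probabilities, one
variable at a time.\<close>

lemma uncorrelated_independent:
  assumes gp: "gaussian_process M I W" and U: "U \<in> lin_span I W" and V: "V \<in> lin_span I W"
    and UV: "covariance M U V = 0" and [measurable]: "B \<in> sets borel" "B' \<in> sets borel"
  shows "measure M {\<omega>\<in>space M. U \<omega> \<in> B \<and> V \<omega> \<in> B'}
    = measure M {\<omega>\<in>space M. U \<omega> \<in> B} * measure M {\<omega>\<in>space M. V \<omega> \<in> B'}"
proof -
  interpret prob_space M using gp by (simp add: gaussian_process_def)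
  note s = lin_span_square_integrable[OF gp]
  have [measurable]: "U \<in> borel_measurable M" "V \<in> borel_measurable M"
    using s[OF U] s[OF V] by (auto simp: square_integrable_def)
  define P where "P = prob {\<omega>\<in>space M. V \<omega> \<in> B'}"
  have ind: "(CLINT \<omega>|M. indicator D \<omega>) = complex_of_real (prob D)" if "D \<in> sets M" for D
  proof -
    have "(CLINT \<omega>|M. indicator D \<omega>) = (CLINT \<omega>|M. complex_of_real (indicator D \<omega>))"
      by (intro Bochner_Integration.integral_cong) (auto simp: indicator_def)
    then show ?thesis using that by (simp add: sets.Int_space_eq2)
  qed
  have bnd: "integrable M f" if "f \<in> borel_measurable M" "\<And>\<omega>. norm (f \<omega>) \<le> C" for f :: "'a \<Rightarrow> complex" and C
    using that by (intro integrable_const_bound[of _ C]) auto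
  have iV: "(CLINT \<omega>|M. indicator B' (V \<omega>)) = complex_of_real P"
  proof -
    have "(CLINT \<omega>|M. indicator B' (V \<omega>)) = (CLINT \<omega>|M. indicator {\<omega>\<in>space M. V \<omega> \<in> B'} \<omega>)"
      by (intro Bochner_Integration.integral_cong) (auto simp: indicator_def)
    then show ?thesis by (simp add: ind P_def)
  qed
  have iU: "(CLINT \<omega>|M. indicator B (U \<omega>)) = complex_of_real (prob {\<omega>\<in>space M. U \<omega> \<in> B})"
  proof -
    have "(CLINT \<omega>|M. indicator B (U \<omega>)) = (CLINT \<omega>|M. indicator {\<omega>\<in>space M. U \<omega> \<in> B} \<omega>)"
      by (intro Bochner_Integration.integral_cong) (auto simp: indicator_def)
    then show ?thesis by (simp add: ind)
  qed
  have iUV: "(CLINT \<omega>|M. indicator B' (V \<omega>) * indicator B (U \<omega>)) = complex_of_real (prob {\<omega>\<in>space M. U \<omega> \<in> B \<and> V \<omega> \<in> B'})"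
  proof -
    have "(CLINT \<omega>|M. indicator B' (V \<omega>) * indicator B (U \<omega>)) = (CLINT \<omega>|M. indicator {\<omega>\<in>space M. U \<omega> \<in> B \<and> V \<omega> \<in> B'} \<omega>)"
      by (intro Bochner_Integration.integral_cong) (auto simp: indicator_def)
    then show ?thesis by (simp add: ind)
  qed
  have step: "(CLINT \<omega>|M. cis (l * U \<omega>) * indicator B' (V \<omega>)) = (CLINT \<omega>|M. cis (l * U \<omega>)) * P" for l
  proof -
    define \<phi> where "\<phi> = (CLINT \<omega>|M. cis (l * U \<omega>))"
    have b1: "integrable M (\<lambda>\<omega>. cis (l * U \<omega>) * indicator B' (V \<omega>))"
      by (rule bnd[of _ 1]) (auto simp: norm_mult indicator_def)
    have b2: "integrable M (\<lambda>\<omega>. indicator B' (V \<omega>) :: complex)"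
      by (rule bnd[of _ 1]) (auto simp: indicator_def)
    have "(CLINT \<omega>|M. (cis (l * U \<omega>) - \<phi>) * indicator B' (V \<omega>)) = 0"
    proof (rule fourier_uniqueness)
      show "integrable M (\<lambda>\<omega>. cis (l * U \<omega>) - \<phi>)"
        by (intro Bochner_Integration.integrable_diff integrable_const bnd[of "\<lambda>\<omega>. cis (l * U \<omega>)" 1]) auto
      show "integrable M (\<lambda>\<omega>. (cis (l * U \<omega>) - \<phi>) * indicator B' (V \<omega>))"
        unfolding left_diff_distrib by (intro Bochner_Integration.integrable_diff b1 integrable_mult_right b2)
      fix r
      have "(CLINT \<omega>|M. cis (l * U \<omega> + r * V \<omega>)) = \<phi> * (CLINT \<omega>|M. cis (r * V \<omega>))"
        unfolding \<phi>_def using UV s[OF U] s[OF V]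
        by (intro cis_uncorrelated[OF gp lin_span_scale[OF U] lin_span_scale[OF V]])
           (simp add: covariance_scale_left covariance_scale_right square_integrable_scale)
      moreover have "integrable M (\<lambda>\<omega>. cis (l * U \<omega> + r * V \<omega>))" "integrable M (\<lambda>\<omega>. cis (r * V \<omega>))"
        by (rule bnd[of _ 1]; simp)+
      ultimately show "(CLINT \<omega>|M. (cis (l * U \<omega>) - \<phi>) * cis (r * V \<omega>)) = 0"
        by (simp add: left_diff_distrib cis_mult)
    qed auto
    then show ?thesis using b1 b2 by (simp add: left_diff_distrib iV \<phi>_def)
  qed
  have b1: "integrable M (\<lambda>\<omega>. indicator B' (V \<omega>) * indicator B (U \<omega>) :: complex)"
    by (rule bnd[of _ 1]) (auto simp: indicator_def)
  have b2: "integrable M (\<lambda>\<omega>. indicator B (U \<omega>) :: complex)"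
    by (rule bnd[of _ 1]) (auto simp: indicator_def)
  have "(CLINT \<omega>|M. (indicator B' (V \<omega>) - complex_of_real P) * indicator B (U \<omega>)) = 0"
  proof (rule fourier_uniqueness)
    show "integrable M (\<lambda>\<omega>. indicator B' (V \<omega>) - complex_of_real P)"
      by (intro Bochner_Integration.integrable_diff integrable_const bnd[of "\<lambda>\<omega>. indicator B' (V \<omega>)" 1]) (auto simp: indicator_def)
    show "integrable M (\<lambda>\<omega>. (indicator B' (V \<omega>) - complex_of_real P) * indicator B (U \<omega>))"
      unfolding left_diff_distrib by (intro Bochner_Integration.integrable_diff b1 integrable_mult_right b2)
    fix l
    have "integrable M (\<lambda>\<omega>. indicator B' (V \<omega>) * cis (l * U \<omega>))" "integrable M (\<lambda>\<omega>. cis (l * U \<omega>))"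
      by (rule bnd[of _ 1]; auto simp: norm_mult indicator_def)+
    moreover have "(CLINT \<omega>|M. indicator B' (V \<omega>) * cis (l * U \<omega>)) = complex_of_real P * (CLINT \<omega>|M. cis (l * U \<omega>))"
      using step[of l] by (simp only: mult.commute)
    ultimately show "(CLINT \<omega>|M. (indicator B' (V \<omega>) - complex_of_real P) * cis (l * U \<omega>)) = 0"
      by (simp add: left_diff_distrib)
  qed auto
  then have "(CLINT \<omega>|M. indicator B' (V \<omega>) * indicator B (U \<omega>)) = complex_of_real P * (CLINT \<omega>|M. indicator B (U \<omega>))"
    using b1 b2 by (simp add: left_diff_distrib)
  then show ?thesis unfolding iU iUV P_def by (simp add: mult.commute flip: of_real_mult)
qed

lemma (in prob_space) gaussian_rv_interval_pos:
  assumes X: "gaussian_rv M X" and v: "covariance M X X > 0" and \<delta>: "\<delta> > 0"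
  shows "prob {\<omega>\<in>space M. \<bar>X \<omega> - a\<bar> < \<delta>} > 0"
  using X
proof (cases rule: gaussian_rv_cases)
  case const
  then show ?thesis using v by simp
next
  case (normal \<sigma>)
  have [measurable]: "X \<in> borel_measurable M" using X by (simp add: gaussian_rv_def)
  let ?f = "normal_density (expectation X) \<sigma>"
  have eq: "{\<omega>\<in>space M. \<bar>X \<omega> - a\<bar> < \<delta>} = X -` {a - \<delta><..<a + \<delta>} \<inter> space M" by auto
  have "emeasure M {\<omega>\<in>space M. \<bar>X \<omega> - a\<bar> < \<delta>} = (\<integral>\<^sup>+x. ennreal (?f x) * indicator {a - \<delta><..<a + \<delta>} x \<partial>lborel)"
    unfolding eq using distributed_emeasure[OF normal(2), of "{a - \<delta><..<a + \<delta>}"] by simp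
  moreover have "(\<integral>\<^sup>+x. ennreal (?f x) * indicator {a - \<delta><..<a + \<delta>} x \<partial>lborel) \<noteq> 0"
  proof
    assume "(\<integral>\<^sup>+x. ennreal (?f x) * indicator {a - \<delta><..<a + \<delta>} x \<partial>lborel) = 0"
    then have "AE x in lborel. ennreal (?f x) * indicator {a - \<delta><..<a + \<delta>} x = 0"
      by (subst (asm) nn_integral_0_iff_AE) auto
    then have "AE x in lborel. x \<notin> {a - \<delta><..<a + \<delta>}"
    proof eventually_elim
      case (elim x)
      have "?f x > 0" by (rule normal_density_pos[OF normal(1)])
      with elim show ?case by (auto simp: indicator_def)
    qed
    then have "emeasure lborel {a - \<delta><..<a + \<delta>} = 0"
      by (subst (asm) AE_iff_measurable[of "{a - \<delta><..<a + \<delta>}"]) auto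
    then show False using \<delta> by simp
  qed
  ultimately have "emeasure M {\<omega>\<in>space M. \<bar>X \<omega> - a\<bar> < \<delta>} \<noteq> 0" by (simp only:) simp
  then show ?thesis by (simp add: emeasure_eq_measure zero_less_measure_iff)
qed

section \<open>The crossing probability of a Brownian bridge\<close>

text \<open>The crossing event \<open>C\<close> is split according to the first index \<open>k\<close> with \<open>z k > 0\<close>. On each part the weight
\<open>exp (z N)\<close> may be replaced by \<open>exp (z k)\<close>, which is at least \<open>1\<close>, and at most \<open>exp \<epsilon>\<close> unless the
path has jumped above \<open>\<epsilon>\<close>; the event \<open>O'\<close> collects these overshoots.\<close>

lemma (in prob_space) first_passage_discrete:
  fixes z :: "nat \<Rightarrow> 'a \<Rightarrow> real"
  assumes z[measurable]: "\<And>k. k \<le> N \<Longrightarrow> z k \<in> borel_measurable M"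
    and int: "\<And>k. k \<le> N \<Longrightarrow> integrable M (\<lambda>\<omega>. exp (z k \<omega>))"
    and mart: "\<And>k B A. k \<le> N \<Longrightarrow> (\<And>j. B j \<in> sets borel) \<Longrightarrow> A = {\<omega>\<in>space M. \<forall>j\<in>{..k}. z j \<omega> \<in> B j} \<Longrightarrow>
        (LINT \<omega>|M. exp (z N \<omega>) * indicator A \<omega>) = (LINT \<omega>|M. exp (z k \<omega>) * indicator A \<omega>)"
    and C: "C = {\<omega>\<in>space M. \<exists>k\<le>N. z k \<omega> > 0}"
    and "\<epsilon> > 0" and O: "O' = {\<omega>\<in>space M. \<exists>k\<le>N. (\<forall>j<k. z j \<omega> \<le> 0) \<and> z k \<omega> > \<epsilon>}"
  shows "prob C \<le> (LINT \<omega>|M. exp (z N \<omega>) * indicator C \<omega>)"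
    and "(LINT \<omega>|M. exp (z N \<omega>) * indicator C \<omega>) \<le> exp \<epsilon> * prob C + (LINT \<omega>|M. exp (z N \<omega>) * indicator O' \<omega>)"
proof -
  define A where "A k = {\<omega>\<in>space M. \<forall>j\<in>{..k}. z j \<omega> \<in> (if j < k then {..0} else {0<..})}" for k
  \<comment> \<open>first passage at \<open>k\<close> without overshoot, and with overshoot above \<open>\<epsilon>\<close>\<close>
  define S where "S k = {\<omega>\<in>space M. \<forall>j\<in>{..k}. z j \<omega> \<in> (if j < k then {..0} else {0<..\<epsilon>})}" for k
  define L where "L k = {\<omega>\<in>space M. \<forall>j\<in>{..k}. z j \<omega> \<in> (if j < k then {..0} else {\<epsilon><..})}" for k
  have A': "A k = {\<omega>\<in>space M. (\<forall>j<k. z j \<omega> \<le> 0) \<and> z k \<omega> > 0}"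
    and S': "S k = {\<omega>\<in>space M. (\<forall>j<k. z j \<omega> \<le> 0) \<and> z k \<omega> > 0 \<and> z k \<omega> \<le> \<epsilon>}"
    and L': "L k = {\<omega>\<in>space M. (\<forall>j<k. z j \<omega> \<le> 0) \<and> z k \<omega> > \<epsilon>}" for k
    unfolding A_def S_def L_def by (auto simp: le_less)
  have [measurable]: "A k \<in> sets M" "S k \<in> sets M" "L k \<in> sets M" if "k \<le> N" for k
  proof -
    have [measurable]: "z j \<in> borel_measurable M" if "j \<in> {..k}" for j
      using that \<open>k \<le> N\<close> by (intro z) auto
    have "{\<omega>\<in>space M. \<forall>j\<in>{..k}. z j \<omega> \<in> V j} \<in> sets M" if [measurable]: "\<And>j. V j \<in> sets borel" for V
      by measurable
    then show "A k \<in> sets M" "S k \<in> sets M" "L k \<in> sets M"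
      unfolding A_def S_def L_def by auto
  qed
  have disjA: "disjoint_family_on A {..N}"
    unfolding disjoint_family_on_def A' by (auto, metis linorder_neqE_nat not_le)
  have disjL: "disjoint_family_on L {..N}"
  proof -
    have "L k \<subseteq> A k" for k using \<open>\<epsilon> > 0\<close> by (auto simp: A' L')
    then show ?thesis using disjA unfolding disjoint_family_on_def by blast
  qed
  have CA: "C = (\<Union>k\<in>{..N}. A k)"
  proof -
    have "\<exists>k\<le>N. (\<forall>j<k. z j \<omega> \<le> 0) \<and> z k \<omega> > 0" if "k \<le> N" "z k \<omega> > 0" for k \<omega>
    proof -
      define k0 where "k0 = (LEAST k. z k \<omega> > 0)"
      have "z k0 \<omega> > 0" "k0 \<le> k" unfolding k0_def using that by (auto intro: LeastI Least_le)
      moreover have "z j \<omega> \<le> 0" if "j < k0" for j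
        using not_less_Least[of j "\<lambda>k. z k \<omega> > 0"] that unfolding k0_def by auto
      ultimately show ?thesis using that by (intro exI[of _ k0]) auto
    qed
    then show ?thesis unfolding C A' by (fastforce simp: Bex_def)
  qed
  have OL: "O' = (\<Union>k\<in>{..N}. L k)" unfolding O L' by auto
  have indC: "indicator C \<omega> = (\<Sum>k\<le>N. indicator (A k) \<omega> :: real)" for \<omega>
    unfolding CA using indicator_UN_disjoint[OF _ disjA] by simp
  have indO: "indicator O' \<omega> = (\<Sum>k\<le>N. indicator (L k) \<omega> :: real)" for \<omega>
    unfolding OL using indicator_UN_disjoint[OF _ disjL] by simp
  have im: "integrable M (\<lambda>\<omega>. exp (z k \<omega>) * indicator X \<omega>)" if "k \<le> N" "X \<in> sets M" for k X
    using int[OF that(1)] that(2) by (rule integrable_real_mult_indicator[rotated])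
  have ind[simp]: "integrable M (indicat_real (A k))" if "k \<le> N" for k
    using that by (intro integrable_real_indicator) (auto simp: emeasure_eq_measure)
  have EC: "(LINT \<omega>|M. exp (z N \<omega>) * indicator C \<omega>) = (\<Sum>k\<le>N. LINT \<omega>|M. exp (z N \<omega>) * indicator (A k) \<omega>)"
    unfolding indC sum_distrib_left using im by (intro Bochner_Integration.integral_sum) auto
  have EO: "(LINT \<omega>|M. exp (z N \<omega>) * indicator O' \<omega>) = (\<Sum>k\<le>N. LINT \<omega>|M. exp (z N \<omega>) * indicator (L k) \<omega>)"
    unfolding indO sum_distrib_left using im by (intro Bochner_Integration.integral_sum) auto
  have PC: "prob C = (\<Sum>k\<le>N. prob (A k))"
    unfolding CA using disjA by (intro finite_measure_finite_Union) auto
  have martA: "(LINT \<omega>|M. exp (z N \<omega>) * indicator (A k) \<omega>) = (LINT \<omega>|M. exp (z k \<omega>) * indicator (A k) \<omega>)" if "k \<le> N" for k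
    by (rule mart[OF that _ A_def]) auto
  have martS: "(LINT \<omega>|M. exp (z N \<omega>) * indicator (S k) \<omega>) = (LINT \<omega>|M. exp (z k \<omega>) * indicator (S k) \<omega>)" if "k \<le> N" for k
    by (rule mart[OF that _ S_def]) auto
  have lower: "prob (A k) \<le> (LINT \<omega>|M. exp (z N \<omega>) * indicator (A k) \<omega>)" if "k \<le> N" for k
  proof -
    have "(LINT \<omega>|M. indicator (A k) \<omega>) \<le> (LINT \<omega>|M. exp (z k \<omega>) * indicator (A k) \<omega>)"
    proof (rule integral_mono)
      show "indicator (A k) \<omega> \<le> exp (z k \<omega>) * indicator (A k) \<omega>" for \<omega>
        by (auto simp: A' indicator_def)
    qed (use im that in auto)
    then show ?thesis using that by (simp add: martA)
  qed
  have upper: "(LINT \<omega>|M. exp (z N \<omega>) * indicator (A k) \<omega>)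
     \<le> exp \<epsilon> * prob (A k) + (LINT \<omega>|M. exp (z N \<omega>) * indicator (L k) \<omega>)" if "k \<le> N" for k
  proof -
    have "(LINT \<omega>|M. exp (z N \<omega>) * indicator (A k) \<omega>)
      = (LINT \<omega>|M. exp (z N \<omega>) * indicator (S k) \<omega> + exp (z N \<omega>) * indicator (L k) \<omega>)"
      by (intro Bochner_Integration.integral_cong refl) (use \<open>\<epsilon> > 0\<close> in \<open>auto simp: A' S' L' indicator_def\<close>)
    also have "\<dots> = (LINT \<omega>|M. exp (z k \<omega>) * indicator (S k) \<omega>) + (LINT \<omega>|M. exp (z N \<omega>) * indicator (L k) \<omega>)"
      using im that by (simp add: martS)
    also have "(LINT \<omega>|M. exp (z k \<omega>) * indicator (S k) \<omega>) \<le> (LINT \<omega>|M. exp \<epsilon> * indicator (A k) \<omega>)"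
    proof (rule integral_mono)
      show "exp (z k \<omega>) * indicator (S k) \<omega> \<le> exp \<epsilon> * indicator (A k) \<omega>" for \<omega>
        by (auto simp: A' S' indicator_def)
    qed (use im that in auto)
    finally show ?thesis using that by simp
  qed
  show "prob C \<le> (LINT \<omega>|M. exp (z N \<omega>) * indicator C \<omega>)"
    unfolding PC EC using lower by (intro sum_mono) auto
  show "(LINT \<omega>|M. exp (z N \<omega>) * indicator C \<omega>) \<le> exp \<epsilon> * prob C + (LINT \<omega>|M. exp (z N \<omega>) * indicator O' \<omega>)"
    unfolding PC EC EO sum_distrib_left sum.distrib[symmetric] using upper by (intro sum_mono) auto
qed

lemma grid_point_in_interval:
  assumes "T > 0" "k \<le> Suc n" shows "real k * T / real (Suc n) \<in> {0..T}"
proof -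
  have "real k * T \<le> real (Suc n) * T" using assms by (intro mult_right_mono) auto
  then show ?thesis using assms by (simp add: field_simps)
qed

lemma eventually_grid_small:
  assumes "T > 0" "\<delta> > (0::real)" shows "eventually (\<lambda>n. T / real (Suc n) < \<delta>) sequentially"
proof -
  have "(\<lambda>n. T / real (Suc n)) \<longlonglongrightarrow> 0"
    using tendsto_mult_right_zero[OF LIMSEQ_inverse_real_of_nat, of T] by (simp add: divide_inverse)
  then show ?thesis using assms order_tendstoD(2) by blast
qed

lemma eventually_grid_hits:
  fixes f :: "real \<Rightarrow> real"
  assumes T: "T > 0" and f: "continuous_on {0..T} f" and t: "t \<in> {0..T}" "f t > 0"
  shows "eventually (\<lambda>n. \<exists>k\<le>Suc n. f (real k * T / real (Suc n)) > 0) sequentially"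
proof -
  obtain \<delta> where \<delta>: "\<delta> > 0" "\<And>s. s \<in> {0..T} \<Longrightarrow> dist s t < \<delta> \<Longrightarrow> dist (f s) (f t) < f t"
    using f t unfolding continuous_on_iff by metis
  show ?thesis using eventually_grid_small[OF T \<delta>(1)]
  proof eventually_elim
    case (elim n)
    define r where "r = t * real (Suc n) / T"
    define k where "k = nat \<lfloor>r\<rfloor>"
    have "t * real (Suc n) \<le> T * real (Suc n)" using t by (intro mult_right_mono) auto
    then have r: "0 \<le> r" "r \<le> real (Suc n)" using T t by (auto simp: r_def field_simps)
    have k: "real k \<le> r" "r < real k + 1" using r(1) by (auto simp: k_def)
    then have kN: "k \<le> Suc n" using r(2) by simp
    have "t = r * T / real (Suc n)" using T by (simp add: r_def)
    then have "t - real k * T / real (Suc n) = (r - real k) * (T / real (Suc n))"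
      by (simp add: algebra_simps diff_divide_distrib)
    moreover have "0 \<le> (r - real k) * (T / real (Suc n))" "(r - real k) * (T / real (Suc n)) \<le> 1 * (T / real (Suc n))"
      using k T mult_right_mono[of "r - real k" 1 "T / real (Suc n)"] by auto
    ultimately have "dist (real k * T / real (Suc n)) t < \<delta>" using elim by (simp add: dist_real_def)
    from \<delta>(2)[OF grid_point_in_interval[OF T kN] this] have "f (real k * T / real (Suc n)) > 0"
      by (auto simp: dist_real_def)
    with kN show ?case by blast
  qed
qed

lemma eventually_grid_no_overshoot:
  fixes f :: "real \<Rightarrow> real"
  assumes T: "T > 0" and f: "continuous_on {0..T} f" and f0: "f 0 \<le> 0" and e: "\<epsilon> > 0"
  shows "eventually (\<lambda>n. \<not> (\<exists>k\<le>Suc n. (\<forall>j<k. f (real j * T / real (Suc n)) \<le> 0) \<and> f (real k * T / real (Suc n)) > \<epsilon>)) sequentially"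
proof -
  have "uniformly_continuous_on {0..T} f" using f by (intro compact_uniformly_continuous) auto
  then obtain \<delta> where \<delta>: "\<delta> > 0" "\<And>s t. s \<in> {0..T} \<Longrightarrow> t \<in> {0..T} \<Longrightarrow> dist t s < \<delta> \<Longrightarrow> dist (f t) (f s) < \<epsilon>"
    using e unfolding uniformly_continuous_on_def by metis
  show ?thesis using eventually_grid_small[OF T \<delta>(1)]
  proof eventually_elim
    case (elim n)
    show ?case
    proof (intro notI, elim exE conjE)
      fix k assume k: "k \<le> Suc n" "\<forall>j<k. f (real j * T / real (Suc n)) \<le> 0" "f (real k * T / real (Suc n)) > \<epsilon>"
      show False
      proof (cases k)
        case 0
        then show False using k f0 e by simp
      next
        case (Suc j)
        have "dist (real k * T / real (Suc n)) (real j * T / real (Suc n)) = T / real (Suc n)"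
        proof -
          have "real k * T / real (Suc n) - real j * T / real (Suc n) = T / real (Suc n)"
            by (simp add: Suc add_divide_distrib distrib_right)
          then show ?thesis using T by (simp add: dist_real_def)
        qed
        then have "dist (f (real k * T / real (Suc n))) (f (real j * T / real (Suc n))) < \<epsilon>"
          using k Suc elim by (intro \<delta>(2) grid_point_in_interval[OF T]) auto
        moreover have "f (real j * T / real (Suc n)) \<le> 0" using k Suc by auto
        ultimately show False using k(3) by (auto simp: dist_real_def)
      qed
    qed
  qed
qed

lemma crossing_measurable:
  fixes Z :: "real \<Rightarrow> 'a \<Rightarrow> real"
  assumes T: "T > 0" and Z: "\<And>t. t \<in> {0..T} \<Longrightarrow> Z t \<in> borel_measurable M"
    and cont: "\<And>\<omega>. \<omega> \<in> space M \<Longrightarrow> continuous_on {0..T} (\<lambda>t. Z t \<omega>)"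
  shows "{\<omega>\<in>space M. \<exists>t\<in>{0..T}. Z t \<omega> > 0} \<in> sets M"
proof -
  have [measurable]: "Z (real k * T / real (Suc n)) \<in> borel_measurable M" if "k \<le> Suc n" for k n
    using Z grid_point_in_interval[OF T that] by blast
  have "{\<omega>\<in>space M. \<exists>t\<in>{0..T}. Z t \<omega> > 0}
     = (\<Union>n. {\<omega>\<in>space M. \<exists>k\<in>{..Suc n}. Z (real k * T / real (Suc n)) \<omega> > 0})"
  proof (intro set_eqI iffI)
    fix \<omega> assume "\<omega> \<in> {\<omega>\<in>space M. \<exists>t\<in>{0..T}. Z t \<omega> > 0}"
    then obtain t where "\<omega> \<in> space M" "t \<in> {0..T}" "Z t \<omega> > 0" by auto
    then show "\<omega> \<in> (\<Union>n. {\<omega>\<in>space M. \<exists>k\<in>{..Suc n}. Z (real k * T / real (Suc n)) \<omega> > 0})"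
      using eventually_happens'[OF _ eventually_grid_hits[OF T cont]] by fastforce
  next
    fix \<omega> assume "\<omega> \<in> (\<Union>n. {\<omega>\<in>space M. \<exists>k\<in>{..Suc n}. Z (real k * T / real (Suc n)) \<omega> > 0})"
    then show "\<omega> \<in> {\<omega>\<in>space M. \<exists>t\<in>{0..T}. Z t \<omega> > 0}"
      using grid_point_in_interval[OF T] by (auto simp del: of_nat_Suc)
  qed
  also have "\<dots> \<in> sets M" by measurable
  finally show ?thesis .
qed

text \<open>A continuous path satisfies \<open>exp (Z t) = 1\<close> at the first time when it reaches \<open>0\<close>, so optional stopping
equates the crossing probability with the part of the final expectation carried by the crossing paths.
The proof refines grids: the discrete first passage estimates hold up to overshoots above \<open>\<epsilon>\<close>, and those
disappear in the limit by uniform continuity of the paths. The martingale hypothesis \<open>mart\<close> is stated for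
product events at finitely many times, because the first passage events of a grid have this form.\<close>

lemma (in prob_space) optional_stopping_crossing:
  fixes Z :: "real \<Rightarrow> 'a \<Rightarrow> real"
  assumes T: "T > 0" and Z: "\<And>t. t \<in> {0..T} \<Longrightarrow> Z t \<in> borel_measurable M"
    and cont: "\<And>\<omega>. \<omega> \<in> space M \<Longrightarrow> continuous_on {0..T} (\<lambda>t. Z t \<omega>)"
    and start: "AE \<omega> in M. Z 0 \<omega> \<le> 0"
    and int: "\<And>t. t \<in> {0..T} \<Longrightarrow> integrable M (\<lambda>\<omega>. exp (Z t \<omega>))"
    and mart: "\<And>u k B A. (\<And>j. j \<le> k \<Longrightarrow> u j \<in> {0..u k}) \<Longrightarrow> u k \<in> {0..T} \<Longrightarrow> (\<And>j. B j \<in> sets borel) \<Longrightarrow>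
        A = {\<omega>\<in>space M. \<forall>j\<in>{..k::nat}. Z (u j) \<omega> \<in> B j} \<Longrightarrow>
        (LINT \<omega>|M. exp (Z T \<omega>) * indicator A \<omega>) = (LINT \<omega>|M. exp (Z (u k) \<omega>) * indicator A \<omega>)"
    and C: "C = {\<omega>\<in>space M. \<exists>t\<in>{0..T}. Z t \<omega> > 0}"
  shows "prob C = (LINT \<omega>|M. exp (Z T \<omega>) * indicator C \<omega>)"
proof -
  define z where "z n k = Z (real k * T / real (Suc n))" for n k
  have zN: "z n (Suc n) = Z T" for n unfolding z_def using T by (simp add: mult.commute del: of_nat_Suc)
  have zm[measurable]: "z n k \<in> borel_measurable M" if "k \<le> Suc n" for n k
    unfolding z_def using Z grid_point_in_interval[OF T that] by blast
  have [measurable]: "Z T \<in> borel_measurable M" using Z T by auto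
  define Cn where "Cn n = {\<omega>\<in>space M. \<exists>k\<le>Suc n. z n k \<omega> > 0}" for n
  define On where "On \<epsilon> n = {\<omega>\<in>space M. \<exists>k\<le>Suc n. (\<forall>j<k. z n j \<omega> \<le> 0) \<and> z n k \<omega> > \<epsilon>}" for \<epsilon> n
  have Cm[measurable]: "C \<in> sets M" unfolding C using crossing_measurable[OF T Z cont] .
  have Cn_eq: "Cn n = {\<omega>\<in>space M. \<exists>k\<in>{..Suc n}. z n k \<omega> > 0}" for n unfolding Cn_def by auto
  have On_eq: "On \<epsilon> n = {\<omega>\<in>space M. \<exists>k\<in>{..Suc n}. (\<forall>j\<in>{..<k}. z n j \<omega> \<le> 0) \<and> z n k \<omega> > \<epsilon>}" for \<epsilon> n unfolding On_def by auto
  have [measurable]: "Cn n \<in> sets M" "On \<epsilon> n \<in> sets M" for n \<epsilon>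
    unfolding Cn_eq On_eq by measurable
  have mart': "(LINT \<omega>|M. exp (z n (Suc n) \<omega>) * indicator A \<omega>) = (LINT \<omega>|M. exp (z n k \<omega>) * indicator A \<omega>)"
    if "k \<le> Suc n" "\<And>j. B j \<in> sets borel" "A = {\<omega>\<in>space M. \<forall>j\<in>{..k}. z n j \<omega> \<in> B j}" for n k B A
    unfolding zN unfolding z_def
  proof (rule mart[of k "\<lambda>j. real j * T / real (Suc n)" B A])
    show "real j * T / real (Suc n) \<in> {0..real k * T / real (Suc n)}" if "j \<le> k" for j
      using T that by (auto intro!: divide_right_mono mult_right_mono)
    show "real k * T / real (Suc n) \<in> {0..T}" using grid_point_in_interval[OF T that(1)] .
  qed (use that in \<open>auto simp: z_def\<close>)
  have int': "integrable M (\<lambda>\<omega>. exp (z n k \<omega>))" if "k \<le> Suc n" for n k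
    unfolding z_def using int grid_point_in_interval[OF T that] by blast
  have iT: "integrable M (\<lambda>\<omega>. exp (Z T \<omega>))" using int T by auto
  have ind_lim: "(\<lambda>n. indicator (Cn n) \<omega> :: real) \<longlonglongrightarrow> indicator C \<omega>" for \<omega>
  proof (cases "\<omega> \<in> C")
    case True
    then obtain t where t: "\<omega> \<in> space M" "t \<in> {0..T}" "Z t \<omega> > 0" by (auto simp: C)
    have "eventually (\<lambda>n. indicator (Cn n) \<omega> = (1::real)) sequentially"
      using eventually_grid_hits[OF T cont[OF t(1)] t(2,3)]
      by eventually_elim (use t(1) in \<open>auto simp: Cn_def z_def\<close>)
    with True show ?thesis by (auto intro: tendsto_eventually)
  next
    case False
    then have "\<omega> \<notin> Cn n" for n
      using grid_point_in_interval[OF T] by (auto simp: C Cn_def z_def simp del: of_nat_Suc)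
    with False show ?thesis by simp
  qed
  have lim1: "(\<lambda>n. prob (Cn n)) \<longlonglongrightarrow> prob C"
  proof -
    have "(\<lambda>n. LINT \<omega>|M. indicator (Cn n) \<omega>) \<longlonglongrightarrow> (LINT \<omega>|M. (indicator C \<omega> :: real))"
      by (rule integral_dominated_convergence[where w = "\<lambda>_. 1"]) (simp, simp, simp, intro AE_I2 ind_lim, simp)
    then show ?thesis by simp
  qed
  have lim2: "(\<lambda>n. LINT \<omega>|M. exp (Z T \<omega>) * indicator (Cn n) \<omega>) \<longlonglongrightarrow> (LINT \<omega>|M. exp (Z T \<omega>) * indicator C \<omega>)"
    by (rule integral_dominated_convergence[OF _ _ iT])
       (simp, simp, intro AE_I2 tendsto_mult tendsto_const ind_lim, simp add: indicator_def)
  have lim3: "(\<lambda>n. LINT \<omega>|M. exp (Z T \<omega>) * indicator (On \<epsilon> n) \<omega>) \<longlonglongrightarrow> 0" if "\<epsilon> > 0" for \<epsilon>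
  proof -
    have "(\<lambda>n. LINT \<omega>|M. exp (Z T \<omega>) * indicator (On \<epsilon> n) \<omega>) \<longlonglongrightarrow> (LINT \<omega>|M. 0)"
    proof (rule integral_dominated_convergence[OF _ _ iT])
      show "AE \<omega> in M. (\<lambda>n. exp (Z T \<omega>) * indicator (On \<epsilon> n) \<omega>) \<longlonglongrightarrow> 0"
        using start
      proof (rule AE_mp, intro AE_I2 impI)
        fix \<omega> assume \<omega>: "\<omega> \<in> space M" "Z 0 \<omega> \<le> 0"
        have "eventually (\<lambda>n. exp (Z T \<omega>) * indicator (On \<epsilon> n) \<omega> = 0) sequentially"
          using eventually_grid_no_overshoot[OF T cont[OF \<omega>(1)] \<omega>(2) that]
          by eventually_elim (auto simp: On_def z_def indicator_def)
        then show "(\<lambda>n. exp (Z T \<omega>) * indicator (On \<epsilon> n) \<omega>) \<longlonglongrightarrow> 0" by (rule tendsto_eventually)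
      qed
    qed (auto simp: indicator_def)
    then show ?thesis by simp
  qed
  have disc: "prob (Cn n) \<le> (LINT \<omega>|M. exp (Z T \<omega>) * indicator (Cn n) \<omega>)"
    "(LINT \<omega>|M. exp (Z T \<omega>) * indicator (Cn n) \<omega>) \<le> exp \<epsilon> * prob (Cn n) + (LINT \<omega>|M. exp (Z T \<omega>) * indicator (On \<epsilon> n) \<omega>)"
    if "\<epsilon> > 0" for n \<epsilon>
  proof -
    show "prob (Cn n) \<le> (LINT \<omega>|M. exp (Z T \<omega>) * indicator (Cn n) \<omega>)"
      unfolding zN[of n, symmetric]
      by (rule first_passage_discrete(1)[OF _ _ _ Cn_def that On_def]; (rule zm int' mart')?; assumption)
    show "(LINT \<omega>|M. exp (Z T \<omega>) * indicator (Cn n) \<omega>) \<le> exp \<epsilon> * prob (Cn n) + (LINT \<omega>|M. exp (Z T \<omega>) * indicator (On \<epsilon> n) \<omega>)"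
      unfolding zN[of n, symmetric]
      by (rule first_passage_discrete(2)[OF _ _ _ Cn_def that On_def]; (rule zm int' mart')?; assumption)
  qed
  have lower: "prob C \<le> (LINT \<omega>|M. exp (Z T \<omega>) * indicator C \<omega>)"
    by (rule LIMSEQ_le[OF lim1 lim2]) (use disc(1)[OF zero_less_one] in auto)
  have upper: "(LINT \<omega>|M. exp (Z T \<omega>) * indicator C \<omega>) \<le> exp \<epsilon> * prob C" if "\<epsilon> > 0" for \<epsilon>
  proof -
    have "(\<lambda>n. exp \<epsilon> * prob (Cn n) + (LINT \<omega>|M. exp (Z T \<omega>) * indicator (On \<epsilon> n) \<omega>)) \<longlonglongrightarrow> exp \<epsilon> * prob C + 0"
      by (intro tendsto_intros lim1 lim3 that)
    then show ?thesis
      using LIMSEQ_le[OF lim2] disc(2)[OF that] that by auto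
  qed
  have "(LINT \<omega>|M. exp (Z T \<omega>) * indicator C \<omega>) \<le> exp 0 * prob C"
  proof (rule tendsto_lowerbound)
    show "((\<lambda>\<epsilon>. exp \<epsilon> * prob C) \<longlongrightarrow> exp 0 * prob C) (at_right (0::real))"
      by (intro tendsto_intros)
    show "eventually (\<lambda>\<epsilon>. (LINT \<omega>|M. exp (Z T \<omega>) * indicator C \<omega>) \<le> exp \<epsilon> * prob C) (at_right (0::real))"
      using upper by (auto simp: eventually_at_filter)
  qed simp
  with lower show ?thesis by simp
qed

text \<open>The time-changed process \<open>Y t / (h - t)\<close> has covariance \<open>s2 * min s t / (h * (h - min s t))\<close>, hence independent
increments. With the factor \<open>\<theta> = 2 * \<beta> / s2\<close> its exponential has constant expectation \<open>exp (- \<theta> * \<alpha> / h)\<close>.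
On the paths that do not cross, the exponential is at most \<open>1\<close> and tends to \<open>0\<close> at time \<open>h\<close>, where the bridge
is at \<open>- \<beta>\<close>; so these paths contribute nothing in the limit, and optional stopping gives the value of the
crossing probability.\<close>

theorem brownian_bridge_crossing:
  fixes Y :: "real \<Rightarrow> 'a \<Rightarrow> real" and h \<alpha> \<beta> s2 :: real
  assumes gp: "gaussian_process M {0..h} Y" and h: "h > 0" and \<alpha>: "\<alpha> > 0" and \<beta>: "\<beta> > 0" and s2: "s2 > 0"
    and mean: "\<And>t. t \<in> {0..h} \<Longrightarrow> (LINT \<omega>|M. Y t \<omega>) = - (\<alpha> * (h - t) + \<beta> * t) / h"
    and cov: "\<And>s t. 0 \<le> s \<Longrightarrow> s \<le> t \<Longrightarrow> t \<le> h \<Longrightarrow> covariance M (Y s) (Y t) = s2 * s * (h - t) / h"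
    and cont: "\<And>\<omega>. \<omega> \<in> space M \<Longrightarrow> continuous_on {0..h} (\<lambda>t. Y t \<omega>)"
  shows "measure M {\<omega>\<in>space M. \<exists>t\<in>{0..h}. Y t \<omega> > 0} = exp (- 2 * \<alpha> * \<beta> / (s2 * h))"
proof -
  interpret prob_space M using gp by (simp add: gaussian_process_def)
  \<comment> \<open>the only nonzero value for which mean plus half the variance of \<open>Z t\<close> does not depend on \<open>t\<close>\<close>
  define \<theta> where "\<theta> = 2 * \<beta> / s2"
  have \<theta>: "\<theta> > 0" using \<beta> s2 by (simp add: \<theta>_def)
  define Z where "Z t \<omega> = \<theta> / (h - t) * Y t \<omega>" for t \<omega>
  have Yspan: "Y t \<in> lin_span {0..h} Y" if "t \<in> {0..h}" for t using that by (rule lin_span_base)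
  have Zspan: "Z t \<in> lin_span {0..h} Y" if "t \<in> {0..h}" for t
    unfolding Z_def[abs_def] using that by (intro lin_span_scale Yspan)
  have Zpos: "Z t \<omega> > 0 \<longleftrightarrow> Y t \<omega> > 0" if "t < h" for t \<omega>
    unfolding Z_def using that \<theta> by (simp add: zero_less_mult_iff zero_less_divide_iff)
  note g = lin_span_gaussian[OF gp] and s = lin_span_square_integrable[OF gp]
  have covZ: "covariance M (Z u) (Z t) = \<theta>\<^sup>2 * s2 * u / (h * (h - u))" if "0 \<le> u" "u \<le> t" "t < h" for u t
  proof -
    have "covariance M (Z u) (Z t) = (\<theta> / (h - u)) * ((\<theta> / (h - t)) * covariance M (Y u) (Y t))"
      unfolding Z_def[abs_def] using that s[OF Yspan[of u]] s[OF Yspan[of t]]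
      by (simp only: covariance_scale_left covariance_scale_right square_integrable_scale
          atLeastAtMost_iff order.trans less_imp_le)
    also have "covariance M (Y u) (Y t) = s2 * u * (h - t) / h" using that by (intro cov) auto
    also have "(\<theta> / (h - t)) * (s2 * u * (h - t) / h) = \<theta> * s2 * u / h" using that by simp
    finally show ?thesis by (simp add: power2_eq_square mult_ac)
  qed
  define K where "K = - \<theta> * \<alpha> / h"
  have expo: "expectation (Z t) + covariance M (Z t) (Z t) / 2 = K" if "0 \<le> t" "t < h" for t
  proof -
    have "expectation (Z t) = \<theta> / (h - t) * (- (\<alpha> * (h - t) + \<beta> * t) / h)"
      unfolding Z_def[abs_def] using mean[of t] that by simp
    moreover have "\<theta>\<^sup>2 * s2 = 2 * \<theta> * \<beta>" using s2 by (simp add: \<theta>_def power2_eq_square)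
    ultimately have e: "expectation (Z t) + covariance M (Z t) (Z t) / 2
        = \<theta> / (h - t) * (- (\<alpha> * (h - t) + \<beta> * t) / h) + 2 * \<theta> * \<beta> * t / (h * (h - t)) / 2"
      using covZ[of t t] that by simp
    have "\<theta> / \<delta> * (- (\<alpha> * \<delta> + \<beta> * t) / h) + 2 * \<theta> * \<beta> * t / (h * \<delta>) / 2 = K" if "\<delta> > 0" for \<delta>
      using that h by (simp add: K_def field_simps)
    from this[of "h - t"] have "\<theta> / (h - t) * (- (\<alpha> * (h - t) + \<beta> * t) / h) + 2 * \<theta> * \<beta> * t / (h * (h - t)) / 2 = K"
      using that by simp
    with e show ?thesis by simp
  qed
  have Y0: "AE \<omega> in M. Y 0 \<omega> = - \<alpha>"
  proof -
    have "covariance M (Y 0) (Y 0) = 0" "expectation (Y 0) = - \<alpha>" using cov[of 0 0] mean[of 0] h by auto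
    then show ?thesis using g[OF Yspan[of 0]] h by (auto elim: gaussian_rv_cases)
  qed
  have Yh: "AE \<omega> in M. Y h \<omega> = - \<beta>"
  proof -
    have "covariance M (Y h) (Y h) = 0" "expectation (Y h) = - \<beta>" using cov[of h h] mean[of h] h by auto
    then show ?thesis using g[OF Yspan[of h]] h by (auto elim: gaussian_rv_cases)
  qed
  have Ym: "Y t \<in> borel_measurable M" if "t \<in> {0..h}" for t
    using gaussian_process_measurable[OF gp that] .
  have Zm: "Z t \<in> borel_measurable M" if "t \<in> {0..h}" for t
    using s[OF Zspan[OF that]] by (simp add: square_integrable_def)
  have Zint: "integrable M (\<lambda>\<omega>. exp (Z t \<omega>))" and EZ: "expectation (\<lambda>\<omega>. exp (Z t \<omega>)) = exp K"
    if "0 \<le> t" "t < h" for t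
    using exp_gaussian_rv[OF g[OF Zspan[of t]]] expo[of t] that by auto
  have Zcont: "continuous_on {0..T} (\<lambda>t. Z t \<omega>)" if "\<omega> \<in> space M" "T < h" for T \<omega>
    unfolding Z_def using that h
    by (intro continuous_intros continuous_on_subset[OF cont[OF that(1)]]) auto
  define C where "C T = {\<omega>\<in>space M. \<exists>t\<in>{0..T}. Z t \<omega> > 0}" for T
  have Cm[measurable]: "C T \<in> sets M" if "0 < T" "T < h" for T
    unfolding C_def using that by (intro crossing_measurable Zm Zcont) auto
  have stop: "prob (C T) = (LINT \<omega>|M. exp (Z T \<omega>) * indicator (C T) \<omega>)" if T: "0 < T" "T < h" for T
  proof (rule optional_stopping_crossing[OF T(1) _ Zcont[OF _ T(2)] _ _ _ C_def])
    show "AE \<omega> in M. Z 0 \<omega> \<le> 0"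
      using Y0 by eventually_elim (use \<theta> \<alpha> h in \<open>simp add: Z_def\<close>)
    fix u :: "nat \<Rightarrow> real" and k :: nat and B :: "nat \<Rightarrow> real set" and A
    assume u: "\<And>j. j \<le> k \<Longrightarrow> u j \<in> {0..u k}" and uk: "u k \<in> {0..T}"
      and B: "\<And>j. B j \<in> sets borel" and A: "A = {\<omega>\<in>space M. \<forall>j\<in>{..k}. Z (u j) \<omega> \<in> B j}"
    show "(LINT \<omega>|M. exp (Z T \<omega>) * indicator A \<omega>) = (LINT \<omega>|M. exp (Z (u k) \<omega>) * indicator A \<omega>)"
    proof (rule exponential_weights_agree[OF gp _ _ _ _ _ _ B A])
      show "covariance M (Z T) (Z (u j)) = covariance M (Z (u k)) (Z (u j))" if "j \<in> {..k}" for j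
        unfolding covariance_commute[of M _ "Z (u j)"]
        using u[of j] uk that T by (simp add: covZ)
      show "Z (u j) \<in> lin_span {0..h} Y" if "j \<in> {..k}" for j
        using u[of j] uk that T by (intro Zspan) auto
    qed (use uk T in \<open>auto intro!: Zspan simp: expo\<close>)
  qed (use T in \<open>auto intro!: Zm Zint\<close>)
  \<comment> \<open>division by \<open>h - t\<close> excludes the time \<open>h\<close>, which is approached from below\<close>
  define \<tau> where "\<tau> n = h * (1 - 1 / (real n + 2))" for n
  have \<tau>: "0 < \<tau> n" "\<tau> n < h" for n
  proof -
    have "0 < 1 - 1 / (real n + 2)" "1 - 1 / (real n + 2) < 1" by (auto simp: field_simps)
    then show "0 < \<tau> n" "\<tau> n < h" using h by (auto simp: \<tau>_def)
  qed
  have \<tau>lim: "\<tau> \<longlonglongrightarrow> h"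
  proof -
    have "(\<lambda>n. h * (1 - 1 / (real n + 2))) \<longlonglongrightarrow> h * (1 - 0)"
      by (intro tendsto_intros) real_asymp
    then show ?thesis by (simp add: \<tau>_def[abs_def])
  qed
  define D where "D = {\<omega>\<in>space M. \<exists>t\<in>{0..h}. Y t \<omega> > 0}"
  have Dm[measurable]: "D \<in> sets M" unfolding D_def using h by (intro crossing_measurable Ym cont) auto
  have lim1: "(\<lambda>n. prob (C (\<tau> n))) \<longlonglongrightarrow> prob D"
  proof -
    have "(\<lambda>n. LINT \<omega>|M. indicator (C (\<tau> n)) \<omega>) \<longlonglongrightarrow> (LINT \<omega>|M. (indicator D \<omega> :: real))"
    proof (rule integral_dominated_convergence[where w = "\<lambda>_. 1"])
      show "AE \<omega> in M. (\<lambda>n. indicator (C (\<tau> n)) \<omega> :: real) \<longlonglongrightarrow> indicator D \<omega>"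
        using Yh
      proof (rule AE_mp, intro AE_I2 impI)
        fix \<omega> assume \<omega>: "\<omega> \<in> space M" "Y h \<omega> = - \<beta>"
        show "(\<lambda>n. indicator (C (\<tau> n)) \<omega> :: real) \<longlonglongrightarrow> indicator D \<omega>"
        proof (cases "\<omega> \<in> D")
          case True
          then obtain t where t: "0 \<le> t" "t \<le> h" "Y t \<omega> > 0" by (auto simp: D_def)
          with \<omega> \<beta> have "t < h" by (cases "t = h") auto
          with \<tau>lim have "eventually (\<lambda>n. \<tau> n > t) sequentially" by (rule order_tendstoD(1))
          then have "eventually (\<lambda>n. indicator (C (\<tau> n)) \<omega> = (1::real)) sequentially"
          proof eventually_elim
            case (elim n)
            then have "\<omega> \<in> C (\<tau> n)" using t \<omega> \<open>t < h\<close> Zpos unfolding C_def by force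
            then show ?case by simp
          qed
          with True show ?thesis by (auto intro: tendsto_eventually)
        next
          case False
          have "\<omega> \<notin> C (\<tau> n)" for n
          proof
            assume "\<omega> \<in> C (\<tau> n)"
            then obtain t where "t \<in> {0..\<tau> n}" "Z t \<omega> > 0" by (auto simp: C_def)
            then show False using False \<omega> Zpos[of t \<omega>] \<tau>[of n] by (auto simp: D_def)
          qed
          with False show ?thesis by simp
        qed
      qed
    qed (use \<tau> in auto)
    then show ?thesis using \<tau> by (simp add: sets.Int_space_eq2)
  qed
  have lim2: "(\<lambda>n. LINT \<omega>|M. exp (Z (\<tau> n) \<omega>) * indicator (space M - C (\<tau> n)) \<omega>) \<longlonglongrightarrow> 0"
  proof -
    have "(\<lambda>n. LINT \<omega>|M. exp (Z (\<tau> n) \<omega>) * indicator (space M - C (\<tau> n)) \<omega>) \<longlonglongrightarrow> (LINT \<omega>|M. 0)"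
    proof (rule integral_dominated_convergence[where w = "\<lambda>_. 1"])
      have [measurable]: "Z (\<tau> n) \<in> borel_measurable M" for n using \<tau>[of n] by (intro Zm) auto
      show "(\<lambda>\<omega>. exp (Z (\<tau> n) \<omega>) * indicator (space M - C (\<tau> n)) \<omega>) \<in> borel_measurable M" for n
        using \<tau>[of n] by measurable
      show "AE \<omega> in M. norm (exp (Z (\<tau> n) \<omega>) * indicator (space M - C (\<tau> n)) \<omega>) \<le> 1" for n
      proof (rule AE_I2)
        fix \<omega> assume "\<omega> \<in> space M"
        have "Z (\<tau> n) \<omega> \<le> 0" if "\<omega> \<notin> C (\<tau> n)"
          using that \<open>\<omega> \<in> space M\<close> \<tau>[of n] by (auto simp: C_def not_less intro: less_imp_le)
        then show "norm (exp (Z (\<tau> n) \<omega>) * indicator (space M - C (\<tau> n)) \<omega>) \<le> 1"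
          by (auto simp: indicator_def)
      qed
      show "AE \<omega> in M. (\<lambda>n. exp (Z (\<tau> n) \<omega>) * indicator (space M - C (\<tau> n)) \<omega>) \<longlonglongrightarrow> 0"
        using Yh
      proof (rule AE_mp, intro AE_I2 impI)
        fix \<omega> assume \<omega>: "\<omega> \<in> space M" "Y h \<omega> = - \<beta>"
        have Ylim: "(\<lambda>n. Y (\<tau> n) \<omega>) \<longlonglongrightarrow> Y h \<omega>"
        proof (rule continuous_on_tendsto_compose[OF cont[OF \<omega>(1)] \<tau>lim])
          show "\<forall>\<^sub>F n in sequentially. \<tau> n \<in> {0..h}"
            using \<tau> by (intro always_eventually) (auto intro: less_imp_le)
        qed (use h in auto)
        have d: "filterlim (\<lambda>n. h - \<tau> n) (at_right 0) sequentially"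
          unfolding filterlim_at using \<tau> tendsto_diff[OF tendsto_const \<tau>lim, of h] by (auto simp: less_imp_neq[THEN not_sym])
        have "filterlim (\<lambda>n. inverse (h - \<tau> n)) at_top sequentially"
          by (rule filterlim_compose[OF filterlim_inverse_at_top_right d])
        moreover have "(\<lambda>n. \<theta> * Y (\<tau> n) \<omega>) \<longlonglongrightarrow> \<theta> * Y h \<omega>" by (intro tendsto_intros Ylim)
        moreover have "\<theta> * Y h \<omega> < 0" using \<omega> \<theta> \<beta> by simp
        ultimately have "filterlim (\<lambda>n. \<theta> * Y (\<tau> n) \<omega> * inverse (h - \<tau> n)) at_bot sequentially"
          using filterlim_tendsto_neg_mult_at_bot by blast
        then have "filterlim (\<lambda>n. Z (\<tau> n) \<omega>) at_bot sequentially"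
          by (simp add: Z_def field_simps)
        then have "(\<lambda>n. exp (Z (\<tau> n) \<omega>)) \<longlonglongrightarrow> 0" by (rule filterlim_compose[OF exp_at_bot])
        then show "(\<lambda>n. exp (Z (\<tau> n) \<omega>) * indicator (space M - C (\<tau> n)) \<omega>) \<longlonglongrightarrow> 0"
          by (rule Lim_null_comparison[rotated]) (auto simp: indicator_def)
      qed
    qed auto
    then show ?thesis by simp
  qed
  have "prob (C (\<tau> n)) = exp K - (LINT \<omega>|M. exp (Z (\<tau> n) \<omega>) * indicator (space M - C (\<tau> n)) \<omega>)" for n
  proof -
    have "exp K = (LINT \<omega>|M. exp (Z (\<tau> n) \<omega>) * indicator (C (\<tau> n)) \<omega> + exp (Z (\<tau> n) \<omega>) * indicator (space M - C (\<tau> n)) \<omega>)"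
      unfolding EZ[OF less_imp_le[OF \<tau>(1)] \<tau>(2), of n, symmetric]
      by (intro Bochner_Integration.integral_cong refl) (auto simp: indicator_def)
    also have "\<dots> = prob (C (\<tau> n)) + (LINT \<omega>|M. exp (Z (\<tau> n) \<omega>) * indicator (space M - C (\<tau> n)) \<omega>)"
      unfolding stop[OF \<tau>] using \<tau>[of n]
      by (intro Bochner_Integration.integral_add integrable_real_mult_indicator Zint sets.Diff) auto
    finally show ?thesis by simp
  qed
  then have "(\<lambda>n. prob (C (\<tau> n))) \<longlonglongrightarrow> exp K - 0"
    using tendsto_diff[OF tendsto_const lim2, of "exp K"] by simp
  then have "prob D = exp K" using LIMSEQ_unique[OF lim1] by simp
  moreover have "K = - 2 * \<alpha> * \<beta> / (s2 * h)" using s2 h by (simp add: K_def \<theta>_def field_simps)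
  ultimately show ?thesis by (simp add: D_def)
qed

section \<open>Conditioning a Gaussian process on two values\<close>

lemma path_space_coordinate: "u \<in> I \<Longrightarrow> (\<lambda>w. w u) \<in> borel_measurable (path_space I)"
  unfolding path_space_def by (intro measurable_restrict_space1 measurable_component_singleton)

lemma path_measurable:
  assumes "\<And>u. u \<in> I \<Longrightarrow> X u \<in> borel_measurable M"
    and "\<And>\<omega>. \<omega> \<in> space M \<Longrightarrow> continuous_on I (\<lambda>u. X u \<omega>)"
  shows "(\<lambda>\<omega>. \<lambda>u\<in>I. X u \<omega>) \<in> M \<rightarrow>\<^sub>M path_space I"
  unfolding path_space_def
proof (rule measurable_restrict_space2)
  have "continuous_on I (\<lambda>u\<in>I. X u \<omega>)" if "\<omega> \<in> space M" for \<omega>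
    using assms(2)[OF that] by (rule continuous_on_eq) simp
  then show "(\<lambda>\<omega>. \<lambda>u\<in>I. X u \<omega>) \<in> space M \<rightarrow> {w. continuous_on I w}" by auto
  show "(\<lambda>\<omega>. \<lambda>u\<in>I. X u \<omega>) \<in> M \<rightarrow>\<^sub>M Pi\<^sub>M I (\<lambda>_. borel)"
    using assms(1) by (intro measurable_restrict) auto
qed

text \<open>The disintegration formula, which defines the conditional law on events, says that restricting to
\<open>(X s, X t) \<in> S\<close> and then taking the law of the path gives the mixture of the kernel over the
restricted law of \<open>(X s, X t)\<close>. Equality of these two measures extends the formula to integrals.\<close>

lemma regular_conditional_law_integral:
  fixes f :: "(real \<Rightarrow> real) \<Rightarrow> real"
  assumes M: "prob_space M" and rcl: "regular_conditional_law M I X s t \<kappa>"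
    and X: "\<And>u. u \<in> I \<Longrightarrow> X u \<in> borel_measurable M" and st: "s \<in> I" "t \<in> I"
    and cont: "\<And>\<omega>. \<omega> \<in> space M \<Longrightarrow> continuous_on I (\<lambda>u. X u \<omega>)"
    and f[measurable]: "f \<in> borel_measurable (path_space I)" and fK: "\<And>w. \<bar>f w\<bar> \<le> K"
    and S[measurable]: "S \<in> sets borel"
  shows "(LINT \<omega>|M. f (\<lambda>u\<in>I. X u \<omega>) * indicator S (X s \<omega>, X t \<omega>))
    = (LINT z|distr M borel (\<lambda>\<omega>. (X s \<omega>, X t \<omega>)). (LINT w|\<kappa> z. f w) * indicator S z)"
proof -
  interpret prob_space M by fact
  define path where "path = (\<lambda>\<omega>. \<lambda>u\<in>I. X u \<omega>)"
  define Z where "Z = (\<lambda>\<omega>. (X s \<omega>, X t \<omega>))"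
  define \<mu> where "\<mu> = distr M borel Z"
  have path[measurable]: "path \<in> M \<rightarrow>\<^sub>M path_space I"
    unfolding path_def by (rule path_measurable[OF X cont])
  have [measurable]: "X s \<in> borel_measurable M" "X t \<in> borel_measurable M" using X st by auto
  have Z[measurable]: "Z \<in> M \<rightarrow>\<^sub>M borel" unfolding Z_def borel_prod[symmetric] by measurable
  interpret \<mu>: prob_space \<mu> unfolding \<mu>_def by (rule prob_space_distr) measurable
  have \<kappa>: "\<kappa> \<in> borel \<rightarrow>\<^sub>M prob_algebra (path_space I)" using rcl by (simp add: regular_conditional_law_def)
  note \<kappa>'[measurable] = measurable_prob_algebraD[OF \<kappa>]
  have law: "emeasure M {\<omega>\<in>space M. path \<omega> \<in> A \<and> Z \<omega> \<in> S} = (\<integral>\<^sup>+ z\<in>S. emeasure (\<kappa> z) A \<partial>\<mu>)"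
    if "A \<in> sets (path_space I)" for A
    using rcl S that unfolding regular_conditional_law_def path_def Z_def \<mu>_def by auto
  define MS where "MS = density M (\<lambda>\<omega>. indicator S (Z \<omega>))"
  define \<mu>S where "\<mu>S = density \<mu> (indicator S)"
  have s\<mu>[measurable_cong]: "sets \<mu> = sets borel" "sets \<mu>S = sets borel" by (auto simp: \<mu>_def \<mu>S_def)
  have \<mu>S[simp]: "space \<mu> = UNIV" "space \<mu>S = UNIV" by (auto simp: \<mu>_def \<mu>S_def)
  have \<kappa>S: "\<kappa> \<in> \<mu>S \<rightarrow>\<^sub>M subprob_algebra (path_space I)" by measurable
  have pathS[measurable]: "path \<in> MS \<rightarrow>\<^sub>M path_space I" unfolding MS_def by simp
  have eq: "distr MS (path_space I) path = \<mu>S \<bind> \<kappa>"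
  proof (rule measure_eqI)
    show "sets (distr MS (path_space I) path) = sets (\<mu>S \<bind> \<kappa>)"
      by (subst sets_bind_measurable[OF \<kappa>S]) auto
    fix A assume "A \<in> sets (distr MS (path_space I) path)"
    then have A[measurable]: "A \<in> sets (path_space I)" by simp
    have "emeasure (distr MS (path_space I) path) A = emeasure MS (path -` A \<inter> space M)"
      by (simp add: emeasure_distr MS_def)
    also have "\<dots> = (\<integral>\<^sup>+ \<omega>. indicator S (Z \<omega>) * indicator (path -` A \<inter> space M) \<omega> \<partial>M)"
      unfolding MS_def by (subst emeasure_density) auto
    also have "\<dots> = (\<integral>\<^sup>+ \<omega>. indicator {\<omega>\<in>space M. path \<omega> \<in> A \<and> Z \<omega> \<in> S} \<omega> \<partial>M)"
      by (intro nn_integral_cong) (auto simp: indicator_def)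
    also have "\<dots> = emeasure M {\<omega>\<in>space M. path \<omega> \<in> A \<and> Z \<omega> \<in> S}"
      by (rule nn_integral_indicator) measurable
    also have "\<dots> = (\<integral>\<^sup>+ z\<in>S. emeasure (\<kappa> z) A \<partial>\<mu>)" by (rule law[OF A])
    also have "\<dots> = (\<integral>\<^sup>+ z. emeasure (\<kappa> z) A \<partial>\<mu>S)"
    proof -
      have "(\<lambda>z. emeasure (\<kappa> z) A) \<in> borel_measurable \<mu>" by measurable
      moreover have "(\<lambda>z. indicator S z :: ennreal) \<in> borel_measurable \<mu>" by measurable
      ultimately show ?thesis unfolding \<mu>S_def
        by (subst nn_integral_density) (simp_all only: mult.commute)
    qed
    also have "\<dots> = emeasure (\<mu>S \<bind> \<kappa>) A"
      by (subst emeasure_bind[OF _ \<kappa>S A]) auto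
    finally show "emeasure (distr MS (path_space I) path) A = emeasure (\<mu>S \<bind> \<kappa>) A" .
  qed
  have \<kappa>1: "emeasure (\<kappa> z) (space (\<kappa> z)) \<le> ennreal 1" for z
    using measurable_space[OF \<kappa>', of z] by (auto simp: space_subprob_algebra subprob_space.emeasure_space_le_1)
  have fin: "finite_measure \<mu>S"
  proof
    have "emeasure \<mu>S UNIV = emeasure \<mu> S"
      unfolding \<mu>S_def by (subst emeasure_density) (simp_all add: s\<mu>)
    then show "emeasure \<mu>S (space \<mu>S) \<noteq> \<infinity>" by (simp add: \<mu>.emeasure_eq_measure)
  qed
  have "(LINT \<omega>|M. f (path \<omega>) * indicator S (Z \<omega>)) = (LINT \<omega>|MS. f (path \<omega>))"
  proof -
    have "MS = density M (\<lambda>\<omega>. ennreal (indicator S (Z \<omega>)))" by (simp add: MS_def ennreal_indicator)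
    then show ?thesis by (simp add: integral_density mult.commute)
  qed
  also have "\<dots> = (LINT w|distr MS (path_space I) path. f w)"
    by (rule integral_distr[symmetric]) auto
  also have "\<dots> = (LINT z|\<mu>S. LINT w|\<kappa> z. f w)"
    unfolding eq by (rule integral_bind[OF f fK \<kappa>S fin, of 1]) (use \<kappa>1 in auto)
  also have "\<dots> = (LINT z|\<mu>. (LINT w|\<kappa> z. f w) * indicator S z)"
  proof -
    have "(\<lambda>z. LINT w|\<kappa> z. f w) \<in> borel_measurable \<mu>" by measurable
    moreover have "(\<lambda>z. indicator S z :: real) \<in> borel_measurable \<mu>" by measurable
    moreover have "\<mu>S = density \<mu> (\<lambda>z. ennreal (indicator S z))" by (simp add: \<mu>S_def ennreal_indicator)
    ultimately show ?thesis by (simp add: integral_density mult.commute)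
  qed
  finally show ?thesis by (simp add: path_def Z_def \<mu>_def)
qed

text \<open>If \<open>g z \<noteq> 0\<close>, then \<open>Re (cnj (g z) * g x)\<close> is positive for all \<open>x\<close> in a box around \<open>z\<close>; as the box has
positive mass, the integral of \<open>g\<close> over it cannot vanish.\<close>

lemma continuous_zero_of_box_integrals:
  fixes g :: "real \<times> real \<Rightarrow> complex"
  assumes \<mu>: "finite_measure \<mu>" "sets \<mu> = sets borel"
    and supp: "\<And>z \<delta>. \<delta> > 0 \<Longrightarrow> measure \<mu> {x. \<bar>fst x - fst z\<bar> < \<delta> \<and> \<bar>snd x - snd z\<bar> < \<delta>} > 0"
    and g: "continuous_on UNIV g" and gK: "\<And>z. norm (g z) \<le> K"
    and zero: "\<And>B1 B2. B1 \<in> sets borel \<Longrightarrow> B2 \<in> sets borel \<Longrightarrow> (CLINT z|\<mu>. g z * indicator (B1 \<times> B2) z) = 0"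
  shows "g z = 0"
proof (rule ccontr)
  assume nz: "g z \<noteq> 0"
  interpret finite_measure \<mu> by fact
  have [measurable]: "g \<in> borel_measurable \<mu>"
    using borel_measurable_continuous_onI[OF g] \<mu>(2) by (simp cong: measurable_cong_sets)
  define r where "r x = Re (cnj (g z) * g x)" for x
  have r: "continuous_on UNIV r" unfolding r_def by (intro continuous_intros g)
  have "cnj (g z) * g z = complex_of_real ((cmod (g z))\<^sup>2)"
    by (subst complex_norm_square) (rule mult.commute)
  then have "r z > 0" using nz by (simp add: r_def)
  with r[unfolded continuous_on_iff, rule_format, of z "r z"]
  obtain \<delta> where \<delta>: "\<delta> > 0" "\<And>x. dist x z < \<delta> \<Longrightarrow> dist (r x) (r z) < r z"
    by auto
  define B1 where "B1 = {x. \<bar>x - fst z\<bar> < \<delta> / 2}"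
  define B2 where "B2 = {x. \<bar>x - snd z\<bar> < \<delta> / 2}"
  have B[measurable]: "B1 \<in> sets borel" "B2 \<in> sets borel" unfolding B1_def B2_def by measurable
  have box: "{x. \<bar>fst x - fst z\<bar> < \<delta> / 2 \<and> \<bar>snd x - snd z\<bar> < \<delta> / 2} = B1 \<times> B2"
    by (auto simp: B1_def B2_def)
  have S[measurable]: "B1 \<times> B2 \<in> sets \<mu>"
    unfolding \<mu>(2) borel_prod[symmetric] by measurable
  have pos: "r x > 0" if "x \<in> B1 \<times> B2" for x
  proof -
    have "dist x z \<le> dist (fst x) (fst z) + dist (snd x) (snd z)"
      unfolding dist_prod_def by (rule sqrt_sum_squares_le_sum) auto
    also have "\<dots> < \<delta>" using that unfolding box[symmetric] by (auto simp: dist_real_def)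
    finally show ?thesis using \<delta>(2)[of x] by (auto simp: dist_real_def)
  qed
  have int: "integrable \<mu> (\<lambda>x. g x * indicator (B1 \<times> B2) x)"
  proof (rule integrable_const_bound[of _ K])
    have "0 \<le> K" using order_trans[OF norm_ge_zero gK] .
    then show "AE x in \<mu>. norm (g x * indicator (B1 \<times> B2) x) \<le> K"
      using gK by (intro AE_I2) (simp add: indicator_def)
  qed measurable
  have "0 = Re (cnj (g z) * (CLINT x|\<mu>. g x * indicator (B1 \<times> B2) x))"
    using zero[OF B] by simp
  also have "\<dots> = Re (CLINT x|\<mu>. cnj (g z) * (g x * indicator (B1 \<times> B2) x))"
    by simp
  also have "\<dots> = (LINT x|\<mu>. Re (cnj (g z) * (g x * indicator (B1 \<times> B2) x)))"
    using int by (intro integral_Re[symmetric] integrable_mult_right)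
  also have "\<dots> = (LINT x|\<mu>. r x * indicator (B1 \<times> B2) x)"
    by (intro Bochner_Integration.integral_cong refl) (auto simp: r_def indicator_def)
  finally have I0: "(LINT x|\<mu>. r x * indicator (B1 \<times> B2) x) = 0" by simp
  have "integrable \<mu> (\<lambda>x. Re (cnj (g z) * (g x * indicator (B1 \<times> B2) x)))"
    using int by (intro integrable_Re integrable_mult_right)
  also have "(\<lambda>x. Re (cnj (g z) * (g x * indicator (B1 \<times> B2) x))) = (\<lambda>x. r x * indicator (B1 \<times> B2) x)"
    by (auto simp: r_def indicator_def fun_eq_iff)
  finally have "AE x in \<mu>. r x * indicator (B1 \<times> B2) x = 0"
    using I0 by (subst (asm) integral_nonneg_eq_0_iff_AE)
      (auto simp: indicator_def intro!: less_imp_le pos)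
  then have "AE x in \<mu>. x \<notin> B1 \<times> B2"
    by eventually_elim (use pos in \<open>fastforce simp: indicator_def\<close>)
  then have "emeasure \<mu> (B1 \<times> B2) = 0"
    using S by (subst (asm) AE_iff_measurable[OF S]) (use sets.sets_into_space[OF S] in auto)
  then show False using supp[of "\<delta> / 2" z] \<delta>(1) unfolding box by (simp add: measure_def)
qed

lemma cis_eq_imp_eq:
  assumes "\<And>\<theta>. cis (\<theta> * x) = cis (\<theta> * y)" shows "x = y"
proof (rule ccontr)
  assume "x \<noteq> y"
  define \<theta> where "\<theta> = pi / (x - y)"
  have "cis (\<theta> * x - \<theta> * y) = cis (\<theta> * x) / cis (\<theta> * y)" by (simp add: cis_divide)
  also have "\<dots> = 1" using assms[of \<theta>] by simp
  also have "\<theta> * x - \<theta> * y = pi"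
    unfolding right_diff_distrib[symmetric] using \<open>x \<noteq> y\<close> by (simp add: \<theta>_def)
  finally show False by (simp add: complex_eq_iff)
qed

text \<open>Both sides are continuous in \<open>z\<close>: the left-hand side because \<open>\<kappa> z\<close> is Gaussian and its mean and covariance are
continuous. Their integrals over boxes agree: on the left by disintegration, and on the right because
the regression residual \<open>R\<close> is uncorrelated with \<open>X s\<close> and \<open>X t\<close>, so that \<open>cis (R + p * X s + r * X t)\<close> and
\<open>exp (- covariance M R R / 2) * cis (p * X s + r * X t)\<close> have the same expectation after multiplication by
any \<open>cis (l * X s + m * X t)\<close>.
Since every box has positive mass, agreement holds at every \<open>z\<close>.\<close>

lemma gaussian_conditional_cis:
  assumes gp: "gaussian_process M I X"
    and cont: "\<And>\<omega>. \<omega> \<in> space M \<Longrightarrow> continuous_on I (\<lambda>u. X u \<omega>)"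
    and st: "s \<in> I" "t \<in> I" and uv: "u \<in> I" "v \<in> I"
    and gcl: "gaussian_conditional_law M I X s t \<kappa>"
    and supp: "\<And>z \<delta>. \<delta> > 0 \<Longrightarrow> measure M {\<omega>\<in>space M. \<bar>X s \<omega> - fst z\<bar> < \<delta> \<and> \<bar>X t \<omega> - snd z\<bar> < \<delta>} > 0"
    and R: "R = (\<lambda>\<omega>. c * X u \<omega> + e * X v \<omega> - (p * X s \<omega> + r * X t \<omega>))"
    and orth: "covariance M R (X s) = 0" "covariance M R (X t) = 0"
    and ER: "(LINT \<omega>|M. R \<omega>) = 0"
  shows "(CLINT w|\<kappa> z. cis (c * w u + e * w v))
       = exp (- covariance M R R / 2) * cis (p * fst z + r * snd z)"
proof -
  interpret prob_space M using gp by (simp add: gaussian_process_def)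
  have rcl: "regular_conditional_law M I X s t \<kappa>" and gk: "gaussian_process (\<kappa> z) I (\<lambda>u w. w u)"
    and mean_cont: "a \<in> I \<Longrightarrow> continuous_on UNIV (\<lambda>z. LINT w|\<kappa> z. w a)"
    and cov_cont: "a \<in> I \<Longrightarrow> b \<in> I \<Longrightarrow> continuous_on UNIV (\<lambda>z. covariance (\<kappa> z) (\<lambda>w. w a) (\<lambda>w. w b))" for z a b
    using gcl unfolding gaussian_conditional_law_def by blast+
  define Z where "Z = (\<lambda>\<omega>. (X s \<omega>, X t \<omega>))"
  define \<mu> where "\<mu> = distr M borel Z"
  have Xm[measurable]: "X a \<in> borel_measurable M" if "a \<in> I" for a
    using gaussian_process_measurable[OF gp that] .
  note [measurable] = Xm[OF st(1)] Xm[OF st(2)] Xm[OF uv(1)] Xm[OF uv(2)]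
  have Z[measurable]: "Z \<in> M \<rightarrow>\<^sub>M borel" unfolding Z_def borel_prod[symmetric] by measurable
  interpret \<mu>: prob_space \<mu> unfolding \<mu>_def by (rule prob_space_distr) measurable
  define L where "L w = c * w u + e * w v" for w :: "real \<Rightarrow> real"
  define g where "g z = (CLINT w|\<kappa> z. cis (L w))" for z
  define g0 where "g0 z = exp (- covariance M R R / 2) * cis (p * fst z + r * snd z)" for z
  have span: "X a \<in> lin_span I X" if "a \<in> I" for a using that by (rule lin_span_base)
  have Rspan: "R \<in> lin_span I X"
    unfolding R using uv st by (intro lin_span_diff lin_span_add lin_span_scale span)
  note sq = lin_span_square_integrable[OF gp]
  note [measurable] = path_space_coordinate[OF uv(1)] path_space_coordinate[OF uv(2)]
  have Lm[measurable]: "L \<in> borel_measurable (path_space I)" unfolding L_def by measurable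

  have g_eq: "g z = exp (- covariance (\<kappa> z) L L / 2) * cis (LINT w|\<kappa> z. L w)"
    and EL: "(LINT w|\<kappa> z. L w) = c * (LINT w|\<kappa> z. w u) + e * (LINT w|\<kappa> z. w v)"
    and VL: "covariance (\<kappa> z) L L = c * (c * covariance (\<kappa> z) (\<lambda>w. w u) (\<lambda>w. w u) + e * covariance (\<kappa> z) (\<lambda>w. w u) (\<lambda>w. w v))
        + e * (c * covariance (\<kappa> z) (\<lambda>w. w v) (\<lambda>w. w u) + e * covariance (\<kappa> z) (\<lambda>w. w v) (\<lambda>w. w v))" for z
  proof -
    interpret k: prob_space "\<kappa> z" using gk[of z] by (simp add: gaussian_process_def)
    have su: "(\<lambda>w. w u) \<in> lin_span I (\<lambda>u w. w u)" and sv: "(\<lambda>w. w v) \<in> lin_span I (\<lambda>u w. w u)"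
      using lin_span_base[OF uv(1), of "\<lambda>u w. w u"] lin_span_base[OF uv(2), of "\<lambda>u w. w u"] by auto
    have "L \<in> lin_span I (\<lambda>u w. w u)"
      unfolding L_def[abs_def] by (intro lin_span_add lin_span_scale su sv)
    then show "g z = exp (- covariance (\<kappa> z) L L / 2) * cis (LINT w|\<kappa> z. L w)"
      unfolding g_def by (intro k.cis_gaussian_rv lin_span_gaussian[OF gk])
    note qu = lin_span_square_integrable[OF gk su] and qv = lin_span_square_integrable[OF gk sv]
    show "(LINT w|\<kappa> z. L w) = c * (LINT w|\<kappa> z. w u) + e * (LINT w|\<kappa> z. w v)"
      unfolding L_def using k.square_integrable_integrable[OF qu] k.square_integrable_integrable[OF qv] by simp
    show "covariance (\<kappa> z) L L = c * (c * covariance (\<kappa> z) (\<lambda>w. w u) (\<lambda>w. w u) + e * covariance (\<kappa> z) (\<lambda>w. w u) (\<lambda>w. w v))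
        + e * (c * covariance (\<kappa> z) (\<lambda>w. w v) (\<lambda>w. w u) + e * covariance (\<kappa> z) (\<lambda>w. w v) (\<lambda>w. w v))"
      unfolding L_def[abs_def] using qu qv
      by (simp add: k.covariance_add_left k.covariance_add_right k.covariance_scale_left k.covariance_scale_right
          square_integrable_add square_integrable_scale distrib_left)
  qed
  have gcont: "continuous_on UNIV g"
    unfolding g_eq[abs_def] EL VL using uv by (intro continuous_intros mean_cont cov_cont) auto
  have g0cont: "continuous_on UNIV g0"
    unfolding g0_def by (intro continuous_intros)
  have gbound: "norm (g z) \<le> 1" for z
  proof -
    interpret k: prob_space "\<kappa> z" using gk[of z] by (simp add: gaussian_process_def)
    have "norm (g z) \<le> (LINT w|\<kappa> z. norm (cis (L w)))" unfolding g_def by (rule integral_norm_bound)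
    then show ?thesis by (simp add: k.prob_space)
  qed
  have g0bound: "norm (g0 z) \<le> exp (- covariance M R R / 2)" for z by (simp add: g0_def norm_mult)
  have m\<mu>: "h \<in> borel_measurable \<mu> \<longleftrightarrow> h \<in> borel_measurable borel" for h :: "real \<times> real \<Rightarrow> complex"
    by (simp add: \<mu>_def)
  have gm[measurable]: "g \<in> borel_measurable borel" "g0 \<in> borel_measurable borel"
    using gcont g0cont by (auto intro: borel_measurable_continuous_onI)

  have "g z - g0 z = 0" for z
  proof (rule continuous_zero_of_box_integrals)
    show "finite_measure \<mu>" "sets \<mu> = sets borel" by (auto simp: \<mu>_def intro: \<mu>.finite_measure_axioms[unfolded \<mu>_def])
    show "continuous_on UNIV (\<lambda>z. g z - g0 z)" by (intro continuous_intros gcont g0cont)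
    show "norm (g z - g0 z) \<le> 1 + exp (- covariance M R R / 2)" for z
      using norm_triangle_ineq4[of "g z" "g0 z"] gbound[of z] g0bound[of z] by linarith
    show "measure \<mu> {x. \<bar>fst x - fst z\<bar> < \<delta> \<and> \<bar>snd x - snd z\<bar> < \<delta>} > 0" if "\<delta> > 0" for z \<delta>
    proof -
      have "open {x. \<bar>fst x - fst z\<bar> < \<delta> \<and> \<bar>snd x - snd z\<bar> < \<delta>}"
        by (intro open_Collect_conj open_Collect_less continuous_intros)
      then have "{x. \<bar>fst x - fst z\<bar> < \<delta> \<and> \<bar>snd x - snd z\<bar> < \<delta>} \<in> sets borel" by (rule borel_open)
      then have "measure \<mu> {x. \<bar>fst x - fst z\<bar> < \<delta> \<and> \<bar>snd x - snd z\<bar> < \<delta>}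
         = prob {\<omega>\<in>space M. \<bar>X s \<omega> - fst z\<bar> < \<delta> \<and> \<bar>X t \<omega> - snd z\<bar> < \<delta>}"
        unfolding \<mu>_def by (subst measure_distr) (auto simp: Z_def intro!: arg_cong[where f = prob])
      then show ?thesis using supp[OF that] by simp
    qed
    fix B1 B2 :: "real set" assume B[measurable]: "B1 \<in> sets borel" "B2 \<in> sets borel"
    have S[measurable]: "B1 \<times> B2 \<in> sets (borel :: (real \<times> real) measure)"
      unfolding borel_prod[symmetric] by measurable
    define LX where "LX \<omega> = c * X u \<omega> + e * X v \<omega>" for \<omega>
    have [measurable]: "LX \<in> borel_measurable M" unfolding LX_def by measurable
    have LXe: "L (\<lambda>u\<in>I. X u \<omega>) = LX \<omega>" for \<omega> using uv by (simp add: L_def LX_def)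
    define D where "D = covariance M R R"

    have ints: "integrable M (\<lambda>\<omega>. cis (Y \<omega>) * indicator (B1 \<times> B2) (Z \<omega>))" if "Y \<in> borel_measurable M" for Y
      using that by (intro integrable_const_bound[of _ 1]) (auto simp: norm_mult indicator_def)
    have gint: "integrable \<mu> (\<lambda>z. h z * indicator (B1 \<times> B2) z)"
      if "h \<in> borel_measurable borel" "\<And>z. norm (h z) \<le> K" for h :: "real \<times> real \<Rightarrow> complex" and K
    proof (rule \<mu>.integrable_const_bound[of _ K])
      have "0 \<le> K" using order_trans[OF norm_ge_zero that(2)] .
      then show "AE z in \<mu>. norm (h z * indicator (B1 \<times> B2) z) \<le> K"
        using that(2) by (intro AE_I2) (simp add: indicator_def)
      show "(\<lambda>z. h z * indicator (B1 \<times> B2) z) \<in> borel_measurable \<mu>"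
        unfolding m\<mu> using that(1) by measurable
    qed
    have dis: "(LINT \<omega>|M. f (L (\<lambda>u\<in>I. X u \<omega>)) * indicator (B1 \<times> B2) (Z \<omega>))
        = (LINT z|\<mu>. (LINT w|\<kappa> z. f (L w)) * indicator (B1 \<times> B2) z)"
      if [measurable]: "f \<in> borel_measurable borel" and "\<And>x. \<bar>f x\<bar> \<le> 1" for f :: "real \<Rightarrow> real"
      unfolding Z_def \<mu>_def
      by (rule regular_conditional_law_integral[OF prob_space_axioms rcl Xm st cont, where f = "\<lambda>w. f (L w)" and K = 1 and S = "B1 \<times> B2"])
         (use that in auto)
    have Rg: "Re (g z) = (LINT w|\<kappa> z. cos (L w))" and Ig: "Im (g z) = (LINT w|\<kappa> z. sin (L w))" for z
    proof -
      interpret k: prob_space "\<kappa> z" using gk[of z] by (simp add: gaussian_process_def)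
      have "\<kappa> z \<in> space (prob_algebra (path_space I))"
        using rcl measurable_space[of \<kappa> borel "prob_algebra (path_space I)" z] by (simp add: regular_conditional_law_def)
      then have [measurable_cong]: "sets (\<kappa> z) = sets (path_space I)" by (simp add: space_prob_algebra)
      have "integrable (\<kappa> z) (\<lambda>w. cis (L w))" by (intro k.integrable_const_bound[of _ 1]) auto
      then show "Re (g z) = (LINT w|\<kappa> z. cos (L w))" "Im (g z) = (LINT w|\<kappa> z. sin (L w))"
        unfolding g_def by (simp_all flip: integral_Re integral_Im)
    qed
    have lhs: "(CLINT \<omega>|M. cis (LX \<omega>) * indicator (B1 \<times> B2) (Z \<omega>)) = (CLINT z|\<mu>. g z * indicator (B1 \<times> B2) z)"
    proof (rule complex_eqI)
      have "Re (CLINT \<omega>|M. cis (LX \<omega>) * indicator (B1 \<times> B2) (Z \<omega>))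
          = (LINT \<omega>|M. Re (cis (LX \<omega>) * indicator (B1 \<times> B2) (Z \<omega>)))"
        by (intro integral_Re[symmetric] ints) measurable
      also have "\<dots> = (LINT \<omega>|M. cos (L (\<lambda>u\<in>I. X u \<omega>)) * indicator (B1 \<times> B2) (Z \<omega>))"
        by (intro Bochner_Integration.integral_cong refl) (auto simp: LXe indicator_def)
      also have "\<dots> = (LINT z|\<mu>. (LINT w|\<kappa> z. cos (L w)) * indicator (B1 \<times> B2) z)"
        by (rule dis) auto
      also have "\<dots> = (LINT z|\<mu>. Re (g z * indicator (B1 \<times> B2) z))"
        by (intro Bochner_Integration.integral_cong refl) (auto simp: Rg indicator_def)
      also have "\<dots> = Re (CLINT z|\<mu>. g z * indicator (B1 \<times> B2) z)"
        using gint[OF gm(1) gbound] by (rule integral_Re)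
      finally show "Re (CLINT \<omega>|M. cis (LX \<omega>) * indicator (B1 \<times> B2) (Z \<omega>)) = Re (CLINT z|\<mu>. g z * indicator (B1 \<times> B2) z)" .
      have "Im (CLINT \<omega>|M. cis (LX \<omega>) * indicator (B1 \<times> B2) (Z \<omega>))
          = (LINT \<omega>|M. Im (cis (LX \<omega>) * indicator (B1 \<times> B2) (Z \<omega>)))"
        by (intro integral_Im[symmetric] ints) measurable
      also have "\<dots> = (LINT \<omega>|M. sin (L (\<lambda>u\<in>I. X u \<omega>)) * indicator (B1 \<times> B2) (Z \<omega>))"
        by (intro Bochner_Integration.integral_cong refl) (auto simp: LXe indicator_def)
      also have "\<dots> = (LINT z|\<mu>. (LINT w|\<kappa> z. sin (L w)) * indicator (B1 \<times> B2) z)"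
        by (rule dis) auto
      also have "\<dots> = (LINT z|\<mu>. Im (g z * indicator (B1 \<times> B2) z))"
        by (intro Bochner_Integration.integral_cong refl) (auto simp: Ig indicator_def)
      also have "\<dots> = Im (CLINT z|\<mu>. g z * indicator (B1 \<times> B2) z)"
        using gint[OF gm(1) gbound] by (rule integral_Im)
      finally show "Im (CLINT \<omega>|M. cis (LX \<omega>) * indicator (B1 \<times> B2) (Z \<omega>)) = Im (CLINT z|\<mu>. g z * indicator (B1 \<times> B2) z)" .
    qed

    \<comment> \<open>by uniqueness of weighted Fourier transforms, \<open>R\<close> may be averaged out over boxes\<close>
    define N where "N \<omega> = p * X s \<omega> + r * X t \<omega>" for \<omega>
    have [measurable]: "N \<in> borel_measurable M" unfolding N_def by measurable
    have LXR: "LX \<omega> = R \<omega> + N \<omega>" for \<omega> by (simp add: LX_def R N_def)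
    let ?F = "\<lambda>\<omega>. cis (LX \<omega>) - complex_of_real (exp (- D / 2)) * cis (N \<omega>)"
    have icis: "integrable M (\<lambda>\<omega>. cis (Y \<omega>))" if "Y \<in> borel_measurable M" for Y
      using that by (intro integrable_const_bound[of _ 1]) auto
    \<comment> \<open>the two conditioning values, indexed by truth values as a two-element index set\<close>
    define XX where "XX j = (if j then X s else X t)" for j
    define BB where "BB j = (if j then B1 else B2)" for j
    have "(CLINT \<omega>|M. ?F \<omega> * (\<Prod>j\<in>UNIV. indicator (BB j) (XX j \<omega>))) = 0"
    proof (rule fourier_uniqueness_product)
      show "integrable M ?F" by (intro Bochner_Integration.integrable_diff integrable_mult_right icis) measurable
      show "XX j \<in> borel_measurable M" for j unfolding XX_def using st Xm by auto
      show "BB j \<in> sets borel" for j unfolding BB_def using B by auto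
      fix l :: "bool \<Rightarrow> real"
      define A where "A \<omega> = (p + l True) * X s \<omega> + (r + l False) * X t \<omega>" for \<omega>
      have A: "A \<in> lin_span I X" unfolding A_def[abs_def] using st by (intro lin_span_add lin_span_scale span)
      have Am[measurable]: "A \<in> borel_measurable M" using sq[OF A] by (simp add: square_integrable_def)
      have Rm[measurable]: "R \<in> borel_measurable M" using sq[OF Rspan] by (simp add: square_integrable_def)
      have "covariance M R A = 0"
        unfolding A_def[abs_def] using sq[OF span[OF st(1)]] sq[OF span[OF st(2)]] sq[OF Rspan] orth
        by (simp add: covariance_add_right covariance_scale_right square_integrable_scale)
      then have "(CLINT \<omega>|M. cis (R \<omega> + A \<omega>)) = (CLINT \<omega>|M. cis (R \<omega>)) * (CLINT \<omega>|M. cis (A \<omega>))"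
        by (rule cis_uncorrelated[OF gp Rspan A])
      also have "(CLINT \<omega>|M. cis (R \<omega>)) = exp (- D / 2)"
        using cis_gaussian_rv[OF lin_span_gaussian[OF gp Rspan]] by (simp add: ER D_def)
      finally have RA: "(CLINT \<omega>|M. cis (R \<omega> + A \<omega>)) = exp (- D / 2) * (CLINT \<omega>|M. cis (A \<omega>))" .
      have "?F \<omega> * cis (\<Sum>j\<in>UNIV. l j * XX j \<omega>) = cis (R \<omega> + A \<omega>) - complex_of_real (exp (- D / 2)) * cis (A \<omega>)" for \<omega>
      proof -
        have "(\<Sum>j\<in>UNIV. l j * XX j \<omega>) = l True * X s \<omega> + l False * X t \<omega>"
          by (simp add: UNIV_bool XX_def)
        then have "R \<omega> + A \<omega> = LX \<omega> + (\<Sum>j\<in>UNIV. l j * XX j \<omega>)" "A \<omega> = N \<omega> + (\<Sum>j\<in>UNIV. l j * XX j \<omega>)"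
          by (simp_all add: LXR N_def A_def algebra_simps)
        then show ?thesis by (simp only: left_diff_distrib mult.assoc cis_mult)
      qed
      then show "(CLINT \<omega>|M. ?F \<omega> * cis (\<Sum>j\<in>UNIV. l j * XX j \<omega>)) = 0"
        using RA icis[of "\<lambda>\<omega>. R \<omega> + A \<omega>"] icis[of A] by simp
    qed auto
    also have "(\<lambda>\<omega>. ?F \<omega> * (\<Prod>j\<in>UNIV. indicator (BB j) (XX j \<omega>)))
        = (\<lambda>\<omega>. cis (LX \<omega>) * indicator (B1 \<times> B2) (Z \<omega>)
             - complex_of_real (exp (- D / 2)) * (cis (N \<omega>) * indicator (B1 \<times> B2) (Z \<omega>)))"
      by (auto simp: fun_eq_iff UNIV_bool BB_def XX_def Z_def indicator_def)
    finally have "(CLINT \<omega>|M. cis (LX \<omega>) * indicator (B1 \<times> B2) (Z \<omega>))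
        = complex_of_real (exp (- D / 2)) * (CLINT \<omega>|M. cis (N \<omega>) * indicator (B1 \<times> B2) (Z \<omega>))"
      using ints[of LX] ints[of N] by simp
    also have "\<dots> = (CLINT \<omega>|M. g0 (Z \<omega>) * indicator (B1 \<times> B2) (Z \<omega>))"
      unfolding g0_def D_def[symmetric] using ints[of N] by (simp add: N_def Z_def mult.assoc)
    also have "\<dots> = (CLINT z|\<mu>. g0 z * indicator (B1 \<times> B2) z)"
      unfolding \<mu>_def by (rule integral_distr[symmetric]) measurable
    finally show "(CLINT z|\<mu>. (g z - g0 z) * indicator (B1 \<times> B2) z) = 0"
      using lhs gint[OF gm(1) gbound] gint[OF gm(2) g0bound] by (simp add: left_diff_distrib)
  qed
  then show ?thesis by (simp add: g_def g0_def L_def)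
qed

text \<open>The absolute values of the two Fourier transforms determine the variance. Their arguments determine
the mean only modulo \<open>2 * pi\<close>, so all multiples of the linear combination are used.\<close>

lemma gaussian_conditional_moments:
  assumes gp: "gaussian_process M I X"
    and cont: "\<And>\<omega>. \<omega> \<in> space M \<Longrightarrow> continuous_on I (\<lambda>u. X u \<omega>)"
    and st: "s \<in> I" "t \<in> I" and uv: "u \<in> I" "v \<in> I"
    and gcl: "gaussian_conditional_law M I X s t \<kappa>"
    and supp: "\<And>z \<delta>. \<delta> > 0 \<Longrightarrow> measure M {\<omega>\<in>space M. \<bar>X s \<omega> - fst z\<bar> < \<delta> \<and> \<bar>X t \<omega> - snd z\<bar> < \<delta>} > 0"
    and R: "R = (\<lambda>\<omega>. c * X u \<omega> + e * X v \<omega> - (p * X s \<omega> + r * X t \<omega>))"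
    and orth: "covariance M R (X s) = 0" "covariance M R (X t) = 0"
    and ER: "(LINT \<omega>|M. R \<omega>) = 0"
  shows "(LINT w|\<kappa> z. c * w u + e * w v) = p * fst z + r * snd z"
    and "covariance (\<kappa> z) (\<lambda>w. c * w u + e * w v) (\<lambda>w. c * w u + e * w v) = covariance M R R"
proof -
  interpret prob_space M using gp by (simp add: gaussian_process_def)
  have gk: "gaussian_process (\<kappa> z) I (\<lambda>u w. w u)" using gcl unfolding gaussian_conditional_law_def by blast
  interpret k: prob_space "\<kappa> z" using gk by (simp add: gaussian_process_def)
  define L where "L w = c * w u + e * w v" for w :: "real \<Rightarrow> real"
  define m where "m = (LINT w|\<kappa> z. L w)"
  define m0 where "m0 = p * fst z + r * snd z"
  have Lspan: "L \<in> lin_span I (\<lambda>u w. w u)"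
    unfolding L_def[abs_def]
    using lin_span_base[OF uv(1), of "\<lambda>u w. w u"] lin_span_base[OF uv(2), of "\<lambda>u w. w u"]
    by (intro lin_span_add lin_span_scale)
  note sqL = lin_span_square_integrable[OF gk Lspan]
  have Rspan: "R \<in> lin_span I X"
    unfolding R using uv st by (intro lin_span_diff lin_span_add lin_span_scale lin_span_base)
  note sq = lin_span_square_integrable[OF gp]
  have key: "exp (- (\<theta>\<^sup>2 * covariance (\<kappa> z) L L) / 2) * cis (\<theta> * m) = exp (- (\<theta>\<^sup>2 * covariance M R R) / 2) * cis (\<theta> * m0)" for \<theta>
  proof -
    have cR: "covariance M (\<lambda>\<omega>. \<theta> * R \<omega>) (X a) = \<theta> * covariance M R (X a)" if "a \<in> I" for a
      using sq[OF Rspan] sq[OF lin_span_base[OF that]] by (rule covariance_scale_left)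
    have "(CLINT w|\<kappa> z. cis (\<theta> * c * w u + \<theta> * e * w v))
       = exp (- covariance M (\<lambda>\<omega>. \<theta> * R \<omega>) (\<lambda>\<omega>. \<theta> * R \<omega>) / 2) * cis (\<theta> * p * fst z + \<theta> * r * snd z)"
    proof (rule gaussian_conditional_cis[OF gp cont st uv gcl supp])
      show "(\<lambda>\<omega>. \<theta> * R \<omega>) = (\<lambda>\<omega>. \<theta> * c * X u \<omega> + \<theta> * e * X v \<omega> - (\<theta> * p * X s \<omega> + \<theta> * r * X t \<omega>))"
        by (simp add: R algebra_simps)
    qed (use orth ER cR st in auto)
    also have "covariance M (\<lambda>\<omega>. \<theta> * R \<omega>) (\<lambda>\<omega>. \<theta> * R \<omega>) = \<theta>\<^sup>2 * covariance M R R"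
      using sq[OF Rspan] by (simp add: covariance_scale_left covariance_scale_right square_integrable_scale power2_eq_square)
    also have "\<theta> * p * fst z + \<theta> * r * snd z = \<theta> * m0" by (simp add: m0_def algebra_simps)
    also have "(CLINT w|\<kappa> z. cis (\<theta> * c * w u + \<theta> * e * w v)) = (CLINT w|\<kappa> z. cis (\<theta> * L w))"
      by (simp add: L_def algebra_simps)
    also have "\<dots> = exp (- covariance (\<kappa> z) (\<lambda>w. \<theta> * L w) (\<lambda>w. \<theta> * L w) / 2) * cis (LINT w|\<kappa> z. \<theta> * L w)"
      by (intro k.cis_gaussian_rv lin_span_gaussian[OF gk] lin_span_scale Lspan)
    also have "covariance (\<kappa> z) (\<lambda>w. \<theta> * L w) (\<lambda>w. \<theta> * L w) = \<theta>\<^sup>2 * covariance (\<kappa> z) L L"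
      using sqL by (simp add: k.covariance_scale_left k.covariance_scale_right square_integrable_scale power2_eq_square)
    also have "(LINT w|\<kappa> z. \<theta> * L w) = \<theta> * m" by (simp add: m_def)
    finally show ?thesis .
  qed
  have "norm (exp (- (1\<^sup>2 * covariance (\<kappa> z) L L) / 2) * cis (1 * m)) = norm (exp (- (1\<^sup>2 * covariance M R R) / 2) * cis (1 * m0))"
    unfolding key ..
  then have V: "covariance (\<kappa> z) L L = covariance M R R" by (simp add: norm_mult)
  then show "covariance (\<kappa> z) (\<lambda>w. c * w u + e * w v) (\<lambda>w. c * w u + e * w v) = covariance M R R"
    by (simp add: L_def[abs_def])
  have "cis (\<theta> * m) = cis (\<theta> * m0)" for \<theta> using key[of \<theta>] by (simp add: V)
  then have "m = m0" by (rule cis_eq_imp_eq)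
  then show "(LINT w|\<kappa> z. c * w u + e * w v) = p * fst z + r * snd z"
    by (simp add: m_def m0_def L_def[abs_def])
qed

section \<open>The Slepian process between two fixed values\<close>

context
  fixes M :: "'a measure" and W :: "real \<Rightarrow> 'a \<Rightarrow> real" and q d t\<^sub>0 t\<^sub>1 :: real
  assumes q: "0 < q" and d: "d \<le> 2 * q" and W: "slepian_process M q d W"
    and sub: "{t\<^sub>0..t\<^sub>1} \<subseteq> {q..d}" and t01: "t\<^sub>0 < t\<^sub>1"
begin

interpretation prob_space M
  using W by (simp add: slepian_process_def gaussian_process_def)

lemma slepian_gp: "gaussian_process M {q..d} W"
  using W by (simp add: slepian_process_def)

lemma endpoints: "t\<^sub>0 \<in> {q..d}" "t\<^sub>1 \<in> {q..d}"
  using sub t01 by auto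

text \<open>This is where \<open>d \<le> 2 * q\<close> enters: two times in \<open>[q, d]\<close> differ by at most \<open>q\<close>.\<close>

lemma slepian_cov:
  assumes "u \<in> {q..d}" "v \<in> {q..d}"
  shows "covariance M (W u) (W v) = 1 - \<bar>u - v\<bar> / q"
proof -
  have *: "covariance M (W u) (W v) = 1 - \<bar>u - v\<bar> / q" if "u \<le> v" "u \<in> {q..d}" "v \<in> {q..d}" for u v
  proof -
    have "q \<le> s \<Longrightarrow> s \<le> s + t \<Longrightarrow> s + t \<le> d \<Longrightarrow> covariance M (W s) (W (s + t)) = max 0 (1 - t / q)" for s t
      using W unfolding slepian_process_def by blast
    from this[of u "v - u"] have "covariance M (W u) (W (u + (v - u))) = max 0 (1 - (v - u) / q)"
      using that by simp
    moreover have "(v - u) / q \<le> 1" using that d q by simp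
    ultimately show ?thesis using that by simp
  qed
  show ?thesis
  proof (cases "u \<le> v")
    case True
    then show ?thesis using * assms by blast
  next
    case False
    then show ?thesis using *[of v u] assms by (simp add: covariance_commute[of M "W u"])
  qed
qed

lemma slepian_mean: "u \<in> {q..d} \<Longrightarrow> expectation (W u) = 0"
  using W by (simp add: slepian_process_def)

lemma slepian_sq: "u \<in> {q..d} \<Longrightarrow> square_integrable M (W u)"
  by (rule lin_span_square_integrable[OF slepian_gp lin_span_base])

text \<open>The end values form a nondegenerate Gaussian pair: \<open>W t\<^sub>1\<close> is \<open>\<rho> * W t\<^sub>0\<close> plus an independent Gaussian variable
of variance \<open>1 - \<rho>\<^sup>2 > 0\<close>, and both of these charge every interval.\<close>

lemma slepian_endpoints_support:
  assumes \<delta>: "\<delta> > 0"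
  shows "prob {\<omega>\<in>space M. \<bar>W t\<^sub>0 \<omega> - fst z\<bar> < \<delta> \<and> \<bar>W t\<^sub>1 \<omega> - snd z\<bar> < \<delta>} > 0"
proof -
  define \<rho> where "\<rho> = 1 - (t\<^sub>1 - t\<^sub>0) / q"
  have "(t\<^sub>1 - t\<^sub>0) / q \<le> 1" "(t\<^sub>1 - t\<^sub>0) / q > 0" using endpoints t01 d q by auto
  then have \<rho>: "0 \<le> \<rho>" "\<rho> < 1" by (auto simp: \<rho>_def)
  define V where "V \<omega> = W t\<^sub>1 \<omega> + (- \<rho>) * W t\<^sub>0 \<omega>" for \<omega>
  have V: "V \<in> lin_span {q..d} W" unfolding V_def[abs_def]
    by (intro lin_span_add lin_span_scale lin_span_base endpoints)
  note s0 = slepian_sq[OF endpoints(1)] and s1 = slepian_sq[OF endpoints(2)]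
  have [measurable]: "W t\<^sub>0 \<in> borel_measurable M" "W t\<^sub>1 \<in> borel_measurable M" "V \<in> borel_measurable M"
    using s0 s1 lin_span_square_integrable[OF slepian_gp V] by (auto simp: square_integrable_def)
  have c00: "covariance M (W t\<^sub>0) (W t\<^sub>0) = 1" and c11: "covariance M (W t\<^sub>1) (W t\<^sub>1) = 1"
    and c10: "covariance M (W t\<^sub>1) (W t\<^sub>0) = \<rho>" and c01: "covariance M (W t\<^sub>0) (W t\<^sub>1) = \<rho>"
    using t01 endpoints by (simp_all add: slepian_cov \<rho>_def)
  have VX: "covariance M V X = covariance M (W t\<^sub>1) X + (- \<rho>) * covariance M (W t\<^sub>0) X" if "square_integrable M X" for X
    unfolding V_def[abs_def] covariance_add_left[OF s1 square_integrable_scale[OF s0] that]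
      covariance_scale_left[OF s0 that] ..
  have V0: "covariance M (W t\<^sub>0) V = 0"
    using VX[OF s0] by (simp add: covariance_commute[of M _ V] c00 c10)
  have "covariance M V V = covariance M (W t\<^sub>1) V"
    using VX[OF lin_span_square_integrable[OF slepian_gp V]] V0 by simp
  also have "\<dots> = 1 - \<rho>\<^sup>2"
    using VX[OF s1] by (simp add: covariance_commute[of M _ V] c11 c01 power2_eq_square)
  finally have VV: "covariance M V V > 0" using \<rho> by (simp add: power_less_one_iff)
  define B where "B = {x. \<bar>x - fst z\<bar> < \<delta> / 2}"
  define B' where "B' = {x. \<bar>x - (snd z - \<rho> * fst z)\<bar> < \<delta> / 2}"
  have [measurable]: "B \<in> sets borel" "B' \<in> sets borel" unfolding B_def B'_def by measurable
  have "prob {\<omega>\<in>space M. W t\<^sub>0 \<omega> \<in> B} > 0"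
    unfolding B_def mem_Collect_eq using \<delta>
    by (intro gaussian_rv_interval_pos lin_span_gaussian[OF slepian_gp lin_span_base] endpoints) (auto simp: c00)
  moreover have "prob {\<omega>\<in>space M. V \<omega> \<in> B'} > 0"
    unfolding B'_def mem_Collect_eq using \<delta> VV
    by (intro gaussian_rv_interval_pos lin_span_gaussian[OF slepian_gp V]) auto
  ultimately have "prob {\<omega>\<in>space M. W t\<^sub>0 \<omega> \<in> B \<and> V \<omega> \<in> B'} > 0"
    using uncorrelated_independent[OF slepian_gp lin_span_base[OF endpoints(1)] V V0, of B B'] by simp
  also have "\<dots> \<le> prob {\<omega>\<in>space M. \<bar>W t\<^sub>0 \<omega> - fst z\<bar> < \<delta> \<and> \<bar>W t\<^sub>1 \<omega> - snd z\<bar> < \<delta>}"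
  proof (rule finite_measure_mono)
    show "{\<omega>\<in>space M. W t\<^sub>0 \<omega> \<in> B \<and> V \<omega> \<in> B'}
        \<subseteq> {\<omega>\<in>space M. \<bar>W t\<^sub>0 \<omega> - fst z\<bar> < \<delta> \<and> \<bar>W t\<^sub>1 \<omega> - snd z\<bar> < \<delta>}"
    proof safe
      fix \<omega> assume "W t\<^sub>0 \<omega> \<in> B" "V \<omega> \<in> B'"
      then have b: "\<bar>W t\<^sub>0 \<omega> - fst z\<bar> < \<delta> / 2" "\<bar>V \<omega> - (snd z - \<rho> * fst z)\<bar> < \<delta> / 2"
        by (auto simp: B_def B'_def)
      then show "\<bar>W t\<^sub>0 \<omega> - fst z\<bar> < \<delta>" using \<delta> by linarith
      have "W t\<^sub>1 \<omega> - snd z = \<rho> * (W t\<^sub>0 \<omega> - fst z) + (V \<omega> - (snd z - \<rho> * fst z))"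
        by (simp add: V_def algebra_simps)
      then have "\<bar>W t\<^sub>1 \<omega> - snd z\<bar> \<le> \<bar>\<rho> * (W t\<^sub>0 \<omega> - fst z)\<bar> + \<bar>V \<omega> - (snd z - \<rho> * fst z)\<bar>"
        by (metis abs_triangle_ineq)
      also have "\<bar>\<rho> * (W t\<^sub>0 \<omega> - fst z)\<bar> \<le> 1 * \<bar>W t\<^sub>0 \<omega> - fst z\<bar>"
        unfolding abs_mult using \<rho> by (intro mult_right_mono) auto
      finally show "\<bar>W t\<^sub>1 \<omega> - snd z\<bar> < \<delta>" using b by simp
    qed
  qed measurable
  finally show ?thesis .
qed

text \<open>The minus signs are kept inside the coefficients so that the linearity rules for the covariance apply
as they stand.\<close>

definition bridge_residual :: "real \<Rightarrow> 'a \<Rightarrow> real" where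
  "bridge_residual u \<omega> = W u \<omega> + (- ((t\<^sub>1 - u) / (t\<^sub>1 - t\<^sub>0))) * W t\<^sub>0 \<omega> + (- ((u - t\<^sub>0) / (t\<^sub>1 - t\<^sub>0))) * W t\<^sub>1 \<omega>"

text \<open>On \<open>[t\<^sub>0, t\<^sub>1]\<close> the covariances of \<open>W u\<close> with \<open>W t\<^sub>0\<close> and \<open>W t\<^sub>1\<close> are affine functions of \<open>u\<close>, so that linear
interpolation between the end values is the regression of \<open>W u\<close> on them. The residual has the covariance of a Brownian bridge.\<close>

lemma bridge_residual:
  assumes u: "u \<in> {t\<^sub>0..t\<^sub>1}"
  shows "bridge_residual u \<in> lin_span {q..d} W"
    and "expectation (bridge_residual u) = 0"
    and "covariance M (bridge_residual u) (W t\<^sub>0) = 0"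
    and "covariance M (bridge_residual u) (W t\<^sub>1) = 0"
    and "v \<in> {u..t\<^sub>1} \<Longrightarrow> covariance M (bridge_residual u) (bridge_residual v) = 2 / q * (u - t\<^sub>0) * (t\<^sub>1 - v) / (t\<^sub>1 - t\<^sub>0)"
proof -
  have h: "t\<^sub>1 - t\<^sub>0 > 0" using t01 by simp
  have span: "bridge_residual u \<in> lin_span {q..d} W" if "u \<in> {t\<^sub>0..t\<^sub>1}" for u
    unfolding bridge_residual_def[abs_def]
    using that sub by (intro lin_span_add lin_span_scale lin_span_base endpoints) auto
  then show "bridge_residual u \<in> lin_span {q..d} W" using u by blast
  have sq: "square_integrable M (bridge_residual u)" if "u \<in> {t\<^sub>0..t\<^sub>1}" for u
    using lin_span_square_integrable[OF slepian_gp span[OF that]] .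
  have ud: "u \<in> {q..d}" if "u \<in> {t\<^sub>0..t\<^sub>1}" for u using that sub by auto
  note s0 = slepian_sq[OF endpoints(1)] and s1 = slepian_sq[OF endpoints(2)]
  show "expectation (bridge_residual u) = 0"
    unfolding bridge_residual_def
    using square_integrable_integrable[OF slepian_sq[OF ud[OF u]]] square_integrable_integrable[OF s0]
      square_integrable_integrable[OF s1]
    by (simp add: slepian_mean[OF endpoints(1)] slepian_mean[OF endpoints(2)] slepian_mean[OF ud[OF u]])
  have cov: "covariance M (bridge_residual u) X = covariance M (W u) X
      + (- ((t\<^sub>1 - u) / (t\<^sub>1 - t\<^sub>0))) * covariance M (W t\<^sub>0) X + (- ((u - t\<^sub>0) / (t\<^sub>1 - t\<^sub>0))) * covariance M (W t\<^sub>1) X"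
    if "square_integrable M X" "u \<in> {t\<^sub>0..t\<^sub>1}" for X u
    unfolding bridge_residual_def[abs_def]
      covariance_add_left[OF square_integrable_add[OF slepian_sq[OF ud[OF that(2)]] square_integrable_scale[OF s0]] square_integrable_scale[OF s1] that(1)]
      covariance_add_left[OF slepian_sq[OF ud[OF that(2)]] square_integrable_scale[OF s0] that(1)]
      covariance_scale_left[OF s0 that(1)] covariance_scale_left[OF s1 that(1)] ..
  have 0: "covariance M (bridge_residual u) (W t\<^sub>0) = 0" if "u \<in> {t\<^sub>0..t\<^sub>1}" for u
    using cov[OF s0 that] that h q ud[OF that] endpoints by (simp add: slepian_cov field_simps)
  have 1: "covariance M (bridge_residual u) (W t\<^sub>1) = 0" if "u \<in> {t\<^sub>0..t\<^sub>1}" for u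
    using cov[OF s1 that] that h q ud[OF that] endpoints by (simp add: slepian_cov field_simps)
  show "covariance M (bridge_residual u) (W t\<^sub>0) = 0" "covariance M (bridge_residual u) (W t\<^sub>1) = 0"
    using 0 1 u by auto
  assume v: "v \<in> {u..t\<^sub>1}"
  with u have v': "v \<in> {t\<^sub>0..t\<^sub>1}" by auto
  have "covariance M (bridge_residual u) (bridge_residual v) = covariance M (W u) (bridge_residual v)"
    unfolding cov[OF sq[OF v'] u] covariance_commute[of M "W t\<^sub>0" "bridge_residual v"]
      covariance_commute[of M "W t\<^sub>1" "bridge_residual v"] 0[OF v'] 1[OF v'] by simp
  also have "\<dots> = covariance M (bridge_residual v) (W u)" by (rule covariance_commute)
  also have "\<dots> = 2 / q * (u - t\<^sub>0) * (t\<^sub>1 - v) / (t\<^sub>1 - t\<^sub>0)"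
    unfolding cov[OF slepian_sq[OF ud[OF u]] v']
  proof -
    define H \<alpha> \<beta> where "H = t\<^sub>1 - t\<^sub>0" and "\<alpha> = u - t\<^sub>0" and "\<beta> = v - t\<^sub>0"
    have "covariance M (W v) (W u) = 1 - (\<beta> - \<alpha>) / q" "covariance M (W t\<^sub>0) (W u) = 1 - \<alpha> / q"
      "covariance M (W t\<^sub>1) (W u) = 1 - (H - \<alpha>) / q"
      using u v ud[OF u] ud[OF v'] endpoints by (simp_all add: slepian_cov H_def \<alpha>_def \<beta>_def)
    moreover have "t\<^sub>1 - v = H - \<beta>" "t\<^sub>1 - t\<^sub>0 = H" "v - t\<^sub>0 = \<beta>" "u - t\<^sub>0 = \<alpha>"
      by (simp_all add: H_def \<alpha>_def \<beta>_def)
    moreover have "H > 0" using h by (simp add: H_def)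
    then have "1 - (\<beta> - \<alpha>) / q + - ((H - \<beta>) / H) * (1 - \<alpha> / q) + - (\<beta> / H) * (1 - (H - \<alpha>) / q)
        = 2 / q * \<alpha> * (H - \<beta>) / H"
      using q by (simp add: field_simps)
    ultimately show "covariance M (W v) (W u) + - ((t\<^sub>1 - v) / (t\<^sub>1 - t\<^sub>0)) * covariance M (W t\<^sub>0) (W u)
        + - ((v - t\<^sub>0) / (t\<^sub>1 - t\<^sub>0)) * covariance M (W t\<^sub>1) (W u) = 2 / q * (u - t\<^sub>0) * (t\<^sub>1 - v) / (t\<^sub>1 - t\<^sub>0)"
      by (simp only:)
  qed
  finally show "covariance M (bridge_residual u) (bridge_residual v) = 2 / q * (u - t\<^sub>0) * (t\<^sub>1 - v) / (t\<^sub>1 - t\<^sub>0)" .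
qed

text \<open>Under the conditional law given \<open>W t\<^sub>0 = fst z\<close> and \<open>W t\<^sub>1 = snd z\<close>, the process on \<open>[t\<^sub>0, t\<^sub>1]\<close> is the Brownian
bridge between these values. Its covariance follows by polarisation from the variances of \<open>w u\<close>, \<open>w v\<close> and
\<open>w u + w v\<close>.\<close>

lemma slepian_conditional_bridge:
  assumes gcl: "gaussian_conditional_law M {q..d} W t\<^sub>0 t\<^sub>1 \<kappa>"
    and u: "u \<in> {t\<^sub>0..t\<^sub>1}" and v: "v \<in> {u..t\<^sub>1}"
  shows "(LINT w|\<kappa> z. w u) = ((t\<^sub>1 - u) * fst z + (u - t\<^sub>0) * snd z) / (t\<^sub>1 - t\<^sub>0)"
    and "covariance (\<kappa> z) (\<lambda>w. w u) (\<lambda>w. w v) = 2 / q * (u - t\<^sub>0) * (t\<^sub>1 - v) / (t\<^sub>1 - t\<^sub>0)"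
proof -
  define K where "K u v = 2 / q * (u - t\<^sub>0) * (t\<^sub>1 - v) / (t\<^sub>1 - t\<^sub>0)" for u v
  have v': "v \<in> {t\<^sub>0..t\<^sub>1}" using u v by auto
  have uv: "u \<in> {q..d}" "v \<in> {q..d}" using u v' sub by auto
  have cont: "continuous_on {q..d} (\<lambda>u. W u \<omega>)" if "\<omega> \<in> space M" for \<omega>
    using W that by (simp add: slepian_process_def)
  have gk: "gaussian_process (\<kappa> z) {q..d} (\<lambda>u w. w u)" using gcl unfolding gaussian_conditional_law_def by blast
  interpret k: prob_space "\<kappa> z" using gk by (simp add: gaussian_process_def)
  note Ru = bridge_residual[OF u] and Rv = bridge_residual[OF v']
  have ru: "square_integrable M (bridge_residual u)" and rv: "square_integrable M (bridge_residual v)"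
    using lin_span_square_integrable[OF slepian_gp] Ru(1) Rv(1) by auto
  note s0 = slepian_sq[OF endpoints(1)] and s1 = slepian_sq[OF endpoints(2)]
  have mom: "(LINT w|\<kappa> z. c * w u + e * w v) = (c * ((t\<^sub>1 - u) / (t\<^sub>1 - t\<^sub>0)) + e * ((t\<^sub>1 - v) / (t\<^sub>1 - t\<^sub>0))) * fst z
        + (c * ((u - t\<^sub>0) / (t\<^sub>1 - t\<^sub>0)) + e * ((v - t\<^sub>0) / (t\<^sub>1 - t\<^sub>0))) * snd z"
    "covariance (\<kappa> z) (\<lambda>w. c * w u + e * w v) (\<lambda>w. c * w u + e * w v)
        = c\<^sup>2 * K u u + 2 * c * e * K u v + e\<^sup>2 * K v v" for c e
  proof -
    let ?R = "\<lambda>\<omega>. c * bridge_residual u \<omega> + e * bridge_residual v \<omega>"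
    have 1: "?R = (\<lambda>\<omega>. c * W u \<omega> + e * W v \<omega>
        - ((c * ((t\<^sub>1 - u) / (t\<^sub>1 - t\<^sub>0)) + e * ((t\<^sub>1 - v) / (t\<^sub>1 - t\<^sub>0))) * W t\<^sub>0 \<omega>
           + (c * ((u - t\<^sub>0) / (t\<^sub>1 - t\<^sub>0)) + e * ((v - t\<^sub>0) / (t\<^sub>1 - t\<^sub>0))) * W t\<^sub>1 \<omega>))"
    proof -
      have "c * (U + (- l) * A + (- m) * B) + e * (V + (- l') * A + (- m') * B)
          = c * U + e * V - ((c * l + e * l') * A + (c * m + e * m') * B)" for U V A B l m l' m' :: real
        by (simp add: algebra_simps)
      then show ?thesis unfolding bridge_residual_def by (intro ext)
    qed
    have 2: "covariance M ?R X = c * covariance M (bridge_residual u) X + e * covariance M (bridge_residual v) X"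
      if "square_integrable M X" for X
      unfolding covariance_add_left[OF square_integrable_scale[OF ru] square_integrable_scale[OF rv] that]
        covariance_scale_left[OF ru that] covariance_scale_left[OF rv that] ..
    have 3: "covariance M ?R (W t\<^sub>0) = 0" "covariance M ?R (W t\<^sub>1) = 0"
      unfolding 2[OF s0] 2[OF s1] using Ru(3,4) Rv(3,4) by auto
    have 4: "expectation ?R = 0"
      using square_integrable_integrable[OF ru] square_integrable_integrable[OF rv] Ru(2) Rv(2) by simp
    note g = gaussian_conditional_moments[OF slepian_gp _ endpoints uv gcl _ 1 3 4]
    show "(LINT w|\<kappa> z. c * w u + e * w v) = (c * ((t\<^sub>1 - u) / (t\<^sub>1 - t\<^sub>0)) + e * ((t\<^sub>1 - v) / (t\<^sub>1 - t\<^sub>0))) * fst z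
        + (c * ((u - t\<^sub>0) / (t\<^sub>1 - t\<^sub>0)) + e * ((v - t\<^sub>0) / (t\<^sub>1 - t\<^sub>0))) * snd z"
      by (rule g(1)[OF cont slepian_endpoints_support])
    have Kuu: "covariance M (bridge_residual u) (bridge_residual u) = K u u"
      and Kuv: "covariance M (bridge_residual u) (bridge_residual v) = K u v"
      and Kvv: "covariance M (bridge_residual v) (bridge_residual v) = K v v"
      unfolding K_def using Ru(5)[of u] Ru(5)[of v] Rv(5)[of v] u v by simp_all
    have "covariance M ?R ?R = c\<^sup>2 * K u u + 2 * c * e * K u v + e\<^sup>2 * K v v"
      unfolding 2[OF square_integrable_add[OF square_integrable_scale[OF ru] square_integrable_scale[OF rv]]]
        covariance_commute[of M _ ?R] 2[OF ru] 2[OF rv]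
        covariance_commute[of M "bridge_residual v" "bridge_residual u"] Kuu Kuv Kvv
      by (simp add: power2_eq_square algebra_simps)
    then show "covariance (\<kappa> z) (\<lambda>w. c * w u + e * w v) (\<lambda>w. c * w u + e * w v)
        = c\<^sup>2 * K u u + 2 * c * e * K u v + e\<^sup>2 * K v v"
      using g(2)[OF cont slepian_endpoints_support] by simp
  qed
  show "(LINT w|\<kappa> z. w u) = ((t\<^sub>1 - u) * fst z + (u - t\<^sub>0) * snd z) / (t\<^sub>1 - t\<^sub>0)"
    using mom(1)[of 1 0] by (simp add: add_divide_distrib)
  have su: "square_integrable (\<kappa> z) (\<lambda>w. w u)" and sv: "square_integrable (\<kappa> z) (\<lambda>w. w v)"
    using lin_span_square_integrable[OF gk] lin_span_base[OF uv(1), of "\<lambda>u w. w u"] lin_span_base[OF uv(2), of "\<lambda>u w. w u"]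
    by auto
  have "covariance (\<kappa> z) (\<lambda>w. 1 * w u + 1 * w v) (\<lambda>w. 1 * w u + 1 * w v)
     = covariance (\<kappa> z) (\<lambda>w. w u) (\<lambda>w. w u) + 2 * covariance (\<kappa> z) (\<lambda>w. w u) (\<lambda>w. w v) + covariance (\<kappa> z) (\<lambda>w. w v) (\<lambda>w. w v)"
    using su sv by (simp add: k.covariance_add_left k.covariance_add_right square_integrable_add
        covariance_commute[of "\<kappa> z" "\<lambda>w. w v" "\<lambda>w. w u"])
  then show "covariance (\<kappa> z) (\<lambda>w. w u) (\<lambda>w. w v) = 2 / q * (u - t\<^sub>0) * (t\<^sub>1 - v) / (t\<^sub>1 - t\<^sub>0)"
    using mom(2)[of 1 1] mom(2)[of 1 0] mom(2)[of 0 1] by (simp add: K_def)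
qed

end

section \<open>The integral over the crossing time\<close>

lemma std_normal_cdf:
  obtains \<Phi> :: "real \<Rightarrow> real"
  where "\<And>x. (\<Phi> has_real_derivative std_normal_density x) (at x)"
    and "(\<Phi> \<longlongrightarrow> 1) at_top" and "(\<Phi> \<longlongrightarrow> 0) at_bot"
proof -
  interpret N: real_distribution std_normal_distribution by (rule real_dist_normal_dist)
  define \<Phi> where "\<Phi> = cdf std_normal_distribution"
  have "(\<Phi> has_real_derivative std_normal_density x) (at x)" for x
  proof -
    define a where "a = x - 1"
    have cont: "continuous_on S std_normal_density" for S :: "real set"
      unfolding normal_density_def by (intro continuous_intros) auto
    have "\<Phi> y = \<Phi> a + integral {a..y} std_normal_density" if "a < y" for y
    proof -
      have "\<Phi> y - \<Phi> a = measure std_normal_distribution {a<..y}"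
        unfolding \<Phi>_def using that by (rule N.cdf_diff_eq)
      also have "\<dots> = (LINT t|lborel. indicator {a<..y} t * std_normal_density t)"
        by (subst measure_eq_emeasure_eq_ennreal)
           (auto simp: emeasure_density nn_integral_eq_integral mult.commute
             ennreal_mult'[symmetric] ennreal_indicator[symmetric]
             intro!: nn_integral_eq_integral integrable_real_mult_indicator integral_nonneg_AE simp del: ennreal_indicator)
      also have "\<dots> = (LINT t:{a..y}|lborel. std_normal_density t)"
        unfolding set_lebesgue_integral_def
        by (rule integral_cong_AE) (auto intro!: AE_I'[of "{a}"] simp: indicator_def)
      also have "\<dots> = integral {a..y} std_normal_density"
        by (rule set_borel_integral_eq_integral(2)) (rule borel_integrable_atLeastAtMost', rule cont)
      finally show ?thesis by simp
    qed
    moreover have "((\<lambda>y. \<Phi> a + integral {a..y} std_normal_density) has_real_derivative std_normal_density x) (at x)"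
    proof -
      have "((\<lambda>y. integral {a..y} std_normal_density) has_real_derivative std_normal_density x) (at x within {a..x+1})"
        by (rule integral_has_real_derivative[OF cont]) (auto simp: a_def)
      then have "((\<lambda>y. integral {a..y} std_normal_density) has_real_derivative std_normal_density x) (at x)"
        by (subst (asm) at_within_interior) (auto simp: a_def)
      then show ?thesis by (auto intro!: derivative_eq_intros)
    qed
    ultimately show ?thesis
      by (elim has_field_derivative_transform_within_open[where S = "{a<..}"]) (auto simp: a_def)
  qed
  moreover have "(\<Phi> \<longlongrightarrow> 1) at_top" "(\<Phi> \<longlongrightarrow> 0) at_bot"
    unfolding \<Phi>_def using N.cdf_lim_at_top_prob N.cdf_lim_at_bot by auto
  ultimately show ?thesis using that by blast
qed

text \<open>With \<open>v = sqrt ((h - s) / s)\<close>, \<open>k = sqrt (q / (2 * h))\<close>, \<open>y = k * (A * v - B / v)\<close> and \<open>w = k * (A * v + B / v)\<close>, the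
function \<open>\<Phi> y + exp (2 * k\<^sup>2 * A * B) * \<Phi> w\<close>, where \<open>\<Phi>\<close> is the standard normal distribution function, has
\<open>v\<close>-derivative \<open>2 * k * A\<close> times the normal density at \<open>y\<close>: since \<open>w\<^sup>2 = y\<^sup>2 + 4 * k\<^sup>2 * A * B\<close>, the densities
at \<open>y\<close> and \<open>w\<close> differ by exactly the factor in front of \<open>\<Phi> w\<close>, so the terms with \<open>B / v\<^sup>2\<close> cancel. As \<open>s\<close>
runs from \<open>0\<close> to \<open>h\<close>, \<open>y\<close> runs from \<open>\<infinity>\<close> to \<open>- \<infinity>\<close>, while \<open>w\<close> tends to \<open>\<infinity>\<close> at both ends.\<close>

lemma gaussian_bridge_integral:
  fixes q h A B :: real
  assumes q: "q > 0" and h: "h > 0" and A: "A > 0" and B: "B > 0"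
  shows "(LBINT s=0..h. 1 / sqrt ((h - s) * s ^ 3) * exp (- (q / 4) * (A\<^sup>2 / s + B\<^sup>2 / (h - s))))
     = 2 * sqrt pi / (sqrt (q * h) * A) * exp (- (q / 4) * ((A + B)\<^sup>2 / h))"
proof -
  obtain \<Phi> where \<Phi>: "\<And>x. (\<Phi> has_real_derivative std_normal_density x) (at x)"
    "(\<Phi> \<longlongrightarrow> 1) at_top" "(\<Phi> \<longlongrightarrow> 0) at_bot" by (rule std_normal_cdf) blast
  define k where "k = sqrt (q / (2 * h))"
  have k: "k > 0" "k\<^sup>2 = q / (2 * h)" using q h by (auto simp: k_def)
  define v where "v s = sqrt ((h - s) / s)" for s
  define y where "y s = k * (A * v s - B / v s)" for s
  define w where "w s = k * (A * v s + B / v s)" for s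
  define E where "E = exp (2 * k\<^sup>2 * A * B)"
  \<comment> \<open>the factor by which the derivative of \<open>- (\<Phi> (y s) + E * \<Phi> (w s))\<close> falls short of the integrand\<close>
  define K where "K = sqrt (2 * pi) / (k * A * h) * exp (- (q / 4) * ((A + B)\<^sup>2 / h))"
  define F where "F s = - K * (\<Phi> (y s) + E * \<Phi> (w s))" for s
  define f where "f s = 1 / sqrt ((h - s) * s ^ 3) * exp (- (q / 4) * (A\<^sup>2 / s + B\<^sup>2 / (h - s)))" for s
  have F': "(F has_real_derivative f s) (at s)" if s: "0 < s" "s < h" for s
  proof -
    have v: "v s > 0" "(v s)\<^sup>2 = (h - s) / s" using s by (auto simp: v_def)
    have "((\<lambda>s. (h - s) / s) has_real_derivative - (h / s\<^sup>2)) (at s)"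
      using s by (auto intro!: derivative_eq_intros simp: field_simps power2_eq_square)
    from DERIV_chain2[OF DERIV_real_sqrt this] have "(v has_real_derivative inverse (v s) / 2 * - (h / s\<^sup>2)) (at s)"
      unfolding v_def using s by simp
    then have v': "(v has_real_derivative - (h / (2 * s\<^sup>2 * v s))) (at s)"
      using s v by (simp add: field_simps)
    define v1 where "v1 = - (h / (2 * s\<^sup>2 * v s))"
    have y': "(y has_real_derivative k * (A + B / (v s)\<^sup>2) * v1) (at s)"
      unfolding y_def using v v'[folded v1_def]
      by (auto intro!: derivative_eq_intros simp: field_simps power2_eq_square)
    have w': "(w has_real_derivative k * (A - B / (v s)\<^sup>2) * v1) (at s)"
      unfolding w_def using v v'[folded v1_def]
      by (auto intro!: derivative_eq_intros simp: field_simps power2_eq_square)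
    have "((\<lambda>s. \<Phi> (y s)) has_real_derivative std_normal_density (y s) * (k * (A + B / (v s)\<^sup>2) * v1)) (at s)"
      by (rule DERIV_chain2[OF \<Phi>(1) y'])
    moreover have "((\<lambda>s. \<Phi> (w s)) has_real_derivative std_normal_density (w s) * (k * (A - B / (v s)\<^sup>2) * v1)) (at s)"
      by (rule DERIV_chain2[OF \<Phi>(1) w'])
    ultimately have F1: "(F has_real_derivative - K * (std_normal_density (y s) * (k * (A + B / (v s)\<^sup>2) * v1)
        + E * (std_normal_density (w s) * (k * (A - B / (v s)\<^sup>2) * v1)))) (at s)"
      unfolding F_def by (intro DERIV_cmult DERIV_add) 
    have "(w s)\<^sup>2 = (y s)\<^sup>2 + 4 * k\<^sup>2 * A * B"
      using v(1) unfolding w_def y_def by (simp add: field_simps power2_eq_square)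
    then have Ew: "E * std_normal_density (w s) = std_normal_density (y s)"
      unfolding std_normal_density_def E_def by (simp add: field_simps flip: exp_add)
    have "- K * (std_normal_density (y s) * (k * (A + B / (v s)\<^sup>2) * v1)
        + E * (std_normal_density (w s) * (k * (A - B / (v s)\<^sup>2) * v1)))
       = - K * std_normal_density (y s) * (2 * k * A * v1)"
    proof -
      have "E * (std_normal_density (w s) * (k * (A - B / (v s)\<^sup>2) * v1))
          = std_normal_density (y s) * (k * (A - B / (v s)\<^sup>2) * v1)" unfolding Ew[symmetric] by simp
      then show ?thesis by (simp add: algebra_simps)
    qed
    also have "\<dots> = K * std_normal_density (y s) * k * A * h / (s\<^sup>2 * v s)"
      using s v by (simp add: v1_def field_simps)
    also have "\<dots> = exp (- (q / 4) * ((A + B)\<^sup>2 / h)) * exp (- (y s)\<^sup>2 / 2) / (s\<^sup>2 * v s)"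
      unfolding K_def std_normal_density_def using k A h by (simp add: field_simps)
    also have "s\<^sup>2 * v s = sqrt ((h - s) * s ^ 3)"
    proof -
      have "s\<^sup>2 * v s = sqrt ((s\<^sup>2)\<^sup>2 * ((h - s) / s))" unfolding real_sqrt_mult v_def by (simp only: real_sqrt_abs) simp
      also have "(s\<^sup>2)\<^sup>2 * ((h - s) / s) = (h - s) * s ^ 3"
        using s by (simp add: field_simps power2_eq_square power3_eq_cube)
      finally show ?thesis .
    qed
    also have "exp (- (q / 4) * ((A + B)\<^sup>2 / h)) * exp (- (y s)\<^sup>2 / 2) = exp (- (q / 4) * (A\<^sup>2 / s + B\<^sup>2 / (h - s)))"
    proof -
      have "(y s)\<^sup>2 / 2 = (q / (4 * h)) * (A * v s - B / v s)\<^sup>2"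
        by (simp add: y_def power_mult_distrib k)
      also have "(A * v s - B / v s)\<^sup>2 = A\<^sup>2 * (v s)\<^sup>2 + B\<^sup>2 / (v s)\<^sup>2 - 2 * A * B"
        using v(1) by (simp add: power2_eq_square field_simps)
      finally have e: "(y s)\<^sup>2 / 2 = q / (4 * h) * (A\<^sup>2 * (v s)\<^sup>2 + B\<^sup>2 / (v s)\<^sup>2 - 2 * A * B)" .
      have "(q / 4) * ((A + B)\<^sup>2 / h) + (y s)\<^sup>2 / 2
          = (q / (4 * h)) * ((A + B)\<^sup>2 + (A\<^sup>2 * (v s)\<^sup>2 + B\<^sup>2 / (v s)\<^sup>2 - 2 * A * B))"
        unfolding e distrib_left by simp
      also have "(A + B)\<^sup>2 + (A\<^sup>2 * (v s)\<^sup>2 + B\<^sup>2 / (v s)\<^sup>2 - 2 * A * B)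
          = A\<^sup>2 * (1 + (v s)\<^sup>2) + B\<^sup>2 * (1 + 1 / (v s)\<^sup>2)"
        by (simp add: power2_eq_square algebra_simps)
      also have "\<dots> = A\<^sup>2 * (1 + (h - s) / s) + B\<^sup>2 * (1 + s / (h - s))" by (simp add: v(2))
      finally have "(q / 4) * ((A + B)\<^sup>2 / h) + (y s)\<^sup>2 / 2
          = (q / (4 * h)) * (A\<^sup>2 * (1 + (h - s) / s) + B\<^sup>2 * (1 + s / (h - s)))" .
      also have "1 + (h - s) / s = h / s" using s by (simp add: field_simps)
      also have "1 + s / (h - s) = h / (h - s)" using s by (simp add: field_simps)
      also have "q / (4 * h) * (A\<^sup>2 * (h / s) + B\<^sup>2 * (h / (h - s))) = q / 4 * (A\<^sup>2 / s + B\<^sup>2 / (h - s))"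
        using h by (simp add: distrib_left)
      finally have e: "q / 4 * ((A + B)\<^sup>2 / h) + (y s)\<^sup>2 / 2 = q / 4 * (A\<^sup>2 / s + B\<^sup>2 / (h - s))" .
      from arg_cong[OF this, of uminus] have "- (q / 4) * ((A + B)\<^sup>2 / h) + - (y s)\<^sup>2 / 2 = - (q / 4) * (A\<^sup>2 / s + B\<^sup>2 / (h - s))"
        by (simp only: mult_minus_left minus_divide_left[symmetric] minus_add_distrib[symmetric])
      then show ?thesis by (simp only: exp_add[symmetric])
    qed
    finally show ?thesis using F1 by (simp add: f_def)
  qed
  have lims: "filterlim y at_top (at_right 0)" "filterlim w at_top (at_right 0)"
    "filterlim y at_bot (at_left h)" "filterlim w at_top (at_left h)"
    unfolding y_def[abs_def] w_def[abs_def] v_def using k(1) A B h by real_asymp+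
  have F0: "(F \<longlongrightarrow> - K * (1 + E * 1)) (at_right 0)"
    unfolding F_def by (intro tendsto_intros filterlim_compose[OF \<Phi>(2)] lims)
  have Fh: "(F \<longlongrightarrow> - K * (0 + E * 1)) (at_left h)"
    unfolding F_def by (intro tendsto_intros filterlim_compose[OF \<Phi>(2)] filterlim_compose[OF \<Phi>(3)] lims)
  have "(LBINT s=0..h. f s) = - K * (0 + E * 1) - (- K * (1 + E * 1))"
  proof (rule interval_integral_FTC_nonneg(2))
    show "(0::ereal) < ereal h" using h by simp
    show "(F has_real_derivative f s) (at s)" if "0 < ereal s" "ereal s < ereal h" for s
      using F' that by simp
    show "isCont f s" if "0 < ereal s" "ereal s < ereal h" for s
      unfolding f_def using that by (intro continuous_intros) auto
    show "AE s in lborel. 0 < ereal s \<longrightarrow> ereal s < ereal h \<longrightarrow> 0 \<le> f s"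
      by (intro AE_I2) (simp add: f_def)
    show "((F \<circ> real_of_ereal) \<longlongrightarrow> - K * (1 + E * 1)) (at_right 0)"
      using F0 by (simp add: zero_ereal_def ereal_tendsto_simps)
    show "((F \<circ> real_of_ereal) \<longlongrightarrow> - K * (0 + E * 1)) (at_left (ereal h))"
      using Fh by (simp add: ereal_tendsto_simps)
  qed
  also have "\<dots> = K" by (simp add: algebra_simps)
  also have "K = 2 * sqrt pi / (sqrt (q * h) * A) * exp (- (q / 4) * ((A + B)\<^sup>2 / h))"
  proof -
    have "sqrt (2 * pi) / (k * A * h) = 2 * sqrt pi / (sqrt (q * h) * A)"
    proof -
      have "k * h = sqrt (q * h) / sqrt 2"
      proof -
        have "k * h = sqrt (q / (2 * h) * h\<^sup>2)" unfolding real_sqrt_mult k_def using h by simp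
        also have "q / (2 * h) * h\<^sup>2 = q * h / 2" using h by (simp add: power2_eq_square)
        finally show ?thesis by (simp add: real_sqrt_divide)
      qed
      then have e: "sqrt (q * h) = k * h * sqrt 2" by simp
      have e2: "2 * sqrt pi / (sqrt (q * h) * A) = (sqrt 2 * sqrt 2) * sqrt pi / (k * h * sqrt 2 * A)"
        unfolding e by simp
      have "(x * x) * sqrt pi / (k * h * x * A) = x * sqrt pi / (k * h * A)" if "x \<noteq> 0" for x
        using that by simp
      from this[of "sqrt 2"] have "(sqrt 2 * sqrt 2) * sqrt pi / (k * h * sqrt 2 * A) = sqrt 2 * sqrt pi / (k * h * A)"
        by (metis real_sqrt_eq_zero_cancel_iff zero_neq_numeral)
      then show ?thesis unfolding e2 by (simp only: real_sqrt_mult mult_ac)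
    qed
    then show ?thesis by (simp add: K_def)
  qed
  finally show ?thesis by (simp add: f_def)
qed

text \<open>Expanding the squares, the terms with the slope \<open>a\<close> do not depend on \<open>s\<close>: they amount to the constant \<open>c\<close>. The
remaining exponents combine by \<open>(A - B)\<^sup>2 - (A + B)\<^sup>2 = - 4 * A * B\<close>.\<close>

lemma slepian_bridge_integral:
  fixes q h a b x\<^sub>0 x\<^sub>1 :: real
  assumes q: "q > 0" and h: "h > 0" and x0: "x\<^sub>0 < b" and x1: "x\<^sub>1 < b + a * h"
  shows "sqrt (q * h) * (b - x\<^sub>0) / (2 * sqrt pi) * exp (q * (x\<^sub>1 - x\<^sub>0)\<^sup>2 / (4 * h)) *
           (LBINT s=0..h. 1 / sqrt ((h - s) * s ^ 3) *
              exp (- (q / 4) * ((b + a * s - x\<^sub>0)\<^sup>2 / s + (x\<^sub>1 - b - a * s)\<^sup>2 / (h - s))))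
        = exp (- (q * (b - x\<^sub>0) * (b + a * h - x\<^sub>1) / h))"
proof -
  define A where "A = b - x\<^sub>0"
  define B where "B = b + a * h - x\<^sub>1"
  have A: "A > 0" and B: "B > 0" using x0 x1 by (auto simp: A_def B_def)
  define c where "c = 2 * a * (A - B) + a\<^sup>2 * h"
  have "(LBINT s=0..h. 1 / sqrt ((h - s) * s ^ 3) *
              exp (- (q / 4) * ((b + a * s - x\<^sub>0)\<^sup>2 / s + (x\<^sub>1 - b - a * s)\<^sup>2 / (h - s))))
      = (LBINT s=0..h. exp (- (q / 4) * c) * (1 / sqrt ((h - s) * s ^ 3) * exp (- (q / 4) * (A\<^sup>2 / s + B\<^sup>2 / (h - s)))))"
  proof (rule interval_integral_cong)
    fix s assume "s \<in> einterval (min 0 (ereal h)) (max 0 (ereal h))"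
    then have s: "0 < s" "s < h" using h by (auto simp: einterval_def min_def max_def split: if_splits)
    have "(b + a * s - x\<^sub>0)\<^sup>2 / s = A\<^sup>2 / s + 2 * a * A + a\<^sup>2 * s"
      using s by (simp add: A_def field_simps power2_eq_square)
    moreover have "(x\<^sub>1 - b - a * s)\<^sup>2 / (h - s) = B\<^sup>2 / (h - s) - 2 * a * B + a\<^sup>2 * (h - s)"
    proof -
      have "(x\<^sub>1 - b - a * s)\<^sup>2 = B\<^sup>2 - 2 * a * B * (h - s) + a\<^sup>2 * (h - s) * (h - s)"
        by (simp add: B_def algebra_simps power2_eq_square)
      then show ?thesis using s by (simp add: add_divide_distrib diff_divide_distrib)
    qed
    ultimately have "(b + a * s - x\<^sub>0)\<^sup>2 / s + (x\<^sub>1 - b - a * s)\<^sup>2 / (h - s) = c + (A\<^sup>2 / s + B\<^sup>2 / (h - s))"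
      by (simp add: c_def algebra_simps)
    then have e: "exp (- (q / 4) * ((b + a * s - x\<^sub>0)\<^sup>2 / s + (x\<^sub>1 - b - a * s)\<^sup>2 / (h - s)))
       = exp (- (q / 4) * c) * exp (- (q / 4) * (A\<^sup>2 / s + B\<^sup>2 / (h - s)))"
      by (simp only: distrib_left exp_add)
    show "1 / sqrt ((h - s) * s ^ 3) * exp (- (q / 4) * ((b + a * s - x\<^sub>0)\<^sup>2 / s + (x\<^sub>1 - b - a * s)\<^sup>2 / (h - s)))
       = exp (- (q / 4) * c) * (1 / sqrt ((h - s) * s ^ 3) * exp (- (q / 4) * (A\<^sup>2 / s + B\<^sup>2 / (h - s))))"
      unfolding e by (simp only: mult_ac)
  qed
  also have "\<dots> = exp (- (q / 4) * c) * (2 * sqrt pi / (sqrt (q * h) * A) * exp (- (q / 4) * ((A + B)\<^sup>2 / h)))"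
    unfolding interval_lebesgue_integral_mult_right gaussian_bridge_integral[OF q h A B] by simp
  finally have "sqrt (q * h) * (b - x\<^sub>0) / (2 * sqrt pi) * exp (q * (x\<^sub>1 - x\<^sub>0)\<^sup>2 / (4 * h)) *
           (LBINT s=0..h. 1 / sqrt ((h - s) * s ^ 3) *
              exp (- (q / 4) * ((b + a * s - x\<^sub>0)\<^sup>2 / s + (x\<^sub>1 - b - a * s)\<^sup>2 / (h - s))))
     = (sqrt (q * h) * A / (2 * sqrt pi) * (2 * sqrt pi / (sqrt (q * h) * A)))
       * (exp (q * (x\<^sub>1 - x\<^sub>0)\<^sup>2 / (4 * h)) * exp (- (q / 4) * c) * exp (- (q / 4) * ((A + B)\<^sup>2 / h)))"
    by (simp add: A_def mult_ac)
  also have "sqrt (q * h) * A / (2 * sqrt pi) * (2 * sqrt pi / (sqrt (q * h) * A)) = 1"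
    using q h A by simp
  also have "exp (q * (x\<^sub>1 - x\<^sub>0)\<^sup>2 / (4 * h)) * exp (- (q / 4) * c) * exp (- (q / 4) * ((A + B)\<^sup>2 / h))
      = exp (- (q * A * B / h))"
  proof -
    have e: "x\<^sub>1 - x\<^sub>0 = A - B + a * h" by (simp add: A_def B_def)
    have "q * (x\<^sub>1 - x\<^sub>0)\<^sup>2 / (4 * h) + - (q / 4) * c + - (q / 4) * ((A + B)\<^sup>2 / h) = - (q * A * B / h)"
      using h unfolding c_def e by (simp add: field_simps power2_eq_square)
    then show ?thesis by (simp only: exp_add[symmetric])
  qed
  finally show ?thesis by (simp add: A_def B_def)
qed

section \<open>The conditional crossing probability of the Slepian process\<close>

theorem theorem2p2:
  fixes M :: "'a measure" and W :: "real \<Rightarrow> 'a \<Rightarrow> real"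
    and \<kappa> :: "real \<times> real \<Rightarrow> (real \<Rightarrow> real) measure"
    and q d a b t\<^sub>0 t\<^sub>1 h x\<^sub>0 x\<^sub>1 :: real
  assumes "0 < q" and "q < d" and "d \<le> 2 * q"
    and "slepian_process M q d W"
    and "{t\<^sub>0..t\<^sub>1} \<subseteq> {q..d}" and "t\<^sub>0 < t\<^sub>1" and "h = t\<^sub>1 - t\<^sub>0"
    and "x\<^sub>0 < b" and "x\<^sub>1 < b + a * h"
    and "gaussian_conditional_law M {q..d} W t\<^sub>0 t\<^sub>1 \<kappa>"
  shows "measure (\<kappa> (x\<^sub>0, x\<^sub>1))
           {w \<in> space (path_space {q..d}). \<forall>t\<in>{t\<^sub>0..t\<^sub>1}. w t \<le> b + a * (t - t\<^sub>0)} =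
         1 - sqrt (q * h) * (b - x\<^sub>0) / (2 * sqrt pi) * exp (q * (x\<^sub>1 - x\<^sub>0)\<^sup>2 / (4 * h)) *
           (LBINT s=0..h. 1 / sqrt ((h - s) * s ^ 3) *
              exp (- (q / 4) * ((b + a * s - x\<^sub>0)\<^sup>2 / s + (x\<^sub>1 - b - a * s)\<^sup>2 / (h - s))))"
proof -
  define N where "N = \<kappa> (x\<^sub>0, x\<^sub>1)"
  note bridge = slepian_conditional_bridge[OF assms(1,3,4,5,6,10), of _ _ "(x\<^sub>0, x\<^sub>1)", folded N_def]
  have h: "h > 0" using assms by simp
  have gN: "gaussian_process N {q..d} (\<lambda>u w. w u)"
    using assms(10) unfolding gaussian_conditional_law_def N_def by blast
  interpret prob_space N using gN by (simp add: gaussian_process_def)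
  have "\<kappa> \<in> borel \<rightarrow>\<^sub>M prob_algebra (path_space {q..d})"
    using assms(10) by (simp add: gaussian_conditional_law_def regular_conditional_law_def)
  from measurable_space[OF this, of "(x\<^sub>0, x\<^sub>1)"] have setsN: "sets N = sets (path_space {q..d})"
    by (simp add: N_def space_prob_algebra)
  then have spN: "space N = space (path_space {q..d})" by (rule sets_eq_imp_space_eq)
  have inI: "t\<^sub>0 + t \<in> {q..d}" if "t \<in> {0..h}" for t using that assms(5,7) by auto
  have shift: "t\<^sub>1 - (t\<^sub>0 + t) = h - t" "t\<^sub>0 + t - t\<^sub>0 = t" "t\<^sub>1 - t\<^sub>0 = h" for t
    using assms(7) by auto
  define Y where "Y t w = w (t\<^sub>0 + t) - (b + a * t)" for t :: real and w :: "real \<Rightarrow> real"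
  have sp: "(\<lambda>w. w (t\<^sub>0 + t)) \<in> lin_span {q..d} (\<lambda>u w. w u)" if "t \<in> {0..h}" for t
    using lin_span_base[OF inI[OF that], of "\<lambda>u w. w u"] by simp
  have ig: "integrable N (\<lambda>w. w (t\<^sub>0 + t))" if "t \<in> {0..h}" for t
    using square_integrable_integrable[OF lin_span_square_integrable[OF gN sp[OF that]]] .
  have gpY: "gaussian_process N {0..h} Y"
    unfolding gaussian_process_def
  proof (intro conjI allI impI prob_space_axioms)
    fix F and c :: "real \<Rightarrow> real" assume F: "finite F \<and> F \<subseteq> {0..h}"
    have "(\<lambda>w. \<Sum>t\<in>F. c t * w (t\<^sub>0 + t)) \<in> lin_span {q..d} (\<lambda>u w. w u)"
      using F by (intro lin_span_sum lin_span_scale sp) auto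
    from gaussian_rv_shift[OF lin_span_gaussian[OF gN this], of "- (\<Sum>t\<in>F. c t * (b + a * t))"]
    show "gaussian_rv N (\<lambda>w. \<Sum>t\<in>F. c t * Y t w)"
      by (simp add: Y_def right_diff_distrib sum_subtractf)
  qed
  have Ycont: "continuous_on {0..h} (\<lambda>t. Y t w)" if "w \<in> space N" for w
  proof -
    have "continuous_on {q..d} w" using that unfolding spN path_space_def by (auto simp: space_restrict_space)
    moreover have "(\<lambda>t. t\<^sub>0 + t) ` {0..h} \<subseteq> {q..d}" using inI by blast
    ultimately have "continuous_on {0..h} (\<lambda>t. w (t\<^sub>0 + t))"
      using continuous_on_compose2[of "{q..d}" w "{0..h}" "\<lambda>t. t\<^sub>0 + t"] by (simp add: continuous_intros)
    then show ?thesis unfolding Y_def by (intro continuous_intros)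
  qed
  let ?C = "{w \<in> space N. \<exists>t\<in>{0..h}. Y t w > 0}"
  have "measure N ?C = exp (- 2 * (b - x\<^sub>0) * (b + a * h - x\<^sub>1) / (2 / q * h))"
  proof (rule brownian_bridge_crossing[OF gpY h])
    show "(LINT w|N. Y t w) = - ((b - x\<^sub>0) * (h - t) + (b + a * h - x\<^sub>1) * t) / h" if t: "t \<in> {0..h}" for t
    proof -
      have "(LINT w|N. Y t w) = (LINT w|N. w (t\<^sub>0 + t)) - (b + a * t)"
        unfolding Y_def using ig[OF t] by (simp add: prob_space)
      also have "(LINT w|N. w (t\<^sub>0 + t)) = ((h - t) * x\<^sub>0 + t * x\<^sub>1) / h"
        using bridge(1)[of "t\<^sub>0 + t" "t\<^sub>1", unfolded shift] t assms(7) by simp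
      finally show ?thesis using h by (simp add: field_simps)
    qed
    show "covariance N (Y s) (Y t) = 2 / q * s * (h - t) / h" if "0 \<le> s" "s \<le> t" "t \<le> h" for s t
    proof -
      have "covariance N (Y s) (Y t) = covariance N (\<lambda>w. w (t\<^sub>0 + s)) (\<lambda>w. w (t\<^sub>0 + t))"
        unfolding Y_def[abs_def] using that by (intro covariance_shift ig) auto
      also have "\<dots> = 2 / q * s * (h - t) / h"
        using bridge(2)[of "t\<^sub>0 + s" "t\<^sub>0 + t", unfolded shift] that assms(7) by simp
      finally show ?thesis .
    qed
  qed (use assms Ycont in auto)
  also have "- 2 * (b - x\<^sub>0) * (b + a * h - x\<^sub>1) / (2 / q * h) = - (q * (b - x\<^sub>0) * (b + a * h - x\<^sub>1) / h)"
    using assms(1) h by (simp add: field_simps)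
  also have "exp \<dots> = sqrt (q * h) * (b - x\<^sub>0) / (2 * sqrt pi) * exp (q * (x\<^sub>1 - x\<^sub>0)\<^sup>2 / (4 * h)) *
           (LBINT s=0..h. 1 / sqrt ((h - s) * s ^ 3) *
              exp (- (q / 4) * ((b + a * s - x\<^sub>0)\<^sup>2 / s + (x\<^sub>1 - b - a * s)\<^sup>2 / (h - s))))"
    by (rule slepian_bridge_integral[OF assms(1) h assms(8,9), symmetric])
  finally have C: "measure N ?C = \<dots>" .
  have "{w \<in> space (path_space {q..d}). \<forall>t\<in>{t\<^sub>0..t\<^sub>1}. w t \<le> b + a * (t - t\<^sub>0)} = space N - ?C"
  proof -
    have "(\<forall>t\<in>{t\<^sub>0..t\<^sub>1}. w t \<le> b + a * (t - t\<^sub>0)) \<longleftrightarrow> \<not> (\<exists>t\<in>{0..h}. Y t w > 0)" for w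
    proof
      assume "\<forall>t\<in>{t\<^sub>0..t\<^sub>1}. w t \<le> b + a * (t - t\<^sub>0)"
      then have "w (t\<^sub>0 + t) \<le> b + a * (t\<^sub>0 + t - t\<^sub>0)" if "t \<in> {0..h}" for t
        using that assms(7) by (intro bspec[where x = "t\<^sub>0 + t"]) auto
      then show "\<not> (\<exists>t\<in>{0..h}. Y t w > 0)" by (force simp: Y_def)
    next
      assume *: "\<not> (\<exists>t\<in>{0..h}. Y t w > 0)"
      show "\<forall>t\<in>{t\<^sub>0..t\<^sub>1}. w t \<le> b + a * (t - t\<^sub>0)"
      proof
        fix t assume "t \<in> {t\<^sub>0..t\<^sub>1}"
        then have "t - t\<^sub>0 \<in> {0..h}" using assms(7) by auto
        then have "\<not> Y (t - t\<^sub>0) w > 0" using * by blast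
        then show "w t \<le> b + a * (t - t\<^sub>0)" by (simp add: Y_def)
      qed
    qed
    then show ?thesis unfolding spN by blast
  qed
  moreover have "?C \<in> sets N"
    using gaussian_process_measurable[OF gpY] Ycont by (intro crossing_measurable h) auto
  ultimately show ?thesis unfolding N_def[symmetric] using prob_compl[of ?C] C by simp
qed

end
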